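(* Fix an integer $J\ge2$ and nonnegative integers $k_2,\dots,k_J$, not all zero, and let $\Gamma$ be the conjugacy class of $\mathcal{S}_n$ with cycle structure $(k_2,\dots,k_J)$. Let $(\sigma_t)_{t\ge0}$ be the continuous-time random walk on $\mathcal{S}_n$ with step distribution uniform on $\Gamma$, and let $$t_c=\Big(\sum_{j=2}^J j(j-1)k_j\Big)^{-1}.$$ (i) Let $0\le t<t_c$. Then there exists $\beta>0$ such that, with probability tending to $1$ as $n\to\infty$, no cycle of $\sigma_{tn}$ has size greater than $\beta\log n$. (ii) Let $t>t_c$. Then there exists $\delta>0$ such that $\mathbb{P}(\tau_\delta<tn)\to1$ as $n\to\infty$, where $\tau_\delta=\inf\{s\ge0:\Lambda(s)>\delta n\}$ and $\Lambda(s)$ is the size of the largest cycle of $\sigma_s$.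
   Context: $\mathcal{S}_n$ is the group of permutations of $\{1,\dots,n\}$. The conjugacy class with cycle structure $(k_2,\dots,k_J)$ is the set of permutations whose cycle decomposition has exactly $k_j$ cycles of length $j$ for each $2\le j\le J$, all other points being fixed; the numbers $J,k_2,\dots,k_J$ do not depend on $n$, and $n$ is large enough for the class to be nonempty. The walk is $\sigma_t=\gamma_1\cdot\ldots\cdot\gamma_{N_t}$, where $(\gamma_i)_{i\ge1}$ are i.i.d. uniform on $\Gamma$ and $(N_t)_{t\ge0}$ is an independent Poisson process of rate 1. *)

theory Defs
  imports "HOL-Probability.Probability" "HOL-Combinatorics.Combinatorics"
begin

section \<open>Cycles and conjugacy classes in the symmetric group\<close>

text \<open>Permutations of \<open>{1..n}\<close> are functions \<open>p\<close> with \<open>p permutes {1..n}\<close>. A cycle is represented by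
  its support, an orbit; fixed points are cycles of size 1.\<close>

definition perm_cycles :: "nat \<Rightarrow> (nat \<Rightarrow> nat) \<Rightarrow> nat set set" where
  "perm_cycles n p = orbit p ` {1..n}"

text \<open>Only the values \<open>k j\<close> for \<open>2 \<le> j \<le> J\<close> matter.\<close>

definition cycle_class :: "nat \<Rightarrow> (nat \<Rightarrow> nat) \<Rightarrow> nat \<Rightarrow> (nat \<Rightarrow> nat) set" where
  "cycle_class J k n =
     {p. p permutes {1..n} \<and>
         (\<forall>j\<in>{2..J}. card {c \<in> perm_cycles n p. card c = j} = k j) \<and>
         (\<forall>x\<in>{1..n}. card (orbit p x) \<notin> {2..J} \<longrightarrow> p x = x)}"

text \<open>Meaningful for \<open>n \<ge> 1\<close> only (\<open>Max\<close> of the empty set is unspecified).\<close>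

definition largest_cycle :: "nat \<Rightarrow> (nat \<Rightarrow> nat) \<Rightarrow> nat" where
  "largest_cycle n p = Max (card ` perm_cycles n p)"

definition critical_time :: "nat \<Rightarrow> (nat \<Rightarrow> nat) \<Rightarrow> real" where
  "critical_time J k = inverse (\<Sum>j=2..J. real (j * (j - 1) * k j))"

section \<open>The continuous-time random walk\<close>

text \<open>A Poisson process, as a counting process all of whose paths start at 0, are nondecreasing
  and right-continuous. The truncated subtraction on \<^typ>\<open>nat\<close> is harmless by monotonicity.\<close>

locale poisson_process = prob_space M
  for M :: "'a measure" and rate :: real and N :: "real \<Rightarrow> 'a \<Rightarrow> nat" +
  assumes rate_pos: "0 < rate"
    and measurable_N: "\<And>t. 0 \<le> t \<Longrightarrow> N t \<in> measurable M (count_space UNIV)"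
    and N_zero: "\<And>\<omega>. \<omega> \<in> space M \<Longrightarrow> N 0 \<omega> = 0"
    and mono_N: "\<And>\<omega>. \<omega> \<in> space M \<Longrightarrow> mono_on {0..} (\<lambda>t. N t \<omega>)"
    and right_continuous_N:
      "\<And>\<omega> t. \<omega> \<in> space M \<Longrightarrow> 0 \<le> t \<Longrightarrow> continuous (at_right t) (\<lambda>s. N s \<omega>)"
    and increments_poisson:
      "\<And>s t. 0 \<le> s \<Longrightarrow> s < t \<Longrightarrow>
         distr M (count_space UNIV) (\<lambda>\<omega>. N t \<omega> - N s \<omega>) =
         measure_pmf (poisson_pmf (rate * (t - s)))"
    and increments_indep:
      "\<And>(m :: nat) (T :: nat \<Rightarrow> real). 0 \<le> T 0 \<Longrightarrow> (\<And>i. i < m \<Longrightarrow> T i \<le> T (Suc i)) \<Longrightarrow>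
         indep_vars (\<lambda>_. count_space UNIV) (\<lambda>i \<omega>. N (T (Suc i)) \<omega> - N (T i) \<omega>) {..<m}"

text \<open>The steps \<open>\<gamma> i\<close> are indexed by \<open>i \<ge> 1\<close>. The last assumption says that the \<open>\<sigma>\<close>-algebras
  generated by the whole step sequence and by the whole Poisson process are independent;
  \<open>indep_var\<close> does not apply, because the two random objects have different types.\<close>

locale uniform_step_walk = poisson_process M 1 N
  for M :: "'a measure" and N :: "real \<Rightarrow> 'a \<Rightarrow> nat" +
  fixes \<Gamma> :: "(nat \<Rightarrow> nat) set" and \<gamma> :: "nat \<Rightarrow> 'a \<Rightarrow> (nat \<Rightarrow> nat)"
  assumes steps_indep: "indep_vars (\<lambda>_. count_space \<Gamma>) \<gamma> {1..}"
    and steps_uniform: "\<And>i. 1 \<le> i \<Longrightarrow> distr M (count_space \<Gamma>) (\<gamma> i) = uniform_count_measure \<Gamma>"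
    and steps_indep_clock:
      "indep_set
         (sets (vimage_algebra (space M) (\<lambda>\<omega>. \<lambda>i\<in>{1..}. \<gamma> i \<omega>) (\<Pi>\<^sub>M i\<in>{1..}. count_space \<Gamma>)))
         (sets (vimage_algebra (space M) (\<lambda>\<omega>. \<lambda>t\<in>{0..}. N t \<omega>) (\<Pi>\<^sub>M t\<in>{0..}. count_space UNIV)))"

text \<open>The product \<open>\<gamma> 1 \<circ> \<dots> \<circ> \<gamma> (N t)\<close>, with empty product \<open>id\<close>.\<close>

definition walk :: "(nat \<Rightarrow> 'a \<Rightarrow> (nat \<Rightarrow> nat)) \<Rightarrow> (real \<Rightarrow> 'a \<Rightarrow> nat) \<Rightarrow> real \<Rightarrow> 'a \<Rightarrow> (nat \<Rightarrow> nat)"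
where
  "walk \<gamma> N t \<omega> = foldr (\<circ>) (map (\<lambda>i. \<gamma> i \<omega>) [1..<Suc (N t \<omega>)]) id"

text \<open>Extended-real valued, so that the infimum of the empty set is \<open>\<infinity>\<close>.\<close>

definition giant_cycle_time :: "nat \<Rightarrow> (real \<Rightarrow> 'a \<Rightarrow> (nat \<Rightarrow> nat)) \<Rightarrow> real \<Rightarrow> 'a \<Rightarrow> ereal" where
  "giant_cycle_time n \<sigma> \<delta> \<omega> =
     Inf {ereal s |s. 0 \<le> s \<and> real (largest_cycle n (\<sigma> s \<omega>)) > \<delta> * real n}"

end

theory Submission
  imports Defs "HOL-Real_Asymp.Real_Asymp"
begin

text \<open>Every cycle of the product of the first steps lies in a component of the hypergraph whose edges
  are the cycles of these steps. A new step behaves, up to an error of order \<open>1/n\<close>, like cycles whose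
  points are thrown independently, so that the averages of \<open>exp (\<lambda> |C|) - 1\<close> and \<open>1 - exp (- \<lambda> |C|)\<close>
  over the components \<open>C\<close> of the points satisfy a Burgers-type equation in \<open>\<lambda>\<close> and time. If \<open>\<lambda>\<close> decreases at a suitable linear
  rate, the first one is almost a supermartingale and the second one almost a submartingale.

  Before the critical time the first one stays bounded, which gives components of size \<open>O(log n)\<close>;
  the classes of bounded size are controlled by concentration of the bounded increments and the
  others by a first moment bound. After the critical time the second one stays bounded below even
  as \<open>\<lambda>\<close> becomes small: a positive fraction of the points lies in large components, and a few more
  steps join them to a giant component. From then on a linear number of the transpositions that
  make up the steps are redundant for connectivity, so the number of components is larger by a linear
  amount than if each transposition joined two components. But if no cycle ever exceeded \<open>\<delta>n\<close>, then
  almost every step would join distinct cycles, and there would finally be fewer cycles than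
  components.\<close>

section \<open>Sequences of independent uniform choices\<close>

text \<open>Components are followed instead of cycles because they only grow, while a step may also
  split cycles. Along a linear decrease of \<lambda> the loss per step is essentially the speed
  times the derivative of the functional in \<lambda>, and the expected gain from merging is the
  same derivative times \<open>growth\<close> of its value. So below the critical time the speed has
  to dominate \<open>growth\<close>, and above it to stay below \<open>decay\<close>. Both have
  slope \<open>\<kappa>\<close>, the inverse critical time, at 0; this decides whether \<lambda>,
  started at a small value, can remain positive up to the given time.

  The exponential moment has no useful bound on its jumps, hence the cut-off at size
  \<open>B\<close>; the larger classes get an exponent smaller by \<open>2 * \<eta>\<close>, and
  this gap pays for small classes that jointly cross \<open>B\<close>. The supercritical functional
  is bounded and is used without a cut-off.

  For (ii) some time before \<open>t * n\<close> suffices, so it is enough to refute that all cycles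
  stay small throughout; and while they do, only a small proportion of the steps can split a
  cycle.\<close>

definition avg :: "'a set \<Rightarrow> ('a \<Rightarrow> real) \<Rightarrow> real" where
  "avg S f = (\<Sum>x\<in>S. f x) / real (card S)"

lemma avg_mono: "(\<And>x. x \<in> S \<Longrightarrow> f x \<le> g x) \<Longrightarrow> avg S f \<le> avg S g"
  by (auto simp: avg_def intro!: divide_right_mono sum_mono)

lemma avg_cong: "(\<And>x. x \<in> S \<Longrightarrow> f x = g x) \<Longrightarrow> avg S f = avg S g"
  by (auto simp: avg_def)

lemma avg_nonneg: "(\<And>x. x \<in> S \<Longrightarrow> 0 \<le> f x) \<Longrightarrow> 0 \<le> avg S f"
  by (auto simp: avg_def intro!: divide_nonneg_nonneg sum_nonneg)

lemma avg_const [simp]: "finite S \<Longrightarrow> S \<noteq> {} \<Longrightarrow> avg S (\<lambda>_. c) = c"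
  by (auto simp: avg_def)

lemma avg_add: "avg S (\<lambda>x. f x + g x) = avg S f + avg S g"
  by (simp add: avg_def sum.distrib add_divide_distrib)

lemma avg_diff: "avg S (\<lambda>x. f x - g x) = avg S f - avg S g"
  by (simp add: avg_def sum_subtractf diff_divide_distrib)

lemma avg_cmult: "avg S (\<lambda>x. c * f x) = c * avg S f"
  by (simp add: avg_def sum_distrib_left)

lemma avg_cmult_right: "avg S (\<lambda>x. f x * c) = avg S f * c"
  by (simp add: avg_def sum_distrib_right)

lemma avg_sum: "avg S (\<lambda>x. \<Sum>i\<in>I. f i x) = (\<Sum>i\<in>I. avg S (f i))"
  unfolding avg_def by (subst sum.swap) (simp add: sum_divide_distrib)

lemma avg_le_const:
  "finite S \<Longrightarrow> S \<noteq> {} \<Longrightarrow> (\<And>x. x \<in> S \<Longrightarrow> f x \<le> c) \<Longrightarrow> avg S f \<le> c"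
  using avg_mono[of S f "\<lambda>_. c"] by simp

lemma avg_ge_const:
  "finite S \<Longrightarrow> S \<noteq> {} \<Longrightarrow> (\<And>x. x \<in> S \<Longrightarrow> c \<le> f x) \<Longrightarrow> c \<le> avg S f"
  using avg_mono[of S "\<lambda>_. c" f] by simp

lemma avg_swap: "avg A (\<lambda>x. avg B (\<lambda>y. f x y)) = avg B (\<lambda>y. avg A (\<lambda>x. f x y))"
  unfolding avg_def
  by (simp add: sum_divide_distrib[symmetric] sum.swap[of _ A] ac_simps divide_divide_eq_left)

text \<open>Independence of the coordinates of a uniform function; coordinates outside
  \<open>O'\<close> enter as factors 1.\<close>

lemma avg_PiE_prod:
  assumes "finite Y" "finite V" "V \<noteq> {}" "O' \<subseteq> Y"
  shows "avg (Y \<rightarrow>\<^sub>E V) (\<lambda>x. \<Prod>y\<in>O'. f y (x y)) = (\<Prod>y\<in>O'. avg V (f y))"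
proof -
  let ?f = "\<lambda>y v. if y \<in> O' then f y v else 1"
  have "(\<Sum>x\<in>Y \<rightarrow>\<^sub>E V. \<Prod>y\<in>O'. f y (x y)) = (\<Sum>x\<in>Y \<rightarrow>\<^sub>E V. \<Prod>y\<in>Y. ?f y (x y))"
    using assms by (intro sum.cong refl prod.mono_neutral_cong_left) auto
  also have "\<dots> = (\<Prod>y\<in>Y. \<Sum>v\<in>V. ?f y v)"
    using assms by (subst prod_sum_PiE) auto
  finally have "avg (Y \<rightarrow>\<^sub>E V) (\<lambda>x. \<Prod>y\<in>O'. f y (x y)) = (\<Prod>y\<in>Y. (\<Sum>v\<in>V. ?f y v) / real (card V))"
    using assms by (simp add: avg_def card_PiE prod_dividef)
  also have "\<dots> = (\<Prod>y\<in>O'. avg V (f y))"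
    using assms by (intro prod.mono_neutral_cong_right) (auto simp: avg_def)
  finally show ?thesis .
qed

lemma avg_PiE_insert:
  assumes "finite Y" "finite V" "s \<notin> Y"
  shows "avg (insert s Y \<rightarrow>\<^sub>E V) F = avg (Y \<rightarrow>\<^sub>E V) (\<lambda>x. avg V (\<lambda>v. F (x(s := v))))"
proof -
  have "(\<Sum>x\<in>insert s Y \<rightarrow>\<^sub>E V. F x) = (\<Sum>(v, x)\<in>V \<times> (Y \<rightarrow>\<^sub>E V). F (x(s := v)))"
    unfolding PiE_insert_eq using assms
    using inj_combinator[of s Y "\<lambda>_. V"] by (subst sum.reindex) (auto simp: case_prod_unfold)
  also have "\<dots> = (\<Sum>x\<in>Y \<rightarrow>\<^sub>E V. \<Sum>v\<in>V. F (x(s := v)))"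
    by (subst sum.swap) (simp add: sum.cartesian_product)
  finally show ?thesis
    using assms by (simp add: avg_def card_PiE sum_divide_distrib divide_divide_eq_left)
qed

text \<open>The value at one coordinate is averaged out first, the other coordinates being frozen.\<close>

lemma avg_PiE_fun_upd_le:
  assumes "finite Y" "finite V" "V \<noteq> {}" "s \<in> Y"
    and "\<And>x. x \<in> Y \<rightarrow>\<^sub>E V \<Longrightarrow> avg V (\<lambda>v. F (x(s := v))) \<le> G x"
    and "\<And>x v. x \<in> Y \<rightarrow>\<^sub>E V \<Longrightarrow> v \<in> V \<Longrightarrow> G (x(s := v)) = G x"
  shows "avg (Y \<rightarrow>\<^sub>E V) F \<le> avg (Y \<rightarrow>\<^sub>E V) G"
proof -
  obtain Z where Z: "Y = insert s Z" "s \<notin> Z" "finite Z"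
    using assms(1,4) by (metis mk_disjoint_insert finite_insert)
  have mem: "x(s := v) \<in> Y \<rightarrow>\<^sub>E V" if "x \<in> Z \<rightarrow>\<^sub>E V" "v \<in> V" for x v
    using that Z by (auto simp: PiE_iff extensional_def)
  have "avg V (\<lambda>v. F (x(s := v))) \<le> avg V (\<lambda>v. G (x(s := v)))" if x: "x \<in> Z \<rightarrow>\<^sub>E V" for x
  proof -
    obtain w where w: "w \<in> V" using assms(3) by auto
    have "avg V (\<lambda>v. F (x(s := v))) = avg V (\<lambda>v. F ((x(s := w))(s := v)))" by simp
    also have "\<dots> \<le> G (x(s := w))" by (rule assms(5)[OF mem[OF x w]])
    also have "\<dots> = avg V (\<lambda>v. G (x(s := w)))" using assms by simp
    also have "\<dots> = avg V (\<lambda>v. G (x(s := v)))"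
      using assms(6)[OF mem[OF x w]] by (intro avg_cong) (metis fun_upd_upd)
    finally show ?thesis .
  qed
  then show ?thesis
    unfolding Z(1) using Z assms by (simp add: avg_PiE_insert) (rule avg_mono)
qed

text \<open>Conditional probability of \<open>Q\<close> given the prefix \<open>xs\<close>, when
  \<open>r\<close> further independent uniform elements of \<open>S\<close> are appended. Carrying
  the prefix along makes conditioning on the past a plain recursion, without a product
  measure.\<close>

fun pr :: "'a set \<Rightarrow> nat \<Rightarrow> 'a list \<Rightarrow> ('a list \<Rightarrow> bool) \<Rightarrow> real" where
  "pr S 0 xs Q = of_bool (Q xs)"
| "pr S (Suc r) xs Q = avg S (\<lambda>g. pr S r (xs @ [g]) Q)"

lemma pr_nonneg: "0 \<le> pr S r xs Q"
  by (induction r arbitrary: xs) (auto intro: avg_nonneg)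

lemma pr_le_1: "finite S \<Longrightarrow> S \<noteq> {} \<Longrightarrow> pr S r xs Q \<le> 1"
  by (induction r arbitrary: xs) (auto intro: avg_le_const)

lemma pr_mono:
  assumes "\<And>ys. length ys = r \<Longrightarrow> set ys \<subseteq> S \<Longrightarrow> Q (xs @ ys) \<Longrightarrow> R (xs @ ys)"
  shows "pr S r xs Q \<le> pr S r xs R"
  using assms
proof (induction r arbitrary: xs)
  case (Suc r)
  have "pr S r (xs @ [g]) Q \<le> pr S r (xs @ [g]) R" if "g \<in> S" for g
    using Suc.prems[of "g # _"] that by (intro Suc.IH) auto
  then show ?case by (auto intro: avg_mono)
qed auto

lemma pr_False: "(\<And>ys. length ys = r \<Longrightarrow> set ys \<subseteq> S \<Longrightarrow> \<not> Q (xs @ ys)) \<Longrightarrow> pr S r xs Q = 0"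
proof (induction r arbitrary: xs)
  case (Suc r)
  have "pr S r (xs @ [g]) Q = 0" if "g \<in> S" for g
    using Suc.prems[of "g # _"] that by (intro Suc.IH) auto
  then show ?case by (auto simp: avg_def)
qed auto

lemma pr_disj: "pr S r xs (\<lambda>ys. Q ys \<or> R ys) \<le> pr S r xs Q + pr S r xs R"
  by (induction r arbitrary: xs) (auto simp: avg_add[symmetric] intro: avg_mono)

lemma pr_finite_union:
  "finite I \<Longrightarrow> pr S r xs (\<lambda>ys. \<exists>i\<in>I. Q i ys) \<le> (\<Sum>i\<in>I. pr S r xs (Q i))"
proof (induction I rule: finite_induct)
  case empty
  then show ?case by (simp add: pr_False)
next
  case (insert i I)
  have "pr S r xs (\<lambda>ys. \<exists>i\<in>insert i I. Q i ys) = pr S r xs (\<lambda>ys. Q i ys \<or> (\<exists>i\<in>I. Q i ys))"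
    by (rule arg_cong[where f = "pr S r xs"]) auto
  then show ?case using insert pr_disj[of S r xs "Q i" "\<lambda>ys. \<exists>i\<in>I. Q i ys"] by simp
qed

text \<open>Conditioning on the list after the first \<open>r1\<close> steps: outside
  \<open>R\<close> the second phase is bounded by 1, inside it by \<open>b\<close>. This chains
  successive phases of the walk.\<close>

lemma pr_append_le:
  assumes S: "finite S" "S \<noteq> {}" and b: "0 \<le> b"
    and "\<And>ys. length ys = r1 \<Longrightarrow> set ys \<subseteq> S \<Longrightarrow> R (xs @ ys) \<Longrightarrow> pr S r2 (xs @ ys) Q \<le> b"
  shows "pr S (r1 + r2) xs Q \<le> pr S r1 xs (\<lambda>zs. \<not> R zs) + b"
  using assms(4)
proof (induction r1 arbitrary: xs)
  case 0
  then show ?case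
    using 0[of "[]"] pr_le_1[OF S, of r2 xs Q] b by (cases "R xs") auto
next
  case (Suc r)
  have "pr S (r + r2) (xs @ [g]) Q \<le> pr S r (xs @ [g]) (\<lambda>zs. \<not> R zs) + b" if "g \<in> S" for g
    using Suc.prems[of "g # _"] that by (intro Suc.IH) auto
  then have "avg S (\<lambda>g. pr S (r + r2) (xs @ [g]) Q)
      \<le> avg S (\<lambda>g. pr S r (xs @ [g]) (\<lambda>zs. \<not> R zs) + b)"
    by (rule avg_mono)
  then show ?case using S by (simp add: avg_add)
qed

text \<open>Counting form of the recursion, the bridge to the law of the actual steps.\<close>

lemma pr_eq_avg:
  assumes "finite S" "S \<noteq> {}"
  shows "pr S r xs Q = (\<Sum>ys | length ys = r \<and> set ys \<subseteq> S. of_bool (Q (xs @ ys)) / real (card S) ^ r)"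
proof (induction r arbitrary: xs)
  case 0
  have "{ys. length ys = 0 \<and> set ys \<subseteq> S} = {[]}" by auto
  then show ?case by (simp add: Collect_conv_if)
next
  case (Suc r)
  have "{ys. length ys = Suc r \<and> set ys \<subseteq> S} =
      (\<lambda>(g, ys). g # ys) ` (S \<times> {ys. length ys = r \<and> set ys \<subseteq> S})"
    by (auto simp: length_Suc_conv image_iff)
  then have "(\<Sum>ys | length ys = Suc r \<and> set ys \<subseteq> S. of_bool (Q (xs @ ys)) / real (card S) ^ Suc r)
     = (\<Sum>(g, ys)\<in>S \<times> {ys. length ys = r \<and> set ys \<subseteq> S}.
          of_bool (Q ((xs @ [g]) @ ys)) / real (card S) ^ Suc r)"
    by (simp add: sum.reindex inj_on_def case_prod_unfold)
  also have "\<dots> = (\<Sum>g\<in>S. (\<Sum>ys | length ys = r \<and> set ys \<subseteq> S.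
          of_bool (Q ((xs @ [g]) @ ys)) / real (card S) ^ r) / real (card S))"
    by (simp add: sum.cartesian_product sum_divide_distrib ac_simps)
  finally show ?case
    by (simp add: avg_def Suc sum_divide_distrib)
qed

text \<open>Doob's maximal inequality for a process that is known to be a supermartingale only while
  \<open>Good\<close> holds. The recursion stops when \<open>F\<close> reaches 1, where the trivial
  bound is enough, or when \<open>Good\<close> fails below level 1: then no later crossing counts,
  since the event asks for \<open>Good\<close> at all earlier indices.\<close>

lemma pr_maximal:
  fixes F :: "'a list \<Rightarrow> real"
  assumes S: "finite S" "S \<noteq> {}" and nonneg: "\<And>zs. 0 \<le> F zs"
    and step: "\<And>zs. set zs \<subseteq> S \<Longrightarrow> length zs < m \<Longrightarrow> Good zs \<Longrightarrow> avg S (\<lambda>g. F (zs @ [g])) \<le> F zs"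
  shows "pr S m [] (\<lambda>zs. \<exists>j\<le>m. (\<forall>i<j. Good (take i zs)) \<and> 1 \<le> F (take j zs)) \<le> F []"
proof -
  let ?H = "\<lambda>zs. \<exists>j\<le>m. (\<forall>i<j. Good (take i zs)) \<and> 1 \<le> F (take j zs)"
  have "pr S r xs ?H \<le> F xs"
    if "r + length xs = m" "set xs \<subseteq> S" "\<And>i. i < length xs \<Longrightarrow> F (take i xs) < 1" for r xs
    using that
  proof (induction r arbitrary: xs)
    case 0
    have "1 \<le> F xs" if "?H xs"
    proof -
      from that obtain j where j: "j \<le> m" "1 \<le> F (take j xs)" by auto
      with 0 have "\<not> j < length xs" by force
      with j 0 show ?thesis by auto
    qed
    then show ?case using nonneg by auto
  next
    case (Suc r)
    show ?case
    proof (cases "1 \<le> F xs")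
      case True
      then show ?thesis using pr_le_1[OF S, of "Suc r" xs ?H] by linarith
    next
      case F1: False
      show ?thesis
      proof (cases "Good xs")
        case True
        have "avg S (\<lambda>g. pr S r (xs @ [g]) ?H) \<le> avg S (\<lambda>g. F (xs @ [g]))"
        proof (rule avg_mono, rule Suc.IH)
          fix g i assume "g \<in> S" "i < length (xs @ [g])"
          then show "F (take i (xs @ [g])) < 1"
            using Suc.prems(3)[of i] F1 by (cases "i = length xs") auto
        qed (use Suc.prems in auto)
        also have "\<dots> \<le> F xs" using True Suc.prems by (intro step) auto
        finally show ?thesis by simp
      next
        case False
        have "\<not> ?H (xs @ ys)" for ys
        proof
          assume "?H (xs @ ys)"
          then obtain j where j: "\<forall>i<j. Good (take i (xs @ ys))" "1 \<le> F (take j (xs @ ys))"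
            by auto
          have "\<not> length xs < j" using j(1) False by auto
          moreover have "j \<noteq> length xs" using j(2) F1 by auto
          ultimately have "j < length xs" by simp
          then show False using Suc.prems(3)[of j] j(2) by simp
        qed
        then have "pr S (Suc r) xs ?H = 0" by (intro pr_False) auto
        then show ?thesis using nonneg by simp
      qed
    qed
  qed
  from this[of m "[]"] show ?thesis by simp
qed

lemma exp_le_quadratic:
  fixes x :: real
  assumes "x \<le> 1"
  shows "exp x \<le> 1 + x + x\<^sup>2"
proof (cases "0 \<le> x")
  case True
  then show ?thesis using exp_bound assms by blast
next
  case False
  define y where "y = - x"
  have y: "y > 0" using False by (simp add: y_def)
  have "1 + y \<le> exp y" by simp
  then have "exp x \<le> 1 / (1 + y)" using y
    by (simp add: y_def exp_minus field_simps)
  also have "\<dots> \<le> 1 - y + y\<^sup>2"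
  proof -
    have "(1 - y + y\<^sup>2) * (1 + y) = 1 + y ^ 3" by (simp add: algebra_simps power2_eq_square power3_eq_cube)
    then have "1 \<le> (1 - y + y\<^sup>2) * (1 + y)" using y by simp
    then show ?thesis using y by (simp add: divide_le_eq)
  qed
  finally show ?thesis by (simp add: y_def)
qed

text \<open>The maximal inequality is applied to the exponential of
  \<open>\<theta> * (X - h)\<close> plus a credit \<open>e\<close> for every remaining step. As
  jumps are at most \<open>J\<close> and \<open>\<theta> * J \<le> 1\<close>, the quadratic bound on
  \<open>exp\<close> makes one step cost a factor of at most \<open>1 + e \<le> exp e\<close>; and
  since the credit is nonnegative, the exponential is at least 1 wherever
  \<open>X \<ge> h\<close>.\<close>

lemma pr_drift:
  fixes X :: "'a list \<Rightarrow> real"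
  assumes S: "finite S" "S \<noteq> {}" and par: "0 \<le> \<theta>" "\<theta> * J \<le> 1" "0 \<le> d"
    and drift: "\<And>zs. set zs \<subseteq> S \<Longrightarrow> length zs < m \<Longrightarrow> Good zs \<Longrightarrow> avg S (\<lambda>g. X (zs @ [g])) \<le> X zs + d"
    and jump: "\<And>zs g. set zs \<subseteq> S \<Longrightarrow> length zs < m \<Longrightarrow> Good zs \<Longrightarrow> g \<in> S \<Longrightarrow> \<bar>X (zs @ [g]) - X zs\<bar> \<le> J"
  shows "pr S m [] (\<lambda>zs. \<exists>j\<le>m. (\<forall>i<j. Good (take i zs)) \<and> h \<le> X (take j zs))
           \<le> exp (- \<theta> * (h - X []) + real m * (\<theta> * d + \<theta>\<^sup>2 * J\<^sup>2))"
proof -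
  define e where "e = \<theta> * d + \<theta>\<^sup>2 * J\<^sup>2"
  define F where "F = (\<lambda>xs. exp (\<theta> * (X xs - h) + (real m - real (length xs)) * e))"
  have e: "0 \<le> e" using par by (simp add: e_def)
  have step: "avg S (\<lambda>g. F (zs @ [g])) \<le> F zs"
    if zs: "set zs \<subseteq> S" "length zs < m" "Good zs" for zs
  proof -
    define c where "c = \<theta> * (X zs - h) + (real m - real (length zs)) * e - e"
    have "F (zs @ [g]) \<le> exp c * (1 + \<theta> * (X (zs @ [g]) - X zs) + \<theta>\<^sup>2 * J\<^sup>2)" if g: "g \<in> S" for g
    proof -
      define y where "y = X (zs @ [g]) - X zs"
      have y: "\<bar>y\<bar> \<le> J" using jump[OF zs g] by (simp add: y_def)
      have "F (zs @ [g]) = exp (c + \<theta> * y)"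
        by (simp add: F_def c_def y_def algebra_simps)
      also have "\<dots> = exp c * exp (\<theta> * y)" by (simp add: exp_add)
      also have "exp (\<theta> * y) \<le> 1 + \<theta> * y + (\<theta> * y)\<^sup>2"
        using y par by (intro exp_le_quadratic) (smt (verit) mult_left_mono)
      also have "(\<theta> * y)\<^sup>2 \<le> \<theta>\<^sup>2 * J\<^sup>2"
        using y by (simp add: power_mult_distrib mult_left_mono abs_le_square_iff[symmetric])
      finally show ?thesis by (simp add: y_def)
    qed
    then have "avg S (\<lambda>g. F (zs @ [g])) \<le>
        avg S (\<lambda>g. exp c * (1 + \<theta> * (X (zs @ [g]) - X zs) + \<theta>\<^sup>2 * J\<^sup>2))"
      by (rule avg_mono)
    also have "\<dots> = exp c * (1 + \<theta> * (avg S (\<lambda>g. X (zs @ [g])) - X zs) + \<theta>\<^sup>2 * J\<^sup>2)"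
      using S by (simp add: avg_cmult avg_add avg_diff)
    also have "\<dots> \<le> exp c * (1 + e)"
      using drift[OF zs] par by (simp add: e_def mult_left_mono)
    also have "\<dots> \<le> exp c * exp e" by simp
    also have "\<dots> = F zs" by (simp add: F_def c_def exp_add[symmetric])
    finally show ?thesis .
  qed
  have "pr S m [] (\<lambda>zs. \<exists>j\<le>m. (\<forall>i<j. Good (take i zs)) \<and> h \<le> X (take j zs))
      \<le> pr S m [] (\<lambda>zs. \<exists>j\<le>m. (\<forall>i<j. Good (take i zs)) \<and> 1 \<le> F (take j zs))"
  proof (rule pr_mono, elim exE conjE)
    fix ys j assume *: "length ys = m" "j \<le> m" "\<forall>i<j. Good (take i ([] @ ys))" "h \<le> X (take j ([] @ ys))"
    have "1 \<le> F (take j ys)" using * e par by (simp add: F_def)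
    then show "\<exists>j\<le>m. (\<forall>i<j. Good (take i ([] @ ys))) \<and> 1 \<le> F (take j ([] @ ys))" using * by auto
  qed
  also have "\<dots> \<le> F []"
    by (rule pr_maximal[OF S _ step]) (auto simp: F_def)
  finally show ?thesis by (simp add: F_def e_def algebra_simps)
qed

text \<open>First-moment counterpart of \<open>pr_drift\<close>, for nonnegative functionals whose
  jumps have no useful bound. The supermartingale is \<open>W\<close> plus the drift still to come,
  divided by \<open>\<epsilon>\<close>.\<close>

lemma pr_drift_nonneg:
  fixes W :: "'a list \<Rightarrow> real"
  assumes S: "finite S" "S \<noteq> {}" and par: "0 \<le> d" "0 < \<epsilon>" and nonneg: "\<And>zs. 0 \<le> W zs"
    and drift: "\<And>zs. set zs \<subseteq> S \<Longrightarrow> length zs < m \<Longrightarrow> Good zs \<Longrightarrow> avg S (\<lambda>g. W (zs @ [g])) \<le> W zs + d"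
  shows "pr S m [] (\<lambda>zs. \<exists>j\<le>m. (\<forall>i<j. Good (take i zs)) \<and> \<epsilon> \<le> W (take j zs))
           \<le> (W [] + real m * d) / \<epsilon>"
proof -
  define F where "F = (\<lambda>xs. (W xs + real (m - length xs) * d) / \<epsilon>)"
  have step: "avg S (\<lambda>g. F (zs @ [g])) \<le> F zs"
    if zs: "set zs \<subseteq> S" "length zs < m" "Good zs" for zs
  proof -
    have "avg S (\<lambda>g. F (zs @ [g])) = (avg S (\<lambda>g. W (zs @ [g])) + real (m - Suc (length zs)) * d) / \<epsilon>"
      using S avg_cmult_right[of S _ "1/\<epsilon>"] by (simp add: F_def avg_add add_divide_distrib)
    also have "\<dots> \<le> (W zs + d + real (m - Suc (length zs)) * d) / \<epsilon>"
      using drift[OF zs] par by (intro divide_right_mono) auto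
    also have "\<dots> = F zs" using zs by (simp add: F_def of_nat_diff algebra_simps)
    finally show ?thesis .
  qed
  have "pr S m [] (\<lambda>zs. \<exists>j\<le>m. (\<forall>i<j. Good (take i zs)) \<and> \<epsilon> \<le> W (take j zs))
      \<le> pr S m [] (\<lambda>zs. \<exists>j\<le>m. (\<forall>i<j. Good (take i zs)) \<and> 1 \<le> F (take j zs))"
  proof (rule pr_mono, elim exE conjE)
    fix ys j assume *: "length ys = m" "j \<le> m" "\<forall>i<j. Good (take i ([] @ ys))" "\<epsilon> \<le> W (take j ([] @ ys))"
    have "0 \<le> real (m - j) * d" using par by (intro mult_nonneg_nonneg) auto
    with * have "\<epsilon> \<le> W (take j ys) + real (m - length (take j ys)) * d" by simp
    then have "1 \<le> F (take j ys)" using par by (simp add: F_def del: length_take)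
    then show "\<exists>j\<le>m. (\<forall>i<j. Good (take i ([] @ ys))) \<and> 1 \<le> F (take j ([] @ ys))" using * by auto
  qed
  also have "\<dots> \<le> F []"
    by (rule pr_maximal[OF S _ step]) (use par nonneg in \<open>auto simp: F_def\<close>)
  finally show ?thesis by (simp add: F_def)
qed

section \<open>Averages over permutations\<close>

text \<open>The extensions of \<open>x\<close> form a coset: one of them, \<open>\<sigma>\<close>,
  is built from a bijection \<open>b\<close> of the complements, and the others are
  \<open>\<sigma> \<circ> \<tau>\<close> with \<open>\<tau>\<close> fixing \<open>Y\<close>
  pointwise.\<close>

lemma card_permutations_extending:
  assumes V: "finite V" "Y \<subseteq> V" and x: "x \<in> Y \<rightarrow>\<^sub>E V" "inj_on x Y"
  shows "card {\<pi>. \<pi> permutes V \<and> restrict \<pi> Y = x} = fact (card V - card Y)"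
proof -
  have Y: "finite Y" using V finite_subset by blast
  have xY: "x ` Y \<subseteq> V" using x by auto
  have "card (V - Y) = card (V - x ` Y)"
    using V Y xY x by (simp add: card_Diff_subset card_image)
  then obtain b where b: "bij_betw b (V - Y) (V - x ` Y)"
    using V by (metis finite_Diff finite_same_card_bij)
  define \<sigma> where "\<sigma> = (\<lambda>v. if v \<in> Y then x v else if v \<in> V then b v else v)"
  have "bij_betw \<sigma> (Y \<union> (V - Y)) (x ` Y \<union> (V - x ` Y))"
  proof (rule bij_betw_combine)
    show "bij_betw \<sigma> Y (x ` Y)"
      using x by (auto simp: \<sigma>_def bij_betw_def inj_on_def)
    show "bij_betw \<sigma> (V - Y) (V - x ` Y)"
      using b by (subst bij_betw_cong[where g = b]) (auto simp: \<sigma>_def)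
  qed auto
  moreover have "Y \<union> (V - Y) = V" "x ` Y \<union> (V - x ` Y) = V" using V xY by auto
  ultimately have \<sigma>: "\<sigma> permutes V"
    using V by (intro bij_imp_permutes) (auto simp: \<sigma>_def)
  have "{\<pi>. \<pi> permutes V \<and> restrict \<pi> Y = x} = (\<lambda>\<tau>. \<sigma> \<circ> \<tau>) ` {\<tau>. \<tau> permutes V - Y}"
  proof (intro equalityI subsetI)
    fix \<pi> assume "\<pi> \<in> {\<pi>. \<pi> permutes V \<and> restrict \<pi> Y = x}"
    then have \<pi>: "\<pi> permutes V" "\<And>y. y \<in> Y \<Longrightarrow> \<pi> y = x y"
      by auto
    have "(inv \<sigma> \<circ> \<pi>) permutes V - Y"
    proof (rule permutes_superset)
      show "(inv \<sigma> \<circ> \<pi>) permutes V" using \<pi> \<sigma> by (intro permutes_compose permutes_inv)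
      show "(inv \<sigma> \<circ> \<pi>) y = y" if "y \<in> V - (V - Y)" for y
      proof -
        have "\<pi> y = \<sigma> y" using that \<pi> by (auto simp: \<sigma>_def)
        then show ?thesis using \<sigma> by (simp add: permutes_inverses)
      qed
    qed
    moreover have "\<pi> = \<sigma> \<circ> (inv \<sigma> \<circ> \<pi>)"
      using \<sigma> by (auto simp: fun_eq_iff permutes_inverses)
    ultimately show "\<pi> \<in> (\<lambda>\<tau>. \<sigma> \<circ> \<tau>) ` {\<tau>. \<tau> permutes V - Y}" by blast
  next
    fix \<pi> assume "\<pi> \<in> (\<lambda>\<tau>. \<sigma> \<circ> \<tau>) ` {\<tau>. \<tau> permutes V - Y}"
    then obtain \<tau> where \<tau>: "\<pi> = \<sigma> \<circ> \<tau>" "\<tau> permutes V - Y" by auto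
    have "\<tau> permutes V" using \<tau> by (auto intro: permutes_subset)
    then have "\<pi> permutes V" using \<sigma> \<tau> by (auto intro: permutes_compose)
    moreover have "restrict \<pi> Y = x"
    proof
      fix y show "restrict \<pi> Y y = x y"
        using \<tau> x by (cases "y \<in> Y") (auto simp: \<sigma>_def permutes_not_in PiE_def extensional_def)
    qed
    ultimately show "\<pi> \<in> {\<pi>. \<pi> permutes V \<and> restrict \<pi> Y = x}" by simp
  qed
  moreover have "inj_on (\<lambda>\<tau>. \<sigma> \<circ> \<tau>) {\<tau>. \<tau> permutes V - Y}"
    using \<sigma> by (auto intro!: inj_onI simp: fun_eq_iff permutes_inj inj_eq)
  ultimately show ?thesis
    using V Y by (simp add: card_image card_permutations[OF refl] card_Diff_subset)
qed

lemma sum_permutations_restrict: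
  fixes F :: "('a \<Rightarrow> 'a) \<Rightarrow> real"
  assumes V: "finite V" "Y \<subseteq> V"
  shows "(\<Sum>\<pi> | \<pi> permutes V. F (restrict \<pi> Y)) =
      fact (card V - card Y) * (\<Sum>x | x \<in> Y \<rightarrow>\<^sub>E V \<and> inj_on x Y. F x)"
proof -
  have Y: "finite Y" using V finite_subset by blast
  have "(\<Sum>\<pi> | \<pi> permutes V. F (restrict \<pi> Y)) =
    (\<Sum>x | x \<in> Y \<rightarrow>\<^sub>E V \<and> inj_on x Y. of_nat (card {\<pi> \<in> {\<pi>. \<pi> permutes V}. restrict \<pi> Y = x}) * F x)"
  proof (rule sum_fun_comp)
    show "finite {\<pi>. \<pi> permutes V}" using V by (simp add: finite_permutations)
    show "finite {x \<in> Y \<rightarrow>\<^sub>E V. inj_on x Y}" using V Y by (simp add: finite_PiE)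
    show "(\<lambda>\<pi>. restrict \<pi> Y) ` {\<pi>. \<pi> permutes V} \<subseteq> {x \<in> Y \<rightarrow>\<^sub>E V. inj_on x Y}"
      using V by (auto simp: permutes_in_image inj_on_def dest: permutes_inj injD)
  qed
  also have "\<dots> = (\<Sum>x | x \<in> Y \<rightarrow>\<^sub>E V \<and> inj_on x Y. fact (card V - card Y) * F x)"
    using card_permutations_extending[OF V] by (intro sum.cong) auto
  finally show ?thesis by (simp add: sum_distrib_left)
qed

text \<open>For \<open>l \<le> n\<close> the inverse of the probability that \<open>l\<close>
  independent uniform points among \<open>n\<close> are distinct. It is the price for replacing the
  random injection given by a permutation by independent points.\<close>

definition inj_ratio :: "nat \<Rightarrow> nat \<Rightarrow> real" where
  "inj_ratio n l = real n ^ l * fact (n - l) / fact n"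

lemma card_injections:
  fixes V :: "'a set"
  assumes V: "finite V" "Y \<subseteq> V"
  shows "real (card {x \<in> Y \<rightarrow>\<^sub>E V. inj_on x Y}) * fact (card V - card Y) = fact (card V)"
proof -
  have "fact (card V - card Y) * real (card {x \<in> Y \<rightarrow>\<^sub>E V. inj_on x Y}) = real (card {\<pi>. \<pi> permutes V})"
    using sum_permutations_restrict[OF V, of "\<lambda>_. 1"] by simp
  then show ?thesis using V by (simp add: card_permutations[OF refl] mult.commute)
qed

lemma avg_permutations_restrict:
  fixes F :: "('a \<Rightarrow> 'a) \<Rightarrow> real"
  assumes V: "finite V" "Y \<subseteq> V"
  shows "avg {\<pi>. \<pi> permutes V} (\<lambda>\<pi>. F (restrict \<pi> Y)) = avg {x \<in> Y \<rightarrow>\<^sub>E V. inj_on x Y} F"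
proof -
  have nz: "real (card {x \<in> Y \<rightarrow>\<^sub>E V. inj_on x Y}) \<noteq> 0"
    using card_injections[OF V] by (metis fact_nonzero mult_zero_left)
  have "avg {\<pi>. \<pi> permutes V} (\<lambda>\<pi>. F (restrict \<pi> Y)) =
     fact (card V - card Y) * (\<Sum>x | x \<in> Y \<rightarrow>\<^sub>E V \<and> inj_on x Y. F x) /
     (real (card {x \<in> Y \<rightarrow>\<^sub>E V. inj_on x Y}) * fact (card V - card Y))"
    using V by (simp add: avg_def sum_permutations_restrict card_permutations[OF refl] card_injections)
  then show ?thesis using nz by (simp add: avg_def)
qed

lemma avg_permutations_le:
  fixes F :: "('a \<Rightarrow> 'a) \<Rightarrow> real"
  assumes V: "finite V" "Y \<subseteq> V" and nonneg: "\<And>x. x \<in> Y \<rightarrow>\<^sub>E V \<Longrightarrow> 0 \<le> F x"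
  shows "avg {\<pi>. \<pi> permutes V} (\<lambda>\<pi>. F (restrict \<pi> Y)) \<le> inj_ratio (card V) (card Y) * avg (Y \<rightarrow>\<^sub>E V) F"
proof -
  have Y: "finite Y" using V finite_subset by blast
  define c where "c = real (card {x \<in> Y \<rightarrow>\<^sub>E V. inj_on x Y})"
  have c: "c * fact (card V - card Y) = fact (card V)"
    unfolding c_def by (rule card_injections[OF V])
  then have nz: "c \<noteq> 0" by (metis fact_nonzero mult_zero_left)
  have nV: "real (card V) ^ card Y \<noteq> 0"
  proof (cases "Y = {}")
    case False
    then have "V \<noteq> {}" using V by auto
    then show ?thesis using V by simp
  qed simp
  have "avg {x \<in> Y \<rightarrow>\<^sub>E V. inj_on x Y} F \<le> (\<Sum>x\<in>Y \<rightarrow>\<^sub>E V. F x) / c"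
    unfolding avg_def c_def using V Y nonneg
    by (intro divide_right_mono sum_mono2) (auto simp: finite_PiE)
  also have "\<dots> = inj_ratio (card V) (card Y) * avg (Y \<rightarrow>\<^sub>E V) F"
  proof -
    have "avg (Y \<rightarrow>\<^sub>E V) F = (\<Sum>x\<in>Y \<rightarrow>\<^sub>E V. F x) / real (card V) ^ card Y"
      using Y by (simp add: avg_def card_PiE)
    moreover have "inj_ratio (card V) (card Y) = real (card V) ^ card Y / c"
      using nz unfolding inj_ratio_def c[symmetric] by simp
    ultimately show ?thesis using nV by simp
  qed
  finally show ?thesis using avg_permutations_restrict[OF V, of F] by simp
qed

text \<open>In this direction no ratio appears: there are at most as many injections as functions,
  so normalising by the number of all functions only lowers the average. Injectivity stays as a
  factor of the integrand.\<close>

lemma avg_permutations_ge: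
  fixes F :: "('a \<Rightarrow> 'a) \<Rightarrow> real"
  assumes V: "finite V" "Y \<subseteq> V" and nonneg: "\<And>x. x \<in> Y \<rightarrow>\<^sub>E V \<Longrightarrow> 0 \<le> F x"
  shows "avg (Y \<rightarrow>\<^sub>E V) (\<lambda>x. F x * of_bool (inj_on x Y)) \<le> avg {\<pi>. \<pi> permutes V} (\<lambda>\<pi>. F (restrict \<pi> Y))"
proof -
  have Y: "finite Y" using V finite_subset by blast
  define c where "c = real (card {x \<in> Y \<rightarrow>\<^sub>E V. inj_on x Y})"
  have "c * fact (card V - card Y) = fact (card V)"
    unfolding c_def by (rule card_injections[OF V])
  then have nz: "c \<noteq> 0" by (metis fact_nonzero mult_zero_left)
  have "c \<le> real (card (Y \<rightarrow>\<^sub>E V))"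
    using V Y by (auto simp: c_def finite_PiE intro!: card_mono)
  moreover have "(\<Sum>x\<in>Y \<rightarrow>\<^sub>E V. F x * of_bool (inj_on x Y)) = (\<Sum>x | x \<in> Y \<rightarrow>\<^sub>E V \<and> inj_on x Y. F x)"
    using V Y by (intro sum.mono_neutral_cong_right) (auto simp: finite_PiE)
  moreover have "0 \<le> (\<Sum>x | x \<in> Y \<rightarrow>\<^sub>E V \<and> inj_on x Y. F x)" using nonneg by (intro sum_nonneg) auto
  moreover have "0 < c" using nz by (simp add: c_def)
  ultimately have "(\<Sum>x\<in>Y \<rightarrow>\<^sub>E V. F x * of_bool (inj_on x Y)) / real (card (Y \<rightarrow>\<^sub>E V))
      \<le> (\<Sum>x | x \<in> Y \<rightarrow>\<^sub>E V \<and> inj_on x Y. F x) / c"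
    by (intro frac_le) auto
  then show ?thesis
    unfolding avg_permutations_restrict[OF V] by (simp only: avg_def c_def)
qed

lemma inj_ratio_Suc: "l < n \<Longrightarrow> inj_ratio n (Suc l) = inj_ratio n l * (real n / (real n - real l))"
proof -
  assume l: "l < n"
  have "fact (n - l) = (real n - real l) * fact (n - Suc l)"
    using l by (simp add: fact_reduce[of "n - l"] of_nat_diff)
  then show ?thesis using l by (simp add: inj_ratio_def)
qed

lemma inj_ratio_tendsto: "(\<lambda>n. inj_ratio n l) \<longlonglongrightarrow> 1"
proof (induction l)
  case 0
  then show ?case by (simp add: inj_ratio_def)
next
  case (Suc l)
  have "(\<lambda>n. real n / (real n - real l)) \<longlonglongrightarrow> 1"
  proof (rule Lim_transform_eventually)
    have "(\<lambda>n. 1 / (1 - real l / real n)) \<longlonglongrightarrow> 1 / (1 - 0)"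
      by (intro tendsto_intros lim_const_over_n) auto
    then show "(\<lambda>n. 1 / (1 - real l / real n)) \<longlonglongrightarrow> 1" by simp
    show "\<forall>\<^sub>F n in sequentially. 1 / (1 - real l / real n) = real n / (real n - real l)"
      using eventually_gt_at_top[of l] by eventually_elim (simp add: field_simps)
  qed
  from tendsto_mult[OF Suc this] have "(\<lambda>n. inj_ratio n l * (real n / (real n - real l))) \<longlonglongrightarrow> 1" by simp
  moreover have "\<forall>\<^sub>F n in sequentially. inj_ratio n l * (real n / (real n - real l)) = inj_ratio n (Suc l)"
    using eventually_gt_at_top[of l] by eventually_elim (simp add: inj_ratio_Suc)
  ultimately show ?case by (rule Lim_transform_eventually)
qed

lemma inj_ratio_nonneg: "0 \<le> inj_ratio n l"
  by (simp add: inj_ratio_def)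

text \<open>Conjugation by a fixed \<open>\<pi>\<close> permutes the class. A uniform step can thus
  be averaged as a fixed representative relabelled by a uniform permutation, so that the randomness
  lies in where the points of its cycles are placed.\<close>

lemma avg_conjugation:
  assumes "finite V" "finite \<Gamma>"
    and closed: "\<And>\<pi> g. \<pi> permutes V \<Longrightarrow> g \<in> \<Gamma> \<Longrightarrow> \<pi> \<circ> g \<circ> inv \<pi> \<in> \<Gamma>"
  shows "avg \<Gamma> Q = avg \<Gamma> (\<lambda>g. avg {\<pi>. \<pi> permutes V} (\<lambda>\<pi>. Q (\<pi> \<circ> g \<circ> inv \<pi>)))"
proof -
  have "avg \<Gamma> (\<lambda>g. Q (\<pi> \<circ> g \<circ> inv \<pi>)) = avg \<Gamma> Q" if \<pi>: "\<pi> permutes V" for \<pi>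
  proof -
    have "bij_betw (\<lambda>g. \<pi> \<circ> g \<circ> inv \<pi>) \<Gamma> \<Gamma>"
    proof (rule bij_betwI)
      show "(\<lambda>g. \<pi> \<circ> g \<circ> inv \<pi>) \<in> \<Gamma> \<rightarrow> \<Gamma>" using closed \<pi> by auto
      show "(\<lambda>g. inv \<pi> \<circ> g \<circ> \<pi>) \<in> \<Gamma> \<rightarrow> \<Gamma>"
        using closed[OF permutes_inv[OF \<pi>]] \<pi> by (auto simp: permutes_inv_inv)
    qed (use \<pi> in \<open>auto simp: fun_eq_iff permutes_inverses\<close>)
    from sum.reindex_bij_betw[OF this, of Q] show ?thesis
      by (simp add: avg_def)
  qed
  then have "avg {\<pi>. \<pi> permutes V} (\<lambda>\<pi>. avg \<Gamma> (\<lambda>g. Q (\<pi> \<circ> g \<circ> inv \<pi>))) = avg {\<pi>. \<pi> permutes V} (\<lambda>\<pi>. avg \<Gamma> Q)"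
    by (rule avg_cong) simp
  also have "\<dots> = avg \<Gamma> Q"
    using assms(1) by (subst avg_const) (auto simp: finite_permutations intro!: exI[of _ id] permutes_id)
  finally show ?thesis by (subst (asm) avg_swap) simp
qed

section \<open>Components generated by a list of permutations\<close>

definition component :: "('a \<Rightarrow> 'a) list \<Rightarrow> 'a \<Rightarrow> 'a set" where
  "component xs v = {w. (v, w) \<in> {(a, b). \<exists>g\<in>set xs. b = g a \<or> a = g b}\<^sup>*}"

lemma component_refl [simp]: "v \<in> component xs v"
  by (simp add: component_def)

lemma component_trans: "w \<in> component xs v \<Longrightarrow> u \<in> component xs w \<Longrightarrow> u \<in> component xs v"
  by (auto simp: component_def intro: rtrancl_trans)

lemma component_sym: "w \<in> component xs v \<Longrightarrow> v \<in> component xs w"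
proof -
  have "sym ({(a, b). \<exists>g\<in>set xs. b = g a \<or> a = g b}\<^sup>*)"
    by (rule sym_rtrancl) (auto simp: sym_def)
  then show "w \<in> component xs v \<Longrightarrow> v \<in> component xs w"
    unfolding component_def mem_Collect_eq by (rule symD)
qed

lemma component_eq: "w \<in> component xs v \<Longrightarrow> component xs w = component xs v"
  by (auto intro: component_trans component_sym)

lemma component_eq_iff: "component xs w = component xs v \<longleftrightarrow> w \<in> component xs v"
  using component_eq component_refl by metis

lemma component_disjoint: "component xs w \<noteq> component xs v \<Longrightarrow> component xs w \<inter> component xs v = {}"
  using component_eq[of _ xs w] component_eq[of _ xs v] by blast

lemma component_step: "g \<in> set xs \<Longrightarrow> g v \<in> component xs v"
  by (auto simp: component_def)

lemma component_subset:
  assumes "v \<in> S" and "\<And>w u g. w \<in> S \<Longrightarrow> g \<in> set xs \<Longrightarrow> u = g w \<or> w = g u \<Longrightarrow> u \<in> S"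
  shows "component xs v \<subseteq> S"
proof
  fix w assume "w \<in> component xs v"
  then have "(v, w) \<in> {(a, b). \<exists>g\<in>set xs. b = g a \<or> a = g b}\<^sup>*" by (simp add: component_def)
  then show "w \<in> S" by induction (use assms in auto)
qed

lemma component_mono: "set xs \<subseteq> set ys \<Longrightarrow> component xs v \<subseteq> component ys v"
  unfolding component_def by (auto elim!: rtrancl_mono[THEN subsetD, rotated])

lemma component_Nil [simp]: "component [] v = {v}"
  by (simp add: component_def)

lemma component_inv:
  assumes "g \<in> set xs" "w = g u"
  shows "u \<in> component xs w"
  using assms component_step[of g xs u] by (auto intro: component_sym)

text \<open>Invariance principle for one added permutation: upper bounds on a new component are
  obtained by exhibiting a set closed under the old components and under \<open>g\<close> in both
  directions.\<close>

lemma component_append_subset: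
  assumes v: "v \<in> S" and old: "\<And>w. w \<in> S \<Longrightarrow> component xs w \<subseteq> S"
    and new: "\<And>w u. w \<in> S \<Longrightarrow> u = g w \<or> w = g u \<Longrightarrow> u \<in> S"
  shows "component (xs @ [g]) v \<subseteq> S"
proof (rule component_subset[OF v])
  fix w u h assume *: "w \<in> S" "h \<in> set (xs @ [g])" "u = h w \<or> w = h u"
  show "u \<in> S"
  proof (cases "h \<in> set xs")
    case True
    then have "u \<in> component xs w" using * component_step component_inv by metis
    then show ?thesis using old * by blast
  next
    case False
    then have "h = g" using * by simp
    then show ?thesis using new[OF *(1), of u] *(3) by simp
  qed
qed

lemma component_subset_carrier:
  assumes "\<And>g. g \<in> set xs \<Longrightarrow> g permutes V" "v \<in> V"
  shows "component xs v \<subseteq> V"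
  using assms by (intro component_subset) (auto simp: permutes_in_image)

section \<open>Orbits and moved points of a permutation\<close>

lemma support_subset: "p permutes V \<Longrightarrow> {y. p y \<noteq> y} \<subseteq> V"
  by (auto simp: permutes_def)

lemma self_in_orbit: "finite V \<Longrightarrow> p permutes V \<Longrightarrow> y \<in> orbit p y"
  using permutation_self_in_orbit permutation_permutes by metis

lemma orbit_eq:
  assumes "finite V" "p permutes V" "z \<in> orbit p y"
  shows "orbit p z = orbit p y"
proof -
  have "y \<in> orbit p z"
    using orbit_swap[OF self_in_orbit[OF assms(1,2)] assms(3)] .
  then show ?thesis using assms(3) orbit_trans by fast
qed

lemma permutes_eq_iff: "p permutes V \<Longrightarrow> p x = p y \<longleftrightarrow> x = y"
  by (simp add: inj_eq permutes_inj)

lemma orbit_subset_support: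
  assumes "p permutes V" "p y \<noteq> y"
  shows "orbit p y \<subseteq> {y. p y \<noteq> y}"
proof
  fix z assume "z \<in> orbit p y"
  then show "z \<in> {y. p y \<noteq> y}"
    using assms(2) by induction (simp_all add: permutes_eq_iff[OF assms(1)])
qed

lemma orbit_subset_carrier:
  assumes "p permutes V" "y \<in> V"
  shows "orbit p y \<subseteq> V"
  using assms permutes_orbit_subset by metis

section \<open>Effect of one relabelled step on the components\<close>

lemma sum_UN_le:
  fixes h :: "'a \<Rightarrow> real"
  assumes "finite I" "\<And>i. i \<in> I \<Longrightarrow> finite (A i)" "\<And>x. x \<in> (\<Union>i\<in>I. A i) \<Longrightarrow> 0 \<le> h x"
  shows "(\<Sum>x\<in>(\<Union>i\<in>I. A i). h x) \<le> (\<Sum>i\<in>I. \<Sum>x\<in>A i. h x)"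
  using assms
proof (induction I rule: finite_induct)
  case (insert i I)
  have "sum h (A i \<union> (\<Union>i\<in>I. A i)) + sum h (A i \<inter> (\<Union>i\<in>I. A i)) = sum h (A i) + sum h (\<Union>i\<in>I. A i)"
    using insert by (intro sum.union_inter) auto
  moreover have "0 \<le> sum h (A i \<inter> (\<Union>i\<in>I. A i))"
    using insert.prems by (intro sum_nonneg) auto
  moreover have "sum h (\<Union>i\<in>I. A i) \<le> (\<Sum>i\<in>I. \<Sum>x\<in>A i. h x)"
    using insert.prems by (intro insert.IH) auto
  ultimately show ?case using insert.hyps by simp
qed simp

text \<open>One step is written as \<open>q = \<pi> \<circ> p \<circ> inv \<pi>\<close> with a fixed
  shape \<open>p\<close>: its cycles are the \<open>\<pi>\<close>-images of the orbits of
  \<open>p\<close>, so the components that it can change are those of \<open>\<pi> y\<close> for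
  \<open>y\<close> moved by \<open>p\<close>.\<close>

locale merge_step =
  fixes V :: "'a set" and xs :: "('a \<Rightarrow> 'a) list" and p \<pi> :: "'a \<Rightarrow> 'a"
  assumes finV: "finite V" and xs: "\<And>g. g \<in> set xs \<Longrightarrow> g permutes V"
    and p: "p permutes V" and \<pi>: "\<pi> permutes V"
begin

abbreviation "supp \<equiv> {y. p y \<noteq> y}"
definition "q = \<pi> \<circ> p \<circ> inv \<pi>"
abbreviation "old \<equiv> component xs"
abbreviation "new \<equiv> component (xs @ [q])"
abbreviation "touched \<equiv> (\<Union>y\<in>supp. old (\<pi> y))"

lemma finite_supp: "finite supp"
  using finV support_subset[OF p] finite_subset by blast

lemma q_permutes: "q permutes V"
  unfolding q_def using p \<pi> by (intro permutes_compose permutes_inv)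

lemma new_perms: "g \<in> set (xs @ [q]) \<Longrightarrow> g permutes V"
  using q_permutes xs by auto

lemma q_image [simp]: "q (\<pi> y) = \<pi> (p y)"
  using \<pi> by (simp add: q_def permutes_inverses)

lemma q_fixed:
  assumes "w \<notin> \<pi> ` supp"
  shows "q w = w"
proof -
  obtain y where y: "w = \<pi> y" using \<pi> by (metis permutes_inverses(1))
  then have "p y = y" using assms by blast
  then show ?thesis using y by simp
qed

lemma q_preimage: "w = q u \<Longrightarrow> u \<notin> \<pi> ` supp \<Longrightarrow> u = w"
  using q_fixed by metis

lemma q_support: "{w. q w \<noteq> w} = \<pi> ` supp"
proof -
  have "q (\<pi> y) \<noteq> \<pi> y" if "p y \<noteq> y" for y
    using that by (simp add: permutes_eq_iff[OF \<pi>])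
  then show ?thesis using q_fixed by auto
qed

lemma old_finite: "v \<in> V \<Longrightarrow> finite (old v)"
  using component_subset_carrier[OF xs] finV finite_subset by blast

lemma new_finite: "v \<in> V \<Longrightarrow> finite (new v)"
  using component_subset_carrier[OF new_perms] finV finite_subset by blast

lemma \<pi>_supp_in: "y \<in> supp \<Longrightarrow> \<pi> y \<in> V"
  using support_subset[OF p] \<pi> by (auto simp: permutes_in_image)

lemma touched_subset: "touched \<subseteq> V"
  using component_subset_carrier[OF xs] \<pi>_supp_in by blast

lemma old_subset_new: "old v \<subseteq> new v"
  by (rule component_mono) auto

lemma p_supp: "p y \<in> supp \<longleftrightarrow> y \<in> supp"
  by (simp add: permutes_eq_iff[OF p])

lemma new_untouched:
  assumes "v \<notin> touched"
  shows "new v = old v"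
proof (rule antisym[OF component_append_subset old_subset_new])
  have out: "w \<notin> \<pi> ` supp" if "w \<in> old v" for w
  proof
    assume "w \<in> \<pi> ` supp"
    then obtain y where y: "w = \<pi> y" "y \<in> supp" by blast
    then have "v \<in> old (\<pi> y)" using that component_sym by metis
    then show False using assms y(2) by blast
  qed
  show "u \<in> old v" if "w \<in> old v" "u = q w \<or> w = q u" for w u
  proof (cases "u = q w")
    case True
    then show ?thesis using that(1) q_fixed[OF out[OF that(1)]] by simp
  next
    case False
    with that have wu: "w = q u" by simp
    have "u \<notin> \<pi> ` supp"
    proof
      assume "u \<in> \<pi> ` supp"
      then obtain y where "u = \<pi> y" "y \<in> supp" by blast
      then have "w = \<pi> (p y)" "p y \<in> supp" using wu p_supp by simp_all
      then have "w \<in> \<pi> ` supp" by blast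
      then show False using out that by blast
    qed
    then show ?thesis using q_preimage[OF wu] that(1) by metis
  qed
  show "v \<in> old v" by simp
  show "old w \<subseteq> old v" if "w \<in> old v" for w
    using component_eq[OF that] by simp
qed

lemma new_touched_subset:
  assumes "v \<in> touched"
  shows "new v \<subseteq> touched"
proof (rule component_append_subset[OF assms])
  show "old w \<subseteq> touched" if "w \<in> touched" for w
  proof -
    from that obtain y where "y \<in> supp" "w \<in> old (\<pi> y)" by blast
    then show ?thesis using component_eq[of w xs "\<pi> y"] by blast
  qed
  have in_touched: "\<pi> y \<in> touched" if "y \<in> supp" for y
    by (rule UN_I[OF that component_refl])
  show "u \<in> touched" if "w \<in> touched" "u = q w \<or> w = q u" for w u
  proof (cases "u = q w")
    case True
    show ?thesis
    proof (cases "w \<in> \<pi> ` supp")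
      case True
      then obtain y where "w = \<pi> y" "y \<in> supp" by blast
      then have "u = \<pi> (p y)" "p y \<in> supp" using \<open>u = q w\<close> p_supp by simp_all
      then show ?thesis using in_touched by blast
    next
      case False
      then show ?thesis using \<open>u = q w\<close> that(1) q_fixed[of w] by metis
    qed
  next
    case False
    with that have wu: "w = q u" by simp
    show ?thesis
    proof (cases "u \<in> \<pi> ` supp")
      case True
      then show ?thesis using in_touched by blast
    next
      case False
      then show ?thesis using q_preimage[OF wu] that(1) by metis
    qed
  qed
qed

lemma new_orbit_eq:
  assumes "z \<in> orbit p y"
  shows "new (\<pi> z) = new (\<pi> y)"
proof -
  have step: "new (\<pi> (p x)) = new (\<pi> x)" for x
  proof (rule component_eq)
    have "q (\<pi> x) \<in> new (\<pi> x)" by (rule component_step[of q]) simp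
    then show "\<pi> (p x) \<in> new (\<pi> x)" by simp
  qed
  show ?thesis
    using assms by induction (simp_all only: step)
qed

lemma orbit_merged:
  assumes "y \<in> supp" "v \<in> old (\<pi> y)"
  shows "(\<Union>z\<in>orbit p y. old (\<pi> z)) \<subseteq> new v"
proof -
  have "new v = new (\<pi> y)"
    using assms old_subset_new by (intro component_eq) blast
  moreover have "old (\<pi> z) \<subseteq> new (\<pi> y)" if "z \<in> orbit p y" for z
    using new_orbit_eq[OF that] old_subset_new[of "\<pi> z"] by simp
  ultimately show ?thesis by blast
qed

text \<open>The union over the orbit is closed under \<open>q\<close>: a moved point in it is
  \<open>\<pi> z\<close> for some \<open>z\<close> in the support, and by injectivity its class can
  occur in the union only if \<open>z\<close> itself lies in the orbit.\<close>

lemma new_no_collision: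
  assumes inj: "inj_on (\<lambda>y. old (\<pi> y)) supp" and y: "y \<in> supp" "v \<in> old (\<pi> y)"
  shows "new v = (\<Union>z\<in>orbit p y. old (\<pi> z))"
proof (rule antisym[OF _ orbit_merged[OF y]])
  let ?S = "\<Union>z\<in>orbit p y. old (\<pi> z)"
  have sub: "orbit p y \<subseteq> supp" using orbit_subset_support[OF p] y by simp
  have in_S: "\<pi> z \<in> ?S" if "z \<in> orbit p y" for z
    by (rule UN_I[OF that component_refl])
  have only: "z \<in> orbit p y" if "z \<in> supp" "\<pi> z \<in> ?S" for z
  proof -
    from that obtain z' where z': "z' \<in> orbit p y" "\<pi> z \<in> old (\<pi> z')" by blast
    have "old (\<pi> z) = old (\<pi> z')" by (rule component_eq[OF z'(2)])
    moreover have "z' \<in> supp" using sub z'(1) by blast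
    ultimately have "z = z'" using inj_onD[OF inj] that(1) by simp
    then show ?thesis using z' by simp
  qed
  show "new v \<subseteq> ?S"
  proof (rule component_append_subset)
    show "v \<in> ?S" using y self_in_orbit[OF finV p, of y] by blast
    show "old w \<subseteq> ?S" if "w \<in> ?S" for w
    proof -
      from that obtain z where "z \<in> orbit p y" "w \<in> old (\<pi> z)" by blast
      then show ?thesis using component_eq[of w xs "\<pi> z"] by blast
    qed
    show "u \<in> ?S" if "w \<in> ?S" "u = q w \<or> w = q u" for w u
    proof (cases "u = q w")
      case True
      show ?thesis
      proof (cases "w \<in> \<pi> ` supp")
        case True
        then obtain z where z: "w = \<pi> z" "z \<in> supp" by blast
        then have "z \<in> orbit p y" using only[OF z(2)] that(1) by simp
        then have "p z \<in> orbit p y" by (rule orbit.step)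
        moreover have "u = \<pi> (p z)" using \<open>u = q w\<close> z by simp
        ultimately show ?thesis using in_S by blast
      next
        case False
        then show ?thesis using \<open>u = q w\<close> that(1) q_fixed[of w] by metis
      qed
    next
      case False
      with that have wu: "w = q u" by simp
      show ?thesis
      proof (cases "u \<in> \<pi> ` supp")
        case True
        then obtain z where z: "u = \<pi> z" "z \<in> supp" by blast
        have "w = \<pi> (p z)" "p z \<in> supp" using p_supp z wu by simp_all
        then have "p z \<in> orbit p y" using only[of "p z"] that(1) by blast
        moreover have "p z \<in> orbit p z" by (rule orbit.base)
        ultimately have "z \<in> orbit p y"
          using orbit_eq[OF finV p, of "p z" y] orbit_eq[OF finV p, of "p z" z] self_in_orbit[OF finV p, of z]
          by simp
        then show ?thesis using z in_S by blast
      next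
        case False
        then show ?thesis using q_preimage[OF wu] that(1) by metis
      qed
    qed
  qed
qed

lemma disjoint_old:
  assumes "inj_on (\<lambda>y. old (\<pi> y)) supp" "z \<in> supp" "z' \<in> supp" "z \<noteq> z'"
  shows "old (\<pi> z) \<inter> old (\<pi> z') = {}"
  using inj_on_contraD[OF assms(1) assms(4,2,3)] by (rule component_disjoint)

lemma card_new_no_collision:
  assumes inj: "inj_on (\<lambda>y. old (\<pi> y)) supp" and y: "y \<in> supp" "v \<in> old (\<pi> y)"
  shows "card (new v) = (\<Sum>z\<in>orbit p y. card (old (\<pi> z)))"
proof -
  have sub: "orbit p y \<subseteq> supp" using orbit_subset_support[OF p] y by simp
  have fin: "finite (old (\<pi> z))" if "z \<in> orbit p y" for z
    using sub that by (intro old_finite \<pi>_supp_in) blast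
  show ?thesis
    unfolding new_no_collision[OF assms]
    using sub fin disjoint_old[OF inj] finite_subset[OF sub finite_supp]
    by (intro card_UN_disjoint) (simp_all add: subset_eq)
qed

lemma sum_split_touched:
  fixes h :: "'a \<Rightarrow> real"
  shows "(\<Sum>v\<in>V. h v) = (\<Sum>v\<in>V - touched. h v) + (\<Sum>v\<in>touched. h v)"
  using sum.subset_diff[OF touched_subset finV, of h] .

lemma sum_touched_le:
  fixes h :: "'a \<Rightarrow> real"
  assumes "\<And>v. v \<in> V \<Longrightarrow> 0 \<le> h v"
  shows "(\<Sum>v\<in>touched. h v) \<le> (\<Sum>y\<in>supp. \<Sum>v\<in>old (\<pi> y). h v)"
proof (rule sum_UN_le[OF finite_supp])
  show "finite (old (\<pi> y))" if "y \<in> supp" for y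
    using old_finite[OF \<pi>_supp_in[OF that]] .
  show "0 \<le> h v" if "v \<in> touched" for v
    using assms touched_subset that by blast
qed

text \<open>Without collisions the touched components are disjoint, one for each moved point, so the
  sum over their vertices can be indexed by the support; every vertex of the component of
  \<open>\<pi> y\<close> then sees the total size along the orbit of \<open>y\<close>.\<close>

lemma sum_no_collision:
  fixes f :: "nat \<Rightarrow> real"
  assumes inj: "inj_on (\<lambda>y. old (\<pi> y)) supp"
  shows "(\<Sum>v\<in>V. f (card (new v))) = (\<Sum>v\<in>V. f (card (old v))) +
    (\<Sum>y\<in>supp. real (card (old (\<pi> y))) *
       (f (\<Sum>z\<in>orbit p y. card (old (\<pi> z))) - f (card (old (\<pi> y)))))"
proof -
  have on_touched: "(\<Sum>v\<in>touched. h v) = (\<Sum>y\<in>supp. \<Sum>v\<in>old (\<pi> y). h v)" for h :: "'a \<Rightarrow> real"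
    using finite_supp old_finite[OF \<pi>_supp_in] disjoint_old[OF inj]
    by (intro sum.UNION_disjoint) simp_all
  have "(\<Sum>v\<in>V. f (card (new v))) - (\<Sum>v\<in>V. f (card (old v))) =
      (\<Sum>v\<in>touched. f (card (new v))) - (\<Sum>v\<in>touched. f (card (old v)))"
    by (simp add: sum_split_touched new_untouched)
  also have "\<dots> = (\<Sum>y\<in>supp. \<Sum>v\<in>old (\<pi> y). f (card (new v)) - f (card (old v)))"
    by (simp only: sum_subtractf[symmetric] on_touched)
  also have "\<dots> = (\<Sum>y\<in>supp. \<Sum>v\<in>old (\<pi> y). f (\<Sum>z\<in>orbit p y. card (old (\<pi> z))) - f (card (old (\<pi> y))))"
  proof (intro sum.cong refl)
    fix y v assume *: "y \<in> supp" "v \<in> old (\<pi> y)"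
    show "f (card (new v)) - f (card (old v)) = f (\<Sum>z\<in>orbit p y. card (old (\<pi> z))) - f (card (old (\<pi> y)))"
      using card_new_no_collision[OF inj *] component_eq[OF *(2)] by simp
  qed
  finally show ?thesis by simp
qed

text \<open>Crude bound for steps with collisions, where the new component sizes are not computed:
  the old contribution of the touched vertices is not subtracted.\<close>

lemma sum_collision_le:
  fixes f :: "nat \<Rightarrow> real"
  assumes "\<And>m. 0 \<le> f m"
  shows "(\<Sum>v\<in>V. f (card (new v))) \<le> (\<Sum>v\<in>V. f (card (old v))) + (\<Sum>v\<in>touched. f (card (new v)))"
proof -
  have "(\<Sum>v\<in>V - touched. f (card (new v))) \<le> (\<Sum>v\<in>V. f (card (old v)))"
    using assms finV by (simp add: new_untouched sum_mono2)
  then show ?thesis using sum_split_touched[of "\<lambda>v. f (card (new v))"] by linarith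
qed

text \<open>\<open>D m\<close> bounds the change of \<open>f\<close> however much a class of size
  \<open>m\<close> grows. Only the product \<open>m * D m\<close> matters later; it stays bounded
  for truncated or exponentially decaying functionals, although the number of affected vertices does
  not.\<close>

lemma sum_jump:
  fixes f D :: "nat \<Rightarrow> real"
  assumes D: "\<And>m m'. 1 \<le> m \<Longrightarrow> m \<le> m' \<Longrightarrow> \<bar>f m' - f m\<bar> \<le> D m"
  shows "\<bar>(\<Sum>v\<in>V. f (card (new v))) - (\<Sum>v\<in>V. f (card (old v)))\<bar>
    \<le> (\<Sum>y\<in>supp. real (card (old (\<pi> y))) * D (card (old (\<pi> y))))"
proof -
  have pos: "1 \<le> card (old v)" if "v \<in> V" for v
    using old_finite[OF that] component_refl[of v xs] by (metis One_nat_def Suc_leI card_gt_0_iff empty_iff)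
  have D': "\<bar>f (card (new v)) - f (card (old v))\<bar> \<le> D (card (old v))" if "v \<in> V" for v
    using that pos D old_subset_new new_finite by (simp add: card_mono)
  have "(\<Sum>v\<in>V. f (card (new v))) - (\<Sum>v\<in>V. f (card (old v))) =
      (\<Sum>v\<in>touched. f (card (new v)) - f (card (old v)))"
    by (simp add: sum_split_touched new_untouched sum_subtractf)
  then have "\<bar>(\<Sum>v\<in>V. f (card (new v))) - (\<Sum>v\<in>V. f (card (old v)))\<bar>
      \<le> (\<Sum>v\<in>touched. \<bar>f (card (new v)) - f (card (old v))\<bar>)"
    by simp
  also have "\<dots> \<le> (\<Sum>y\<in>supp. \<Sum>v\<in>old (\<pi> y). \<bar>f (card (new v)) - f (card (old v))\<bar>)"
    by (rule sum_touched_le) simp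
  also have "\<dots> \<le> (\<Sum>y\<in>supp. \<Sum>v\<in>old (\<pi> y). D (card (old (\<pi> y))))"
  proof (intro sum_mono)
    fix y v assume *: "y \<in> supp" "v \<in> old (\<pi> y)"
    then have "v \<in> V" using touched_subset by blast
    from D'[OF this] show "\<bar>f (card (new v)) - f (card (old v))\<bar> \<le> D (card (old (\<pi> y)))"
      using component_eq[OF *(2)] by simp
  qed
  finally show ?thesis by simp
qed

end

section \<open>Exponential functionals of the component sizes\<close>

lemma avg_PiE_star:
  assumes "finite Y" "finite V" "V \<noteq> {}" "A \<subseteq> Y" "y \<in> A"
  shows "avg (Y \<rightarrow>\<^sub>E V) (\<lambda>x. h (x y) * (\<Prod>z\<in>A - {y}. g (x z))) = avg V h * avg V g ^ (card A - 1)"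
proof -
  have A: "finite A" using assms finite_subset by blast
  have "avg (Y \<rightarrow>\<^sub>E V) (\<lambda>x. h (x y) * (\<Prod>z\<in>A - {y}. g (x z))) =
      avg (Y \<rightarrow>\<^sub>E V) (\<lambda>x. \<Prod>z\<in>A. (if z = y then h else g) (x z))"
    using A assms by (intro avg_cong) (simp add: prod.remove)
  also have "\<dots> = (\<Prod>z\<in>A. avg V (if z = y then h else g))"
    using assms by (intro avg_PiE_prod) auto
  also have "\<dots> = avg V h * avg V g ^ (card A - 1)"
    using A assms by (simp add: prod.remove)
  finally show ?thesis .
qed

lemma avg_PiE_star2:
  assumes "finite Y" "finite V" "V \<noteq> {}" "A \<subseteq> Y" "y \<in> A" "z \<in> A - {y}"
  shows "avg (Y \<rightarrow>\<^sub>E V) (\<lambda>x. h (x y) * k (x z) * (\<Prod>w\<in>A - {y, z}. g (x w)))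
      = avg V h * avg V k * avg V g ^ (card A - 2)"
proof -
  have A: "finite A" using assms finite_subset by blast
  have eq: "A - {y} - {z} = A - {y, z}" by auto
  have "avg (Y \<rightarrow>\<^sub>E V) (\<lambda>x. h (x y) * k (x z) * (\<Prod>w\<in>A - {y, z}. g (x w))) =
      avg (Y \<rightarrow>\<^sub>E V) (\<lambda>x. \<Prod>w\<in>A. (if w = y then h else if w = z then k else g) (x w))"
  proof (intro avg_cong)
    fix x :: "'a \<Rightarrow> 'b"
    have "(\<Prod>w\<in>A. (if w = y then h else if w = z then k else g) (x w)) =
        h (x y) * (\<Prod>w\<in>A - {y}. (if w = y then h else if w = z then k else g) (x w))"
      using A assms by (subst prod.remove[of A y]) auto
    also have "(\<Prod>w\<in>A - {y}. (if w = y then h else if w = z then k else g) (x w)) =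
        k (x z) * (\<Prod>w\<in>A - {y, z}. (if w = y then h else if w = z then k else g) (x w))"
      using A assms by (subst prod.remove[of "A - {y}" z]) (auto simp: eq)
    also have "(\<Prod>w\<in>A - {y, z}. (if w = y then h else if w = z then k else g) (x w)) = (\<Prod>w\<in>A - {y, z}. g (x w))"
      by (intro prod.cong) auto
    finally show "h (x y) * k (x z) * (\<Prod>w\<in>A - {y, z}. g (x w)) =
        (\<Prod>w\<in>A. (if w = y then h else if w = z then k else g) (x w))" by simp
  qed
  also have "\<dots> = (\<Prod>w\<in>A. avg V (if w = y then h else if w = z then k else g))"
    using assms by (intro avg_PiE_prod) auto
  also have "\<dots> = avg V h * (\<Prod>w\<in>A - {y}. avg V (if w = y then h else if w = z then k else g))"
    using A assms by (subst prod.remove[of A y]) auto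
  also have "(\<Prod>w\<in>A - {y}. avg V (if w = y then h else if w = z then k else g)) =
      avg V k * (\<Prod>w\<in>A - {y, z}. avg V (if w = y then h else if w = z then k else g))"
    using A assms by (subst prod.remove[of "A - {y}" z]) (auto simp: eq)
  also have "(\<Prod>w\<in>A - {y, z}. avg V (if w = y then h else if w = z then k else g)) = avg V g ^ (card A - 2)"
  proof -
    have "y \<noteq> z" using assms by auto
    then have "card (A - {y, z}) = card A - 2" using A assms by (simp add: card_Diff_subset)
    moreover have "(\<Prod>w\<in>A - {y, z}. avg V (if w = y then h else if w = z then k else g)) = (\<Prod>w\<in>A - {y, z}. avg V g)"
      by (intro prod.cong) auto
    ultimately show ?thesis by simp
  qed
  finally show ?thesis by simp
qed

text \<open>The exponential is split at class size \<open>B\<close>: the small part has bounded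
  jumps and is concentrated, the large part is only controlled in mean. Subtracting 1 makes the
  average of the small part the argument of \<open>growth\<close>; \<open>small_deriv\<close> and
  \<open>big_deriv\<close> are the derivatives in the exponent.\<close>

definition small_exp :: "nat \<Rightarrow> real \<Rightarrow> nat \<Rightarrow> real" where
  "small_exp B \<alpha> m = (if m \<le> B then exp (\<alpha> * real m) - 1 else 0)"

definition small_deriv :: "nat \<Rightarrow> real \<Rightarrow> nat \<Rightarrow> real" where
  "small_deriv B \<alpha> m = (if m \<le> B then real m * exp (\<alpha> * real m) else 0)"

definition big_exp :: "nat \<Rightarrow> real \<Rightarrow> nat \<Rightarrow> real" where
  "big_exp B \<mu> m = (if m \<le> B then 0 else exp (\<mu> * real m))"

definition big_deriv :: "nat \<Rightarrow> real \<Rightarrow> nat \<Rightarrow> real" where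
  "big_deriv B \<mu> m = (if m \<le> B then 0 else real m * exp (\<mu> * real m))"

lemma small_exp_nonneg: "0 \<le> \<alpha> \<Longrightarrow> 0 \<le> small_exp B \<alpha> m"
  by (simp add: small_exp_def)

lemma big_exp_nonneg: "0 \<le> big_exp B \<mu> m"
  by (simp add: big_exp_def)

text \<open>The total mass of the classes merging with the class of \<open>x y\<close> when \<open>y\<close> lies in the cycle \<open>A y\<close>,
  weighted by the gain of the functional \<open>f\<close>.\<close>

definition merge_gain :: "'b set \<Rightarrow> ('b \<Rightarrow> 'b set) \<Rightarrow> ('a \<Rightarrow> nat) \<Rightarrow> (nat \<Rightarrow> real) \<Rightarrow> ('b \<Rightarrow> 'a) \<Rightarrow> real" where
  "merge_gain Y A s f x =
     (\<Sum>y\<in>Y. real (s (x y)) * max 0 (f (\<Sum>z\<in>A y. s (x z)) - f (s (x y))))"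

lemma merge_gain_nonneg: "0 \<le> merge_gain Y A s f x"
  by (auto simp: merge_gain_def intro!: sum_nonneg)

context
  fixes Y :: "'b set" and V :: "'a set" and A :: "'b \<Rightarrow> 'b set" and s :: "'a \<Rightarrow> nat"
  assumes fin: "finite Y" "finite V" "V \<noteq> {}"
    and A: "\<And>y. y \<in> Y \<Longrightarrow> A y \<subseteq> Y" "\<And>y. y \<in> Y \<Longrightarrow> y \<in> A y"
begin

lemma finite_A: "y \<in> Y \<Longrightarrow> finite (A y)"
  using A fin finite_subset by blast

lemma sum_A_split: "y \<in> Y \<Longrightarrow> (\<Sum>z\<in>A y. s (x z)) = s (x y) + (\<Sum>z\<in>A y - {y}. s (x z))"
  using A(2) finite_A by (intro sum.remove) auto

lemma s_le_sum: "y \<in> Y \<Longrightarrow> real (s (x y)) \<le> real (\<Sum>z\<in>A y. s (x z))"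
  unfolding sum_A_split of_nat_add by (simp add: sum_nonneg)

lemma prod_exp_A:
  assumes "y \<in> Y"
  shows "exp (\<alpha> * real (\<Sum>z\<in>A y. s (x z))) = exp (\<alpha> * real (s (x y))) * (\<Prod>z\<in>A y - {y}. exp (\<alpha> * real (s (x z))))"
  using assms finite_A unfolding sum_A_split[OF assms]
  by (simp add: distrib_left exp_add exp_sum sum_distrib_left)

text \<open>If the merged class stays within the cut-off, all classes of the cycle do and the
  exponential factorises. If it crosses the cut-off, the functional drops to 0 and the gain is cut
  to 0, while the product form minus \<open>h\<close> is still nonnegative because every factor is
  at least 1.\<close>

lemma avg_merge_gain_small:
  fixes B :: nat
  assumes "0 \<le> \<alpha>"
  defines "\<phi> \<equiv> avg V (\<lambda>v. small_exp B \<alpha> (s v))"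
  shows "avg (Y \<rightarrow>\<^sub>E V) (merge_gain Y A s (small_exp B \<alpha>))
    \<le> avg V (\<lambda>v. small_deriv B \<alpha> (s v)) * (\<Sum>y\<in>Y. (1 + \<phi>) ^ (card (A y) - 1) - 1)"
proof -
  define g where "g = (\<lambda>v. 1 + small_exp B \<alpha> (s v))"
  define h where "h = (\<lambda>v. small_deriv B \<alpha> (s v))"
  have g1: "1 \<le> g v" for v using small_exp_nonneg[OF assms(1)] by (simp add: g_def)
  have h0: "0 \<le> h v" for v by (simp add: h_def small_deriv_def)
  have g_avg: "avg V g = 1 + \<phi>" using fin by (simp add: g_def \<phi>_def avg_add)
  have point: "real (s (x y)) * max 0 (small_exp B \<alpha> (\<Sum>z\<in>A y. s (x z)) - small_exp B \<alpha> (s (x y)))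
      \<le> h (x y) * (\<Prod>z\<in>A y - {y}. g (x z)) - h (x y)" (is "?l \<le> ?r") if y: "y \<in> Y" for x y
  proof (cases "(\<Sum>z\<in>A y. s (x z)) \<le> B")
    case True
    have le: "s (x z) \<le> B" if "z \<in> A y" for z
      using True member_le_sum[OF that, of "\<lambda>z. s (x z)"] finite_A[OF y] by simp
    have "(\<Prod>z\<in>A y - {y}. g (x z)) = (\<Prod>z\<in>A y - {y}. exp (\<alpha> * real (s (x z))))"
      using le by (intro prod.cong) (auto simp: g_def small_exp_def)
    then have r: "?r = real (s (x y)) * (exp (\<alpha> * real (\<Sum>z\<in>A y. s (x z))) - exp (\<alpha> * real (s (x y))))"
      unfolding prod_exp_A[OF y] using le[of y] A(2)[OF y] by (simp add: h_def small_deriv_def algebra_simps)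
    have "exp (\<alpha> * real (s (x y))) \<le> exp (\<alpha> * real (\<Sum>z\<in>A y. s (x z)))"
      using mult_left_mono[OF s_le_sum[OF y, of x] assms(1)] by simp
    then have "?l = ?r" unfolding r using True le[of y] A(2)[OF y] by (simp add: small_exp_def)
    then show ?thesis by simp
  next
    case False
    then have "?l = 0" using small_exp_nonneg[OF assms(1), of B "s (x y)"] by (simp add: small_exp_def)
    moreover have "1 \<le> (\<Prod>z\<in>A y - {y}. g (x z))" using g1 by (intro prod_ge_1) auto
    then have "h (x y) * 1 \<le> h (x y) * (\<Prod>z\<in>A y - {y}. g (x z))" using h0 by (intro mult_left_mono)
    ultimately show ?thesis by linarith
  qed
  have "avg (Y \<rightarrow>\<^sub>E V) (merge_gain Y A s (small_exp B \<alpha>))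
      \<le> avg (Y \<rightarrow>\<^sub>E V) (\<lambda>x. \<Sum>y\<in>Y. h (x y) * (\<Prod>z\<in>A y - {y}. g (x z)) - h (x y))"
    unfolding merge_gain_def by (intro avg_mono sum_mono point)
  also have "\<dots> = (\<Sum>y\<in>Y. avg V h * avg V g ^ (card (A y) - 1) - avg V h)"
    unfolding avg_sum avg_diff
  proof (intro sum.cong refl arg_cong2[where f = "(-)"])
    fix y assume y: "y \<in> Y"
    show "avg (Y \<rightarrow>\<^sub>E V) (\<lambda>x. h (x y) * (\<Prod>z\<in>A y - {y}. g (x z))) = avg V h * avg V g ^ (card (A y) - 1)"
      using fin A y by (intro avg_PiE_star) auto
    show "avg (Y \<rightarrow>\<^sub>E V) (\<lambda>x. h (x y)) = avg V h"
      using avg_PiE_prod[OF fin, of "{y}" "\<lambda>_. h"] y by simp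
  qed
  also have "\<dots> = avg V h * (\<Sum>y\<in>Y. (1 + \<phi>) ^ (card (A y) - 1) - 1)"
    by (simp add: g_avg sum_distrib_left algebra_simps)
  finally show ?thesis by (simp add: h_def)
qed

text \<open>The integrand has an extra factor \<open>s (x y)\<close>. If that class is large, the
  factor is part of \<open>big_deriv\<close>; otherwise it is absorbed by raising the exponent,
  since \<open>m \<le> exp (\<eta> * m) / \<eta>\<close>. A second increase by \<open>\<eta>\<close>
  yields the factor \<open>exp (- \<eta> * B)\<close> when small classes jointly cross
  \<open>B\<close>. Hence \<open>\<Phi>\<close> is taken at exponent
  \<open>\<mu> + 2 * \<eta>\<close>.\<close>

lemma avg_merge_gain_big:
  fixes B :: nat
  assumes "0 \<le> \<mu>" "0 < \<eta>"
  defines "\<Phi> \<equiv> 1 + avg V (\<lambda>v. small_exp B (\<mu> + 2 * \<eta>) (s v))"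
    and "Z \<equiv> avg V (\<lambda>v. exp (\<mu> * real (s v)))"
    and "W \<equiv> avg V (\<lambda>v. big_exp B \<mu> (s v))"
    and "W' \<equiv> avg V (\<lambda>v. big_deriv B \<mu> (s v))"
  shows "avg (Y \<rightarrow>\<^sub>E V) (merge_gain Y A s (big_exp B \<mu>))
    \<le> (\<Sum>y\<in>Y. W' * (Z ^ (card (A y) - 1) - 1)
          + real (card (A y) - 1) * (\<Phi> / \<eta> * W * Z ^ (card (A y) - 2))
          + exp (- \<eta> * real B) / \<eta> * \<Phi> ^ card (A y))"
proof -
  define g where "g = (\<lambda>v. 1 + small_exp B (\<mu> + 2 * \<eta>) (s v))"
  define h where "h = (\<lambda>v. big_deriv B \<mu> (s v))"
  define h2 where "h2 = (\<lambda>v. 1 / \<eta> * g v)"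
  define k where "k = (\<lambda>v. exp (\<mu> * real (s v)))"
  define f where "f = (\<lambda>v. big_exp B \<mu> (s v))"
  have g1: "1 \<le> g v" for v using small_exp_nonneg[of "\<mu> + 2 * \<eta>"] assms by (simp add: g_def)
  have h0: "0 \<le> h v" for v by (simp add: h_def big_deriv_def)
  have f0: "0 \<le> f v" for v by (simp add: f_def big_exp_nonneg)
  have h20: "0 \<le> h2 v" for v using g1[of v] assms by (simp add: h2_def)
  have k0: "0 \<le> k v" and k1: "1 \<le> k v" for v using assms by (auto simp: k_def)
  have g_avg: "avg V g = \<Phi>" using fin by (simp add: g_def \<Phi>_def avg_add)
  have h2_avg: "avg V h2 = \<Phi> / \<eta>" unfolding h2_def avg_cmult by (simp add: g_avg)
  have eta: "real m \<le> exp (\<eta> * real m) / \<eta>" for m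
  proof -
    have "\<eta> * real m \<le> exp (\<eta> * real m)" using exp_ge_add_one_self[of "\<eta> * real m"] by linarith
    then show ?thesis using assms(2) by (simp add: field_simps)
  qed
  \<comment> \<open>One summand for each way in which the merged class can end above
    \<open>B\<close>: the class of \<open>x y\<close> is already large, some partner is large, or
    all are small and only their sum exceeds \<open>B\<close>.\<close>
  define R where "R = (\<lambda>y x. (h (x y) * (\<Prod>z\<in>A y - {y}. k (x z)) - h (x y)) +
      (\<Sum>z\<in>A y - {y}. h2 (x y) * f (x z) * (\<Prod>w\<in>A y - {y, z}. k (x w))) +
      exp (- \<eta> * real B) / \<eta> * (\<Prod>z\<in>A y. g (x z)))"
  have point: "real (s (x y)) * max 0 (big_exp B \<mu> (\<Sum>z\<in>A y. s (x z)) - big_exp B \<mu> (s (x y)))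
      \<le> R y x" (is "?l \<le> _") if y: "y \<in> Y" for x y
  proof -
    define S where "S = (\<Sum>z\<in>A y. s (x z))"
    note sy = sum_A_split[OF y, of x]
    have k1p: "1 \<le> (\<Prod>z\<in>A y - {y}. k (x z))" using k1 by (intro prod_ge_1) auto
    have t1: "0 \<le> h (x y) * (\<Prod>z\<in>A y - {y}. k (x z)) - h (x y)"
      using mult_left_mono[OF k1p h0[of "x y"]] by simp
    have t2': "0 \<le> h2 (x y) * f (x z) * (\<Prod>w\<in>A y - {y, z}. k (x w))" for z
      using h20 f0 k0 by (intro mult_nonneg_nonneg prod_nonneg) auto
    then have t2: "0 \<le> (\<Sum>z\<in>A y - {y}. h2 (x y) * f (x z) * (\<Prod>w\<in>A y - {y, z}. k (x w)))"
      by (intro sum_nonneg) auto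
    have gp: "0 \<le> (\<Prod>z\<in>A y. g (x z))" using g1 by (intro prod_nonneg) (metis order_trans zero_le_one)
    then have t3: "0 \<le> exp (- \<eta> * real B) / \<eta> * (\<Prod>z\<in>A y. g (x z))"
      using assms by simp
    show ?thesis
    proof (cases "B < s (x y)")
      case True
      then have S: "B < S" using sy by (simp add: S_def)
      have "exp (\<mu> * real (s (x y))) \<le> exp (\<mu> * real S)"
        using mult_left_mono[OF s_le_sum[OF y, of x] assms(1)] by (simp add: S_def)
      then have "?l = real (s (x y)) * (exp (\<mu> * real S) - exp (\<mu> * real (s (x y))))"
        using S True by (simp add: big_exp_def S_def[symmetric])
      also have "\<dots> = h (x y) * (\<Prod>z\<in>A y - {y}. k (x z)) - h (x y)"
        unfolding S_def prod_exp_A[OF y] using True by (simp add: h_def big_deriv_def k_def algebra_simps)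
      finally show ?thesis using t2 t3 by (simp add: R_def)
    next
      case small: False
      show ?thesis
      proof (cases "B < S")
        case False
        then have "?l = 0" using small by (simp add: big_exp_def S_def[symmetric])
        then show ?thesis using t1 t2 t3 unfolding R_def by linarith
      next
        case S: True
        have l: "?l = real (s (x y)) * exp (\<mu> * real S)"
          using S small by (simp add: big_exp_def S_def[symmetric])
        show ?thesis
        proof (cases "\<exists>z\<in>A y - {y}. B < s (x z)")
          case True
          then obtain z where z: "z \<in> A y - {y}" "B < s (x z)" by auto
          have "real (s (x y)) * exp (\<mu> * real (s (x y))) \<le> exp (\<eta> * real (s (x y))) / \<eta> * exp (\<mu> * real (s (x y)))"
            using eta by (intro mult_right_mono) auto
          also have "\<dots> = exp ((\<mu> + \<eta>) * real (s (x y))) / \<eta>"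
            by (simp add: exp_add[symmetric] algebra_simps)
          also have "\<dots> \<le> exp ((\<mu> + 2 * \<eta>) * real (s (x y))) / \<eta>"
            using assms by (intro divide_right_mono) (auto intro!: mult_right_mono)
          also have "\<dots> = h2 (x y)" using small by (simp add: h2_def g_def small_exp_def)
          finally have hh: "real (s (x y)) * exp (\<mu> * real (s (x y))) \<le> h2 (x y)" .
          have "(\<Prod>w\<in>A y - {y}. k (x w)) = k (x z) * (\<Prod>w\<in>A y - {y, z}. k (x w))"
            using z finite_A[OF y] by (subst prod.remove[of _ z]) (auto simp: Diff_insert2[symmetric] insert_commute)
          then have "?l = (real (s (x y)) * exp (\<mu> * real (s (x y)))) * f (x z) * (\<Prod>w\<in>A y - {y, z}. k (x w))"
            unfolding l S_def prod_exp_A[OF y] using z by (simp add: k_def f_def big_exp_def)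
          also have "\<dots> \<le> h2 (x y) * f (x z) * (\<Prod>w\<in>A y - {y, z}. k (x w))"
            using hh f0 k0 by (intro mult_right_mono prod_nonneg) auto
          also have "\<dots> \<le> (\<Sum>z\<in>A y - {y}. h2 (x y) * f (x z) * (\<Prod>w\<in>A y - {y, z}. k (x w)))"
            using z t2' finite_A[OF y] by (intro member_le_sum) auto
          finally show ?thesis using t1 t3 by (simp add: R_def)
        next
          case False
          then have le: "s (x z) \<le> B" if "z \<in> A y" for z using that small by (cases "z = y") force+
          have "(\<Prod>z\<in>A y. g (x z)) = (\<Prod>z\<in>A y. exp ((\<mu> + 2 * \<eta>) * real (s (x z))))"
            using le by (intro prod.cong) (auto simp: g_def small_exp_def)
          also have "\<dots> = exp ((\<mu> + 2 * \<eta>) * real S)"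
            using finite_A[OF y] by (simp add: S_def exp_sum[symmetric] sum_distrib_left)
          finally have gS: "(\<Prod>z\<in>A y. g (x z)) = exp ((\<mu> + 2 * \<eta>) * real S)" .
          have "real (s (x y)) \<le> real S" unfolding S_def by (rule s_le_sum[OF y])
          also have "\<dots> \<le> exp (\<eta> * real S) / \<eta>" by (rule eta)
          \<comment> \<open>As \<open>S\<close> exceeds \<open>B\<close>, the factor
            \<open>exp (\<eta> * (S - B))\<close> is at least 1 and may be inserted.\<close>
          also have "\<dots> \<le> exp (\<eta> * real S) * exp (\<eta> * (real S - real B)) / \<eta>"
            using S assms by (intro divide_right_mono) auto
          finally have "?l \<le> exp (\<eta> * real S) * exp (\<eta> * (real S - real B)) / \<eta> * exp (\<mu> * real S)"
            unfolding l by (intro mult_right_mono) auto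
          also have "\<dots> = exp (- \<eta> * real B) / \<eta> * exp ((\<mu> + 2 * \<eta>) * real S)"
            by (simp add: exp_add[symmetric] algebra_simps)
          finally show ?thesis using t1 t2 by (simp add: R_def gS)
        qed
      qed
    qed
  qed
  have "avg (Y \<rightarrow>\<^sub>E V) (merge_gain Y A s (big_exp B \<mu>)) \<le> avg (Y \<rightarrow>\<^sub>E V) (\<lambda>x. \<Sum>y\<in>Y. R y x)"
    unfolding merge_gain_def by (intro avg_mono sum_mono point)
  also have "\<dots> = (\<Sum>y\<in>Y. avg (Y \<rightarrow>\<^sub>E V) (R y))" by (rule avg_sum)
  also have "\<dots> = (\<Sum>y\<in>Y. W' * (Z ^ (card (A y) - 1) - 1)
          + real (card (A y) - 1) * (\<Phi> / \<eta> * W * Z ^ (card (A y) - 2))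
          + exp (- \<eta> * real B) / \<eta> * \<Phi> ^ card (A y))"
  proof (intro sum.cong refl)
    fix y assume y: "y \<in> Y"
    have e1: "avg (Y \<rightarrow>\<^sub>E V) (\<lambda>x. h (x y) * (\<Prod>z\<in>A y - {y}. k (x z))) = avg V h * avg V k ^ (card (A y) - 1)"
      using fin A y by (intro avg_PiE_star) auto
    have e2: "avg (Y \<rightarrow>\<^sub>E V) (\<lambda>x. h (x y)) = avg V h"
      using avg_PiE_prod[OF fin, of "{y}" "\<lambda>_. h"] y by simp
    have e3: "avg (Y \<rightarrow>\<^sub>E V) (\<lambda>x. \<Sum>z\<in>A y - {y}. h2 (x y) * f (x z) * (\<Prod>w\<in>A y - {y, z}. k (x w)))
       = (\<Sum>z\<in>A y - {y}. avg V h2 * avg V f * avg V k ^ (card (A y) - 2))"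
      unfolding avg_sum using fin A y by (intro sum.cong refl avg_PiE_star2) auto
    have e4: "avg (Y \<rightarrow>\<^sub>E V) (\<lambda>x. \<Prod>z\<in>A y. g (x z)) = avg V g ^ card (A y)"
      using avg_PiE_prod[OF fin A(1)[OF y], of "\<lambda>_. g"] by simp
    have "avg (Y \<rightarrow>\<^sub>E V) (R y) = (avg V h * avg V k ^ (card (A y) - 1) - avg V h) +
       (\<Sum>z\<in>A y - {y}. avg V h2 * avg V f * avg V k ^ (card (A y) - 2)) +
       exp (- \<eta> * real B) / \<eta> * avg V g ^ card (A y)"
      unfolding R_def avg_add avg_diff avg_cmult e1 e2 e3 e4 ..
    then show "avg (Y \<rightarrow>\<^sub>E V) (R y) = W' * (Z ^ (card (A y) - 1) - 1)
          + real (card (A y) - 1) * (\<Phi> / \<eta> * W * Z ^ (card (A y) - 2))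
          + exp (- \<eta> * real B) / \<eta> * \<Phi> ^ card (A y)"
      using A(2)[OF y] finite_A[OF y]
      by (simp add: h2_avg g_avg W_def W'_def Z_def h_def f_def k_def algebra_simps)
  qed
  finally show ?thesis .
qed

text \<open>An equality: \<open>1 - exp (- \<alpha> * m)\<close> is nondecreasing and not truncated,
  so the maximum with 0 changes nothing and the product over the cycle factorises exactly.\<close>

lemma avg_merge_gain_ge:
  assumes "0 \<le> \<alpha>"
  defines "\<phi> \<equiv> avg V (\<lambda>v. 1 - exp (- \<alpha> * real (s v)))"
  shows "avg (Y \<rightarrow>\<^sub>E V) (merge_gain Y A s (\<lambda>m. 1 - exp (- \<alpha> * real m)))
    = avg V (\<lambda>v. real (s v) * exp (- \<alpha> * real (s v))) * (\<Sum>y\<in>Y. 1 - (1 - \<phi>) ^ (card (A y) - 1))"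
proof -
  define g where "g = (\<lambda>v. exp (- \<alpha> * real (s v)))"
  define h where "h = (\<lambda>v. real (s v) * exp (- \<alpha> * real (s v)))"
  have g_avg: "avg V g = 1 - \<phi>" using fin by (simp add: g_def \<phi>_def avg_diff)
  have point: "real (s (x y)) * max 0 ((1 - exp (- \<alpha> * real (\<Sum>z\<in>A y. s (x z)))) - (1 - exp (- \<alpha> * real (s (x y)))))
      = h (x y) - h (x y) * (\<Prod>z\<in>A y - {y}. g (x z))" if y: "y \<in> Y" for x y
  proof -
    let ?a = "exp (- \<alpha> * real (s (x y)))" and ?b = "exp (- \<alpha> * real (\<Sum>z\<in>A y. s (x z)))"
    have "\<alpha> * real (s (x y)) \<le> \<alpha> * real (\<Sum>z\<in>A y. s (x z))"
      using s_le_sum[OF y] assms(1) by (rule mult_left_mono)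
    then have "?b \<le> ?a" by simp
    then have "max 0 ((1 - ?b) - (1 - ?a)) = ?a - ?b" by linarith
    then show ?thesis
      unfolding prod_exp_A[OF y, of "- \<alpha>"] by (simp only:) (simp add: h_def g_def algebra_simps)
  qed
  have "avg (Y \<rightarrow>\<^sub>E V) (merge_gain Y A s (\<lambda>m. 1 - exp (- \<alpha> * real m)))
      = avg (Y \<rightarrow>\<^sub>E V) (\<lambda>x. \<Sum>y\<in>Y. h (x y) - h (x y) * (\<Prod>z\<in>A y - {y}. g (x z)))"
    unfolding merge_gain_def by (intro avg_cong sum.cong refl point)
  also have "\<dots> = (\<Sum>y\<in>Y. avg V h - avg V h * avg V g ^ (card (A y) - 1))"
    unfolding avg_sum avg_diff
  proof (intro sum.cong refl arg_cong2[where f = "(-)"])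
    fix y assume y: "y \<in> Y"
    show "avg (Y \<rightarrow>\<^sub>E V) (\<lambda>x. h (x y) * (\<Prod>z\<in>A y - {y}. g (x z))) = avg V h * avg V g ^ (card (A y) - 1)"
      using fin A y by (intro avg_PiE_star) auto
    show "avg (Y \<rightarrow>\<^sub>E V) (\<lambda>x. h (x y)) = avg V h"
      using avg_PiE_prod[OF fin, of "{y}" "\<lambda>_. h"] y by simp
  qed
  also have "\<dots> = avg V h * (\<Sum>y\<in>Y. 1 - (1 - \<phi>) ^ (card (A y) - 1))"
    by (simp add: g_avg sum_distrib_left algebra_simps)
  finally show ?thesis by (simp add: h_def)
qed

end

text \<open>Only the coordinate \<open>t\<close> is resampled: given the others, it falls into the
  class of \<open>x r\<close> with probability at most \<open>M / card V\<close>, and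
  \<open>G\<close> does not depend on it.\<close>

lemma avg_collision_le:
  fixes cl :: "'a \<Rightarrow> 'c" and M :: real
  assumes fin: "finite Y" "finite V" "V \<noteq> {}" and rt: "r \<in> Y" "t \<in> Y" "r \<noteq> t"
    and M: "\<And>v. v \<in> V \<Longrightarrow> real (card {u\<in>V. cl v = cl u}) \<le> M"
    and G: "\<And>x. x \<in> Y \<rightarrow>\<^sub>E V \<Longrightarrow> 0 \<le> G x"
      "\<And>x v. x \<in> Y \<rightarrow>\<^sub>E V \<Longrightarrow> v \<in> V \<Longrightarrow> G (x(t := v)) = G x"
  shows "avg (Y \<rightarrow>\<^sub>E V) (\<lambda>x. of_bool (cl (x r) = cl (x t)) * G x) \<le> M / real (card V) * avg (Y \<rightarrow>\<^sub>E V) G"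
proof -
  have "avg (Y \<rightarrow>\<^sub>E V) (\<lambda>x. of_bool (cl (x r) = cl (x t)) * G x)
      \<le> avg (Y \<rightarrow>\<^sub>E V) (\<lambda>x. M / real (card V) * G x)"
  proof (rule avg_PiE_fun_upd_le[OF fin rt(2)])
    fix x assume x: "x \<in> Y \<rightarrow>\<^sub>E V"
    then have xr: "x r \<in> V" using rt by auto
    have "(\<Sum>v\<in>V. of_bool (cl (x r) = cl v) * G x) = real (card {u\<in>V. cl (x r) = cl u}) * G x"
      using fin by (simp add: sum_distrib_right[symmetric] sum.If_cases of_bool_def Collect_conj_eq[symmetric] Int_def)
    then have "avg V (\<lambda>v. of_bool (cl (x r) = cl v) * G x) = real (card {u\<in>V. cl (x r) = cl u}) * G x / real (card V)"
      by (simp add: avg_def)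
    also have "\<dots> \<le> M * G x / real (card V)"
      using M[OF xr] G(1)[OF x] by (intro divide_right_mono mult_right_mono) auto
    finally show "avg V (\<lambda>v. of_bool (cl ((x(t := v)) r) = cl ((x(t := v)) t)) * G (x(t := v))) \<le> M / real (card V) * G x"
      using rt G(2)[OF x] by (simp cong: avg_cong)
  next
    fix x v assume "x \<in> Y \<rightarrow>\<^sub>E V" "v \<in> V"
    then show "M / real (card V) * G (x(t := v)) = M / real (card V) * G x" using G(2) by simp
  qed
  then show ?thesis by (simp only: avg_cmult)
qed

lemma pair_le_sum:
  fixes f :: "'a \<Rightarrow> 'a \<Rightarrow> real"
  assumes "finite Y" "\<And>r t. 0 \<le> f r t" "r \<in> Y" "t \<in> Y" "r \<noteq> t"
  shows "f r t \<le> (\<Sum>r\<in>Y. \<Sum>t\<in>Y - {r}. f r t)"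
proof -
  have "f r t \<le> (\<Sum>t\<in>Y - {r}. f r t)"
    using assms by (intro member_le_sum) auto
  also have "\<dots> \<le> (\<Sum>r\<in>Y. \<Sum>t\<in>Y - {r}. f r t)"
    using assms by (intro member_le_sum[where f = "\<lambda>r. \<Sum>t\<in>Y - {r}. f r t"] sum_nonneg) auto
  finally show ?thesis .
qed

lemma not_inj_on_le_sum:
  assumes "finite Y"
  shows "of_bool (\<not> inj_on f Y) \<le> (\<Sum>r\<in>Y. \<Sum>t\<in>Y - {r}. of_bool (f r = f t) :: real)"
proof (cases "inj_on f Y")
  case False
  then obtain r t where rt: "r \<in> Y" "t \<in> Y" "r \<noteq> t" "f r = f t" by (auto simp: inj_on_def)
  then have "1 \<le> (\<Sum>r\<in>Y. \<Sum>t\<in>Y - {r}. of_bool (f r = f t) :: real)"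
    using pair_le_sum[OF assms, of "\<lambda>r t. of_bool (f r = f t)", OF _ rt(1-3)] by simp
  then show ?thesis using False by simp
qed (auto intro!: sum_nonneg)

lemma sum_pairs_le:
  assumes "finite Y" "0 \<le> (c :: real)" "\<And>r t. r \<in> Y \<Longrightarrow> t \<in> Y \<Longrightarrow> r \<noteq> t \<Longrightarrow> f r t \<le> c"
  shows "(\<Sum>r\<in>Y. \<Sum>t\<in>Y - {r}. f r t) \<le> real (card Y) ^ 2 * c"
proof -
  have "(\<Sum>t\<in>Y - {r}. f r t) \<le> real (card Y) * c" if "r \<in> Y" for r
  proof -
    have "(\<Sum>t\<in>Y - {r}. f r t) \<le> (\<Sum>t\<in>Y - {r}. c)" using assms that by (intro sum_mono) auto
    also have "\<dots> \<le> (\<Sum>t\<in>Y. c)" using assms by (intro sum_mono2) auto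
    finally show ?thesis by simp
  qed
  then have "(\<Sum>r\<in>Y. \<Sum>t\<in>Y - {r}. f r t) \<le> (\<Sum>r\<in>Y. real (card Y) * c)" by (rule sum_mono)
  then show ?thesis by (simp add: power2_eq_square)
qed

section \<open>One uniform step: expected change and maximal jump of the functionals\<close>

locale perm_class =
  fixes V :: "'a set" and \<Gamma> :: "('a \<Rightarrow> 'a) set" and L :: nat
  assumes finV: "finite V" and V_nonempty: "V \<noteq> {}" and \<Gamma>_nonempty: "\<Gamma> \<noteq> {}"
    and \<Gamma>_permutes: "\<And>g. g \<in> \<Gamma> \<Longrightarrow> g permutes V"
    and \<Gamma>_conj: "\<And>\<pi> g. \<pi> permutes V \<Longrightarrow> g \<in> \<Gamma> \<Longrightarrow> \<pi> \<circ> g \<circ> inv \<pi> \<in> \<Gamma>"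
    and card_support: "\<And>g. g \<in> \<Gamma> \<Longrightarrow> card {y. g y \<noteq> y} = L"
begin

abbreviation "n \<equiv> card V"

lemma n_pos: "0 < n" using finV V_nonempty by (simp add: card_gt_0_iff)

lemma finite_\<Gamma>: "finite \<Gamma>"
  using \<Gamma>_permutes finite_permutations[OF finV] by (metis (mono_tags) finite_subset mem_Collect_eq subsetI)

lemma finite_support: "g \<in> \<Gamma> \<Longrightarrow> finite {y. g y \<noteq> y}"
  using support_subset[OF \<Gamma>_permutes] finV finite_subset by metis

lemma merge_stepI: "set xs \<subseteq> \<Gamma> \<Longrightarrow> p \<in> \<Gamma> \<Longrightarrow> \<pi> permutes V \<Longrightarrow> merge_step V xs p \<pi>"
  using finV \<Gamma>_permutes by (auto simp: merge_step_def)

lemma avg_\<Gamma>_le: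
  assumes "\<And>p. p \<in> \<Gamma> \<Longrightarrow> avg {\<pi>. \<pi> permutes V} (\<lambda>\<pi>. Q (\<pi> \<circ> p \<circ> inv \<pi>)) \<le> b"
  shows "avg \<Gamma> Q \<le> b"
proof -
  have "avg \<Gamma> Q = avg \<Gamma> (\<lambda>g. avg {\<pi>. \<pi> permutes V} (\<lambda>\<pi>. Q (\<pi> \<circ> g \<circ> inv \<pi>)))"
    by (rule avg_conjugation[OF finV finite_\<Gamma> \<Gamma>_conj])
  then show ?thesis
    using avg_le_const[OF finite_\<Gamma> \<Gamma>_nonempty assms] by simp
qed

lemma avg_\<Gamma>_ge:
  assumes "\<And>p. p \<in> \<Gamma> \<Longrightarrow> b \<le> avg {\<pi>. \<pi> permutes V} (\<lambda>\<pi>. Q (\<pi> \<circ> p \<circ> inv \<pi>))"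
  shows "b \<le> avg \<Gamma> Q"
proof -
  have "avg \<Gamma> Q = avg \<Gamma> (\<lambda>g. avg {\<pi>. \<pi> permutes V} (\<lambda>\<pi>. Q (\<pi> \<circ> g \<circ> inv \<pi>)))"
    by (rule avg_conjugation[OF finV finite_\<Gamma> \<Gamma>_conj])
  then show ?thesis
    using avg_ge_const[OF finite_\<Gamma> \<Gamma>_nonempty assms] by simp
qed

lemma avg_perms_const: "avg {\<pi>. \<pi> permutes V} (\<lambda>_. c) = c"
  using finV by (intro avg_const) (auto simp: finite_permutations intro!: exI[of _ id] permutes_id)

text \<open>Without a collision the change is bounded by \<open>merge_gain\<close>; with one, all
  touched vertices are charged by the crude bound. The error collects at most \<open>L ^ 2\<close>
  pairs, a collision probability of at most \<open>M / n\<close>, at most \<open>L * M\<close>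
  touched vertices, and a factor \<open>Z\<close> for every remaining point.\<close>

lemma avg_component_sum_le:
  fixes f :: "nat \<Rightarrow> real" and M \<mu> K b :: real
  assumes xs: "set xs \<subseteq> \<Gamma>" and f: "\<And>m. 0 \<le> f m" "\<And>m. f m \<le> K * exp (\<mu> * real m)"
    and par: "0 \<le> K" "0 \<le> \<mu>"
    and M: "\<And>v. v \<in> V \<Longrightarrow> real (card (component xs v)) \<le> M"
    and b: "\<And>p. p \<in> \<Gamma> \<Longrightarrow>
      avg ({y. p y \<noteq> y} \<rightarrow>\<^sub>E V) (merge_gain {y. p y \<noteq> y} (orbit p) (\<lambda>v. card (component xs v)) f) \<le> b"
  defines "Z \<equiv> avg V (\<lambda>v. exp (\<mu> * real (card (component xs v))))"
  shows "avg \<Gamma> (\<lambda>g. \<Sum>v\<in>V. f (card (component (xs @ [g]) v)))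
    \<le> (\<Sum>v\<in>V. f (card (component xs v))) + inj_ratio n L * (b + K * real L ^ 3 * M\<^sup>2 * Z ^ L / real n)"
proof (rule avg_\<Gamma>_le)
  fix p assume p: "p \<in> \<Gamma>"
  define Y where "Y = {y. p y \<noteq> y}"
  define s where "s = (\<lambda>v. card (component xs v))"
  define C0 where "C0 = (\<Sum>v\<in>V. f (card (component xs v)))"
  define k where "k = (\<lambda>v. exp (\<mu> * real (s v)))"
  \<comment> \<open>Charge for a collision involving \<open>t\<close>. It omits the coordinate
    \<open>t\<close>, so that it is independent of whether \<open>t\<close> falls into the class of
    another point.\<close>
  define G where "G = (\<lambda>t x. K * real L * M * (\<Prod>y\<in>Y - {t}. k (x y)))"
  define F where "F = (\<lambda>x. merge_gain Y (orbit p) s f x +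
      (\<Sum>r\<in>Y. \<Sum>t\<in>Y - {r}. of_bool (component xs (x r) = component xs (x t)) * G t x))"
  have Y: "finite Y" "Y \<subseteq> V" "card Y = L"
    using finite_support[OF p] support_subset[OF \<Gamma>_permutes[OF p]] card_support[OF p] by (auto simp: Y_def)
  have M0: "0 \<le> M" using M V_nonempty by (metis all_not_in_conv of_nat_0_le_iff order_trans)
  have k0: "0 \<le> k v" for v by (simp add: k_def)
  have G0: "0 \<le> G t x" for t x using M0 par k0 by (auto simp: G_def intro!: mult_nonneg_nonneg prod_nonneg)
  have F0: "0 \<le> F x" for x
    unfolding F_def using G0 by (intro add_nonneg_nonneg merge_gain_nonneg sum_nonneg) auto
  have point: "(\<Sum>v\<in>V. f (card (component (xs @ [\<pi> \<circ> p \<circ> inv \<pi>]) v))) \<le> C0 + F (restrict \<pi> Y)"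
    if \<pi>: "\<pi> permutes V" for \<pi>
  proof -
    interpret ms: merge_step V xs p \<pi> using merge_stepI[OF xs p \<pi>] .
    have orb: "orbit p y \<subseteq> Y" if "y \<in> Y" for y
      using orbit_subset_support[OF \<Gamma>_permutes[OF p]] that by (simp add: Y_def)
    have restr: "merge_gain Y (orbit p) s f (restrict \<pi> Y) =
       (\<Sum>y\<in>Y. real (s (\<pi> y)) * max 0 (f (\<Sum>z\<in>orbit p y. s (\<pi> z)) - f (s (\<pi> y))))"
    proof -
      have "(\<Sum>z\<in>orbit p y. s (restrict \<pi> Y z)) = (\<Sum>z\<in>orbit p y. s (\<pi> z))" if "y \<in> Y" for y
        using orb[OF that] by (intro sum.cong) auto
      then show ?thesis unfolding merge_gain_def by (intro sum.cong) auto
    qed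
    have Pn: "0 \<le> (\<Sum>r\<in>Y. \<Sum>t\<in>Y - {r}. of_bool (component xs (restrict \<pi> Y r) = component xs (restrict \<pi> Y t)) * G t (restrict \<pi> Y))"
      using G0 by (intro sum_nonneg) auto
    show ?thesis
    proof (cases "inj_on (\<lambda>y. component xs (\<pi> y)) Y")
      case True
      have "(\<Sum>v\<in>V. f (card (ms.new v))) = C0 + (\<Sum>y\<in>Y. real (s (\<pi> y)) * (f (\<Sum>z\<in>orbit p y. s (\<pi> z)) - f (s (\<pi> y))))"
        using ms.sum_no_collision[of f] True by (simp add: C0_def Y_def s_def)
      also have "\<dots> \<le> C0 + merge_gain Y (orbit p) s f (restrict \<pi> Y)"
        unfolding restr by (intro add_left_mono sum_mono mult_left_mono) auto
      also have "\<dots> \<le> C0 + F (restrict \<pi> Y)" using Pn by (simp add: F_def)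
      finally show ?thesis by (simp only: ms.q_def)
    next
      case False
      then obtain r t where rt: "r \<in> Y" "t \<in> Y" "r \<noteq> t" "component xs (\<pi> r) = component xs (\<pi> t)"
        by (auto simp: inj_on_def)
      \<comment> \<open>The class of \<open>\<pi> t\<close> is also that of \<open>\<pi> r\<close>,
        so \<open>t\<close> can be left out of the union.\<close>
      have tch: "ms.touched = (\<Union>y\<in>Y - {t}. component xs (\<pi> y))"
      proof
        show "ms.touched \<subseteq> (\<Union>y\<in>Y - {t}. component xs (\<pi> y))"
        proof
          fix v assume "v \<in> ms.touched"
          then obtain y where y: "y \<in> Y" "v \<in> component xs (\<pi> y)" unfolding Y_def by blast
          show "v \<in> (\<Union>y\<in>Y - {t}. component xs (\<pi> y))"
            using y rt by (cases "y = t") auto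
        qed
      qed (auto simp: Y_def)
      have "card ms.touched \<le> (\<Sum>y\<in>Y - {t}. s (\<pi> y))"
        unfolding tch s_def using Y by (intro card_UN_le) auto
      then have ct: "real (card ms.touched) \<le> (\<Sum>y\<in>Y - {t}. real (s (\<pi> y)))"
        by (metis of_nat_le_iff of_nat_sum)
      have "real (s (\<pi> y)) \<le> M" if "y \<in> Y" for y
        unfolding s_def using that Y \<pi> by (intro M) (auto simp: permutes_in_image)
      then have "(\<Sum>y\<in>Y - {t}. real (s (\<pi> y))) \<le> (\<Sum>y\<in>Y - {t}. M)"
        by (intro sum_mono) auto
      also have "\<dots> \<le> real L * M" using Y M0 rt by (auto intro!: mult_right_mono)
      finally have ctM: "real (card ms.touched) \<le> real L * M" using ct by linarith
      have ex: "exp (\<mu> * real (card ms.touched)) \<le> (\<Prod>y\<in>Y - {t}. k (\<pi> y))"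
      proof -
        have "\<mu> * real (card ms.touched) \<le> (\<Sum>y\<in>Y - {t}. \<mu> * real (s (\<pi> y)))"
          using mult_left_mono[OF ct par(2)] by (simp add: sum_distrib_left)
        then show ?thesis using Y by (simp add: k_def exp_sum[symmetric])
      qed
      have fin_touched: "finite ms.touched" using ms.touched_subset finV finite_subset by blast
      have "f (card (ms.new v)) \<le> K * exp (\<mu> * real (card ms.touched))" if "v \<in> ms.touched" for v
      proof -
        have "card (ms.new v) \<le> card ms.touched"
          using ms.new_touched_subset[OF that] fin_touched by (rule card_mono[rotated])
        then have "K * exp (\<mu> * real (card (ms.new v))) \<le> K * exp (\<mu> * real (card ms.touched))"
          using par by (intro mult_left_mono) (auto intro: mult_left_mono)
        then show ?thesis using f(2)[of "card (ms.new v)"] by linarith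
      qed
      then have "(\<Sum>v\<in>ms.touched. f (card (ms.new v))) \<le> (\<Sum>v\<in>ms.touched. K * exp (\<mu> * real (card ms.touched)))"
        by (intro sum_mono)
      also have "\<dots> = real (card ms.touched) * (K * exp (\<mu> * real (card ms.touched)))" by simp
      also have "\<dots> \<le> (real L * M) * (K * (\<Prod>y\<in>Y - {t}. k (\<pi> y)))"
        using ctM ex par M0 by (intro mult_mono mult_left_mono) auto
      also have "\<dots> = G t (restrict \<pi> Y)"
      proof -
        have "(\<Prod>y\<in>Y - {t}. k (restrict \<pi> Y y)) = (\<Prod>y\<in>Y - {t}. k (\<pi> y))" by (intro prod.cong) auto
        then show ?thesis by (simp only: G_def) (simp add: ac_simps)
      qed
      also have "\<dots> = of_bool (component xs (restrict \<pi> Y r) = component xs (restrict \<pi> Y t)) * G t (restrict \<pi> Y)"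
        using rt by simp
      also have "\<dots> \<le> (\<Sum>r\<in>Y. \<Sum>t\<in>Y - {r}. of_bool (component xs (restrict \<pi> Y r) = component xs (restrict \<pi> Y t)) * G t (restrict \<pi> Y))"
        using Y(1) G0 rt(1-3) by (intro pair_le_sum) auto
      finally have "(\<Sum>v\<in>ms.touched. f (card (ms.new v))) \<le> F (restrict \<pi> Y)"
        unfolding F_def using merge_gain_nonneg[of Y "orbit p" s f "restrict \<pi> Y"] by linarith
      then show ?thesis
        using ms.sum_collision_le[of f, OF f(1)] unfolding C0_def ms.q_def by linarith
    qed
  qed
  have one: "1 \<le> Z"
    unfolding Z_def using finV V_nonempty par by (intro avg_ge_const) auto
  have coll: "avg (Y \<rightarrow>\<^sub>E V) (\<lambda>x. of_bool (component xs (x r) = component xs (x t)) * G t x)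
      \<le> K * real L * M\<^sup>2 * Z ^ L / real n" if rt: "r \<in> Y" "t \<in> Y" "r \<noteq> t" for r t
  proof -
    have "avg (Y \<rightarrow>\<^sub>E V) (\<lambda>x. of_bool (component xs (x r) = component xs (x t)) * G t x)
       \<le> M / real n * avg (Y \<rightarrow>\<^sub>E V) (G t)"
    proof (rule avg_collision_le[OF Y(1) finV V_nonempty rt])
      fix v assume v: "v \<in> V"
      have "card {u \<in> V. component xs v = component xs u} \<le> card (component xs v)"
        using finite_subset[OF component_subset_carrier[of xs V, OF \<Gamma>_permutes v] finV] xs
        by (intro card_mono) (auto simp: component_eq_iff intro: component_sym)
      then show "real (card {u \<in> V. component xs v = component xs u}) \<le> M" using M[OF v] by linarith
    next
      fix x v show "0 \<le> G t x" by (rule G0)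
      have "(\<Prod>y\<in>Y - {t}. k ((x(t := v)) y)) = (\<Prod>y\<in>Y - {t}. k (x y))" by (intro prod.cong) auto
      then show "G t (x(t := v)) = G t x" by (simp only: G_def)
    qed
    also have "avg (Y \<rightarrow>\<^sub>E V) (G t) = K * real L * M * Z ^ card (Y - {t})"
      unfolding G_def avg_cmult using Y finV V_nonempty
      by (subst avg_PiE_prod) (auto simp: Z_def k_def s_def)
    also have "M / real n * (K * real L * M * Z ^ card (Y - {t})) \<le> M / real n * (K * real L * M * Z ^ L)"
      using one M0 par Y rt by (intro mult_left_mono power_increasing) auto
    finally show ?thesis by (simp add: power2_eq_square ac_simps)
  qed
  have "avg (Y \<rightarrow>\<^sub>E V) F \<le> b + (\<Sum>r\<in>Y. \<Sum>t\<in>Y - {r}. avg (Y \<rightarrow>\<^sub>E V) (\<lambda>x. of_bool (component xs (x r) = component xs (x t)) * G t x))"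
    using b[OF p] unfolding F_def avg_add by (simp add: Y_def s_def avg_sum)
  also have "(\<Sum>r\<in>Y. \<Sum>t\<in>Y - {r}. avg (Y \<rightarrow>\<^sub>E V) (\<lambda>x. of_bool (component xs (x r) = component xs (x t)) * G t x))
     \<le> real (card Y) ^ 2 * (K * real L * M\<^sup>2 * Z ^ L / real n)"
    using Y one M0 par coll by (intro sum_pairs_le) auto
  also have "\<dots> = K * real L ^ 3 * M\<^sup>2 * Z ^ L / real n"
    using Y by (simp add: power2_eq_square power3_eq_cube)
  finally have EF: "avg (Y \<rightarrow>\<^sub>E V) F \<le> b + K * real L ^ 3 * M\<^sup>2 * Z ^ L / real n" by simp
  have "avg {\<pi>. \<pi> permutes V} (\<lambda>\<pi>. \<Sum>v\<in>V. f (card (component (xs @ [\<pi> \<circ> p \<circ> inv \<pi>]) v)))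
      \<le> avg {\<pi>. \<pi> permutes V} (\<lambda>\<pi>. C0 + F (restrict \<pi> Y))"
    by (intro avg_mono) (use point in auto)
  also have "\<dots> = C0 + avg {\<pi>. \<pi> permutes V} (\<lambda>\<pi>. F (restrict \<pi> Y))"
    by (simp only: avg_add avg_perms_const)
  also have "\<dots> \<le> C0 + inj_ratio n (card Y) * avg (Y \<rightarrow>\<^sub>E V) F"
    using avg_permutations_le[OF finV Y(2), of F] F0 by simp
  also have "\<dots> \<le> C0 + inj_ratio n L * (b + K * real L ^ 3 * M\<^sup>2 * Z ^ L / real n)"
    unfolding Y(3) using EF inj_ratio_nonneg by (intro add_left_mono mult_left_mono)
  finally show "avg {\<pi>. \<pi> permutes V} (\<lambda>\<pi>. \<Sum>v\<in>V. f (card (component (xs @ [\<pi> \<circ> p \<circ> inv \<pi>]) v)))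
    \<le> (\<Sum>v\<in>V. f (card (component xs v))) + inj_ratio n L * (b + K * real L ^ 3 * M\<^sup>2 * Z ^ L / real n)"
    by (simp only: C0_def)
qed

text \<open>A collision can only waste gain, because the functional grows with the classes. The
  wasted gain is at most the sum of \<open>h (x y)\<close> over the moved points, so
  \<open>\<phi>'\<close> factors out of the error as well; this makes the error comparable with the
  loss from lowering the exponent, which is also proportional to \<open>\<phi>'\<close>.\<close>

lemma avg_component_sum_ge:
  fixes \<alpha> M :: real
  assumes xs: "set xs \<subseteq> \<Gamma>" and \<alpha>: "0 \<le> \<alpha>"
    and M: "\<And>v. v \<in> V \<Longrightarrow> real (card (component xs v)) \<le> M"
  defines "\<phi> \<equiv> avg V (\<lambda>v. 1 - exp (- \<alpha> * real (card (component xs v))))"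
    and "\<phi>' \<equiv> avg V (\<lambda>v. real (card (component xs v)) * exp (- \<alpha> * real (card (component xs v))))"
  assumes b: "\<And>p. p \<in> \<Gamma> \<Longrightarrow> b \<le> (\<Sum>y\<in>{y. p y \<noteq> y}. 1 - (1 - \<phi>) ^ (card (orbit p y) - 1))"
  shows "(\<Sum>v\<in>V. 1 - exp (- \<alpha> * real (card (component xs v)))) + \<phi>' * (b - real L ^ 3 * M / real n)
    \<le> avg \<Gamma> (\<lambda>g. \<Sum>v\<in>V. 1 - exp (- \<alpha> * real (card (component (xs @ [g]) v))))"
proof (rule avg_\<Gamma>_ge)
  fix p assume p: "p \<in> \<Gamma>"
  define Y where "Y = {y. p y \<noteq> y}"
  define s where "s = (\<lambda>v. card (component xs v))"
  define f where "f = (\<lambda>m. 1 - exp (- \<alpha> * real m))"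
  define C0 where "C0 = (\<Sum>v\<in>V. f (card (component xs v)))"
  define h where "h = (\<lambda>v. real (s v) * exp (- \<alpha> * real (s v)))"
  define cl where "cl = component xs"
  define F where "F = (\<lambda>x. merge_gain Y (orbit p) s f x * of_bool (inj_on (\<lambda>y. cl (x y)) Y))"
  have Y: "finite Y" "Y \<subseteq> V" "card Y = L"
    using finite_support[OF p] support_subset[OF \<Gamma>_permutes[OF p]] card_support[OF p] by (auto simp: Y_def)
  have orb: "orbit p y \<subseteq> Y" "y \<in> orbit p y" if "y \<in> Y" for y
    using orbit_subset_support[OF \<Gamma>_permutes[OF p]] self_in_orbit[OF finV \<Gamma>_permutes[OF p]] that by (simp_all add: Y_def)
  have M0: "0 \<le> M" using M V_nonempty by (metis all_not_in_conv of_nat_0_le_iff order_trans)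
  have h0: "0 \<le> h v" for v by (simp add: h_def)
  have f_mono: "f m \<le> f m'" if "m \<le> m'" for m m'
    using that \<alpha> by (simp add: f_def mult_left_mono)
  have F0: "0 \<le> F x" for x unfolding F_def using merge_gain_nonneg[of Y "orbit p" s f x] by simp
  have gain_le: "merge_gain Y (orbit p) s f x \<le> (\<Sum>y\<in>Y. h (x y))" for x
    unfolding merge_gain_def h_def
    by (intro sum_mono mult_left_mono) (auto simp: f_def)
  have point: "C0 + F (restrict \<pi> Y) \<le> (\<Sum>v\<in>V. f (card (component (xs @ [\<pi> \<circ> p \<circ> inv \<pi>]) v)))"
    if \<pi>: "\<pi> permutes V" for \<pi>
  proof -
    interpret ms: merge_step V xs p \<pi> using merge_stepI[OF xs p \<pi>] .
    have inj_eq: "inj_on (\<lambda>y. cl (restrict \<pi> Y y)) Y = inj_on (\<lambda>y. cl (\<pi> y)) Y"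
      by (intro inj_on_cong) simp
    have restr: "merge_gain Y (orbit p) s f (restrict \<pi> Y) =
       (\<Sum>y\<in>Y. real (s (\<pi> y)) * (f (\<Sum>z\<in>orbit p y. s (\<pi> z)) - f (s (\<pi> y))))"
    proof -
      have "(\<Sum>z\<in>orbit p y. s (restrict \<pi> Y z)) = (\<Sum>z\<in>orbit p y. s (\<pi> z))" if "y \<in> Y" for y
        using orb[OF that] by (intro sum.cong) auto
      moreover have "f (s (\<pi> y)) \<le> f (\<Sum>z\<in>orbit p y. s (\<pi> z))" if "y \<in> Y" for y
        using orb[OF that] Y(1) finite_subset
        by (intro f_mono member_le_sum[where f = "\<lambda>z. s (\<pi> z)"]) auto
      ultimately show ?thesis unfolding merge_gain_def by (intro sum.cong) (auto simp: max_def)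
    qed
    show ?thesis
    proof (cases "inj_on (\<lambda>y. cl (\<pi> y)) Y")
      case True
      then have "F (restrict \<pi> Y) = merge_gain Y (orbit p) s f (restrict \<pi> Y)"
        unfolding F_def inj_eq by simp
      then show ?thesis
        using ms.sum_no_collision[of f] True unfolding restr by (simp add: C0_def Y_def s_def ms.q_def cl_def)
    next
      case False
      then have "F (restrict \<pi> Y) = 0" unfolding F_def inj_eq by simp
      moreover have "C0 \<le> (\<Sum>v\<in>V. f (card (ms.new v)))"
        unfolding C0_def using ms.old_subset_new ms.new_finite by (intro sum_mono f_mono card_mono)
      ultimately show ?thesis by (simp add: ms.q_def)
    qed
  qed
  have coll: "avg (Y \<rightarrow>\<^sub>E V) (\<lambda>x. of_bool (cl (x r) = cl (x t)) * h (x y)) \<le> M / real n * avg V h"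
    if rt: "r \<in> Y" "t \<in> Y" "r \<noteq> t" and y: "y \<in> Y" for r t y
  proof -
    have card_le: "real (card {u \<in> V. cl v = cl u}) \<le> M" if v: "v \<in> V" for v
    proof -
      have "card {u \<in> V. cl v = cl u} \<le> card (component xs v)"
        using finite_subset[OF component_subset_carrier[of xs V, OF \<Gamma>_permutes v] finV] xs
        by (intro card_mono) (auto simp: component_eq_iff cl_def intro: component_sym)
      then show ?thesis using M[OF v] by linarith
    qed
    have hy: "avg (Y \<rightarrow>\<^sub>E V) (\<lambda>x. h (x y)) = avg V h"
      using avg_PiE_prod[OF Y(1) finV V_nonempty, of "{y}" "\<lambda>_. h"] y by simp
    \<comment> \<open>At least one of the two colliding coordinates differs from \<open>y\<close>;
      it is the one to be resampled, which leaves \<open>h (x y)\<close> untouched.\<close>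
    obtain r' t' where rt': "r' \<in> Y" "t' \<in> Y" "r' \<noteq> t'" "t' \<noteq> y" "{r', t'} = {r, t}"
      using rt by (cases "t = y") auto
    have "(cl (x r) = cl (x t)) = (cl (x r') = cl (x t'))" for x
      using rt'(5) by (auto simp: doubleton_eq_iff)
    then have "avg (Y \<rightarrow>\<^sub>E V) (\<lambda>x. of_bool (cl (x r) = cl (x t)) * h (x y)) =
        avg (Y \<rightarrow>\<^sub>E V) (\<lambda>x. of_bool (cl (x r') = cl (x t')) * h (x y))" by simp
    also have "\<dots> \<le> M / real n * avg (Y \<rightarrow>\<^sub>E V) (\<lambda>x. h (x y))"
      using rt' h0 card_le by (intro avg_collision_le[OF Y(1) finV V_nonempty]) auto
    finally show ?thesis by (simp only: hy)
  qed
  have hV: "avg V h = \<phi>'" by (simp add: h_def \<phi>'_def s_def)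
  have h0V: "0 \<le> avg V h" using h0 by (rule avg_nonneg)
  have "avg (Y \<rightarrow>\<^sub>E V) (merge_gain Y (orbit p) s f) =
      \<phi>' * (\<Sum>y\<in>Y. 1 - (1 - \<phi>) ^ (card (orbit p y) - 1))"
    using avg_merge_gain_ge[OF Y(1) finV V_nonempty, of "orbit p" \<alpha> s] orb \<alpha>
    by (simp add: f_def s_def \<phi>_def \<phi>'_def)
  also have "\<dots> \<ge> \<phi>' * b"
    using b[OF p] h0V unfolding hV Y_def by (intro mult_left_mono)
  finally have main: "\<phi>' * b \<le> avg (Y \<rightarrow>\<^sub>E V) (merge_gain Y (orbit p) s f)" .
  have "merge_gain Y (orbit p) s f x - (\<Sum>r\<in>Y. \<Sum>t\<in>Y - {r}. \<Sum>y\<in>Y. of_bool (cl (x r) = cl (x t)) * h (x y)) \<le> F x" for x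
  proof -
    have "merge_gain Y (orbit p) s f x * of_bool (\<not> inj_on (\<lambda>y. cl (x y)) Y)
        \<le> (\<Sum>y\<in>Y. h (x y)) * (\<Sum>r\<in>Y. \<Sum>t\<in>Y - {r}. of_bool (cl (x r) = cl (x t)))"
      using gain_le h0 not_inj_on_le_sum[OF Y(1), of "\<lambda>y. cl (x y)"]
      by (intro mult_mono) (auto intro: sum_nonneg)
    also have "\<dots> = (\<Sum>r\<in>Y. \<Sum>t\<in>Y - {r}. \<Sum>y\<in>Y. of_bool (cl (x r) = cl (x t)) * h (x y))"
      by (simp add: sum_distrib_left sum_distrib_right mult.commute)
    finally show ?thesis unfolding F_def by (cases "inj_on (\<lambda>y. cl (x y)) Y") auto
  qed
  then have "avg (Y \<rightarrow>\<^sub>E V) (\<lambda>x. merge_gain Y (orbit p) s f x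
      - (\<Sum>r\<in>Y. \<Sum>t\<in>Y - {r}. \<Sum>y\<in>Y. of_bool (cl (x r) = cl (x t)) * h (x y))) \<le> avg (Y \<rightarrow>\<^sub>E V) F"
    by (intro avg_mono)
  moreover have "(\<Sum>r\<in>Y. \<Sum>t\<in>Y - {r}. \<Sum>y\<in>Y. avg (Y \<rightarrow>\<^sub>E V) (\<lambda>x. of_bool (cl (x r) = cl (x t)) * h (x y)))
      \<le> real (card Y) ^ 2 * (real L * (M / real n * avg V h))"
  proof (rule sum_pairs_le[OF Y(1)])
    show "0 \<le> real L * (M / real n * avg V h)" using M0 h0V by simp
    fix r t assume rt: "r \<in> Y" "t \<in> Y" "r \<noteq> t"
    have "(\<Sum>y\<in>Y. avg (Y \<rightarrow>\<^sub>E V) (\<lambda>x. of_bool (cl (x r) = cl (x t)) * h (x y))) \<le> (\<Sum>y\<in>Y. M / real n * avg V h)"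
      using coll[OF rt] by (rule sum_mono)
    then show "(\<Sum>y\<in>Y. avg (Y \<rightarrow>\<^sub>E V) (\<lambda>x. of_bool (cl (x r) = cl (x t)) * h (x y))) \<le> real L * (M / real n * avg V h)"
      using Y(3) by simp
  qed
  ultimately have "\<phi>' * b - real L ^ 2 * (real L * (M / real n * \<phi>')) \<le> avg (Y \<rightarrow>\<^sub>E V) F"
    using main by (simp add: avg_diff avg_sum hV Y(3))
  then have EF: "\<phi>' * (b - real L ^ 3 * M / real n) \<le> avg (Y \<rightarrow>\<^sub>E V) F"
    by (simp add: power2_eq_square power3_eq_cube algebra_simps)
  \<comment> \<open>Points in distinct classes are distinct, so the indicator demanded by
    \<open>avg_permutations_ge\<close> is already contained in \<open>F\<close>.\<close>
  have F_inj: "F x * of_bool (inj_on x Y) = F x" for x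
    unfolding F_def by (auto simp: inj_on_def)
  have "avg (Y \<rightarrow>\<^sub>E V) F \<le> avg {\<pi>. \<pi> permutes V} (\<lambda>\<pi>. F (restrict \<pi> Y))"
    using avg_permutations_ge[OF finV Y(2), of F] F0 unfolding F_inj by blast
  then have "C0 + \<phi>' * (b - real L ^ 3 * M / real n) \<le> C0 + avg {\<pi>. \<pi> permutes V} (\<lambda>\<pi>. F (restrict \<pi> Y))"
    using EF by linarith
  also have "\<dots> = avg {\<pi>. \<pi> permutes V} (\<lambda>\<pi>. C0 + F (restrict \<pi> Y))"
    by (simp only: avg_add avg_perms_const)
  also have "\<dots> \<le> avg {\<pi>. \<pi> permutes V} (\<lambda>\<pi>. \<Sum>v\<in>V. f (card (component (xs @ [\<pi> \<circ> p \<circ> inv \<pi>]) v)))"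
    by (intro avg_mono) (use point in auto)
  finally show "(\<Sum>v\<in>V. 1 - exp (- \<alpha> * real (card (component xs v)))) + \<phi>' * (b - real L ^ 3 * M / real n)
    \<le> avg {\<pi>. \<pi> permutes V} (\<lambda>\<pi>. \<Sum>v\<in>V. 1 - exp (- \<alpha> * real (card (component (xs @ [\<pi> \<circ> p \<circ> inv \<pi>]) v))))"
    by (simp only: C0_def f_def)
qed

lemma component_sum_jump:
  fixes f D :: "nat \<Rightarrow> real"
  assumes xs: "set xs \<subseteq> \<Gamma>" and g: "g \<in> \<Gamma>"
    and D: "\<And>m m'. 1 \<le> m \<Longrightarrow> m \<le> m' \<Longrightarrow> \<bar>f m' - f m\<bar> \<le> D m" "\<And>m. real m * D m \<le> K"
  shows "\<bar>(\<Sum>v\<in>V. f (card (component (xs @ [g]) v))) - (\<Sum>v\<in>V. f (card (component xs v)))\<bar> \<le> real L * K"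
proof -
  \<comment> \<open>The jump bound holds for every single step, so the trivial relabelling
    suffices.\<close>
  interpret ms: merge_step V xs g id using merge_stepI[OF xs g permutes_id] .
  have "ms.q = g" by (simp add: ms.q_def)
  then have "\<bar>(\<Sum>v\<in>V. f (card (component (xs @ [g]) v))) - (\<Sum>v\<in>V. f (card (component xs v)))\<bar>
    \<le> (\<Sum>y\<in>{y. g y \<noteq> y}. real (card (component xs (id y))) * D (card (component xs (id y))))"
    using ms.sum_jump[of f D, OF D(1)] by simp
  also have "\<dots> \<le> (\<Sum>y\<in>{y. g y \<noteq> y}. K)" using D(2) by (intro sum_mono)
  finally show ?thesis using card_support[OF g] by simp
qed

text \<open>The classification \<open>cl\<close> is left open: it is later the cycle of a point
  under the current product, not its component.\<close>

lemma avg_support_collision_le: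
  fixes M :: real
  assumes M: "\<And>v. v \<in> V \<Longrightarrow> real (card {u\<in>V. cl v = cl u}) \<le> M" and M0: "0 \<le> M"
  shows "avg \<Gamma> (\<lambda>g. of_bool (\<not> inj_on cl {y. g y \<noteq> y})) \<le> inj_ratio n L * (real L ^ 2 * (M / real n))"
proof (rule avg_\<Gamma>_le)
  fix p assume p: "p \<in> \<Gamma>"
  define Y where "Y = {y. p y \<noteq> y}"
  have Y: "finite Y" "Y \<subseteq> V" "card Y = L"
    using finite_support[OF p] support_subset[OF \<Gamma>_permutes[OF p]] card_support[OF p] by (auto simp: Y_def)
  define F where "F = (\<lambda>x. of_bool (\<not> inj_on (\<lambda>y. cl (x y)) Y) :: real)"
  have point: "of_bool (\<not> inj_on cl {y. (\<pi> \<circ> p \<circ> inv \<pi>) y \<noteq> y}) = F (restrict \<pi> Y)" if \<pi>: "\<pi> permutes V" for \<pi>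
  proof -
    interpret ms: merge_step V "[]" p \<pi> using merge_stepI[OF _ p \<pi>, of "[]"] by simp
    have "{y. (\<pi> \<circ> p \<circ> inv \<pi>) y \<noteq> y} = \<pi> ` Y"
      using ms.q_support by (simp add: ms.q_def Y_def)
    moreover have "inj_on cl (\<pi> ` Y) = inj_on (\<lambda>y. cl (\<pi> y)) Y"
      using comp_inj_on_iff[of \<pi> Y cl] \<pi> by (simp add: comp_def inj_on_subset[OF permutes_inj])
    moreover have "inj_on (\<lambda>y. cl (restrict \<pi> Y y)) Y = inj_on (\<lambda>y. cl (\<pi> y)) Y"
      by (intro inj_on_cong) simp
    ultimately show ?thesis unfolding F_def by simp
  qed
  have "avg {\<pi>. \<pi> permutes V} (\<lambda>\<pi>. of_bool (\<not> inj_on cl {y. (\<pi> \<circ> p \<circ> inv \<pi>) y \<noteq> y}))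
      = avg {\<pi>. \<pi> permutes V} (\<lambda>\<pi>. F (restrict \<pi> Y))"
    by (intro avg_cong) (use point in auto)
  also have "\<dots> \<le> inj_ratio n (card Y) * avg (Y \<rightarrow>\<^sub>E V) F"
    by (rule avg_permutations_le[OF finV Y(2)]) (simp add: F_def)
  also have "avg (Y \<rightarrow>\<^sub>E V) F \<le> avg (Y \<rightarrow>\<^sub>E V) (\<lambda>x. \<Sum>r\<in>Y. \<Sum>t\<in>Y - {r}. of_bool (cl (x r) = cl (x t)))"
    unfolding F_def by (intro avg_mono not_inj_on_le_sum Y(1))
  also have "\<dots> \<le> real (card Y) ^ 2 * (M / real n)"
    unfolding avg_sum
  proof (rule sum_pairs_le[OF Y(1)])
    fix r t assume "r \<in> Y" "t \<in> Y" "r \<noteq> t"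
    from avg_collision_le[OF Y(1) finV V_nonempty this M, of "\<lambda>_. 1"]
    show "avg (Y \<rightarrow>\<^sub>E V) (\<lambda>x. of_bool (cl (x r) = cl (x t))) \<le> M / real n"
      using Y finV V_nonempty by (simp add: avg_def card_PiE)
  qed (use M0 in simp)
  finally show "avg {\<pi>. \<pi> permutes V} (\<lambda>\<pi>. of_bool (\<not> inj_on cl {y. (\<pi> \<circ> p \<circ> inv \<pi>) y \<noteq> y}))
    \<le> inj_ratio n L * (real L ^ 2 * (M / real n))"
    using inj_ratio_nonneg Y(3) by (simp add: mult_left_mono)
qed

text \<open>One moved point \<open>y\<close> and its image are enough: under a uniform relabelling
  they become a uniform ordered pair of distinct points, and the numerator counts such pairs in
  \<open>T \<times> U\<close>.\<close>

lemma avg_pair_ge: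
  assumes "0 < L" and TU: "T \<subseteq> V" "U \<subseteq> V"
  shows "(real (card T) * real (card U) - real (card (T \<inter> U))) / real n ^ 2
    \<le> avg \<Gamma> (\<lambda>g. of_bool (\<exists>x. g x \<noteq> x \<and> x \<in> T \<and> g x \<in> U))"
proof (rule avg_\<Gamma>_ge)
  fix p assume p: "p \<in> \<Gamma>"
  have "{y. p y \<noteq> y} \<noteq> {}" using card_support[OF p] assms(1) by (metis card.empty less_irrefl)
  then obtain y where y: "p y \<noteq> y" by auto
  define Y where "Y = {y, p y}"
  have Y: "finite Y" "Y \<subseteq> V" "card Y = 2"
    using y \<Gamma>_permutes[OF p] by (auto simp: Y_def permutes_in_image dest: permutes_not_in)
  define F where "F = (\<lambda>x. of_bool (x y \<in> T \<and> x (p y) \<in> U) :: real)"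
  have inj2: "inj_on x Y \<longleftrightarrow> x y \<noteq> x (p y)" for x :: "'a \<Rightarrow> 'a" using y by (auto simp: Y_def)
  have split: "(\<Sum>x\<in>Y \<rightarrow>\<^sub>E V. H (x y) (x (p y))) = (\<Sum>u\<in>V. \<Sum>v\<in>V. H u v)" for H :: "'a \<Rightarrow> 'a \<Rightarrow> real"
  proof -
    have "(\<Sum>u\<in>V. \<Sum>v\<in>V. H u v) = (\<Sum>(u, v)\<in>V \<times> V. H u v)" by (simp add: sum.cartesian_product)
    also have "\<dots> = (\<Sum>x\<in>Y \<rightarrow>\<^sub>E V. H (x y) (x (p y)))"
      using y
      by (intro sum.reindex_bij_witness[where i = "\<lambda>x. (x y, x (p y))"
            and j = "\<lambda>(u, v). \<lambda>z\<in>Y. if z = y then u else v"])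
         (auto simp: Y_def PiE_iff extensional_def fun_eq_iff)
    finally show ?thesis by simp
  qed
  have "(real (card T) * real (card U) - real (card (T \<inter> U))) / real n ^ 2 = avg (Y \<rightarrow>\<^sub>E V) (\<lambda>x. F x * of_bool (inj_on x Y))"
  proof -
    have "(\<Sum>x\<in>Y \<rightarrow>\<^sub>E V. F x * of_bool (inj_on x Y)) = (\<Sum>u\<in>V. \<Sum>v\<in>V. of_bool (u \<in> T \<and> v \<in> U) * of_bool (u \<noteq> v))"
      unfolding F_def inj2 by (rule split)
    also have "\<dots> = (\<Sum>u\<in>V. of_bool (u \<in> T) * (real (card U) - of_bool (u \<in> U)))"
    proof (intro sum.cong refl)
      fix u assume u: "u \<in> V"
      have "(\<Sum>v\<in>V. of_bool (u \<in> T \<and> v \<in> U) * of_bool (u \<noteq> v)) = (of_bool (u \<in> T) * (\<Sum>v\<in>V. of_bool (v \<in> U) - of_bool (v \<in> U \<and> v = u)) :: real)"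
        unfolding sum_distrib_left by (intro sum.cong) auto
      also have "(\<Sum>v\<in>V. of_bool (v \<in> U) - of_bool (v \<in> U \<and> v = u)) = real (card U) - of_bool (u \<in> U)"
      proof -
        have "V \<inter> U = U" "V \<inter> {v. v \<in> U \<and> v = u} = (if u \<in> U then {u} else {})" using TU u by auto
        then show ?thesis using finV by (simp add: sum_subtractf)
      qed
      finally show "(\<Sum>v\<in>V. of_bool (u \<in> T \<and> v \<in> U) * of_bool (u \<noteq> v)) = of_bool (u \<in> T) * (real (card U) - of_bool (u \<in> U))" .
    qed
    also have "\<dots> = real (card T) * real (card U) - real (card (T \<inter> U))"
    proof -
      have "V \<inter> T = T" "V \<inter> {u. u \<in> T \<and> u \<in> U} = T \<inter> U" using TU by auto
      then show ?thesis
        using finV by (simp add: right_diff_distrib sum_subtractf sum_distrib_right[symmetric] of_bool_conj[symmetric])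
    qed
    finally show ?thesis using Y by (simp add: avg_def card_PiE)
  qed
  also have "\<dots> \<le> avg {\<pi>. \<pi> permutes V} (\<lambda>\<pi>. F (restrict \<pi> Y))"
    by (rule avg_permutations_ge[OF finV Y(2)]) (simp add: F_def)
  also have "\<dots> \<le> avg {\<pi>. \<pi> permutes V} (\<lambda>\<pi>. of_bool (\<exists>x. (\<pi> \<circ> p \<circ> inv \<pi>) x \<noteq> x \<and> x \<in> T \<and> (\<pi> \<circ> p \<circ> inv \<pi>) x \<in> U))"
  proof (rule avg_mono)
    fix \<pi> assume "\<pi> \<in> {\<pi>. \<pi> permutes V}"
    then have \<pi>: "\<pi> permutes V" by simp
    have "(\<pi> \<circ> p \<circ> inv \<pi>) (\<pi> y) = \<pi> (p y)" using \<pi> by (simp add: permutes_inverses)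
    moreover have "\<pi> (p y) \<noteq> \<pi> y" using y permutes_eq_iff[OF \<pi>] by simp
    ultimately have "\<exists>x. (\<pi> \<circ> p \<circ> inv \<pi>) x \<noteq> x \<and> x \<in> T \<and> (\<pi> \<circ> p \<circ> inv \<pi>) x \<in> U" if "\<pi> y \<in> T" "\<pi> (p y) \<in> U"
      using that by (intro exI[of _ "\<pi> y"]) simp
    then show "F (restrict \<pi> Y) \<le> of_bool (\<exists>x. (\<pi> \<circ> p \<circ> inv \<pi>) x \<noteq> x \<and> x \<in> T \<and> (\<pi> \<circ> p \<circ> inv \<pi>) x \<in> U)"
      unfolding F_def Y_def by (auto simp del: comp_apply)
  qed
  finally show "(real (card T) * real (card U) - real (card (T \<inter> U))) / real n ^ 2
    \<le> avg {\<pi>. \<pi> permutes V} (\<lambda>\<pi>. of_bool (\<exists>x. (\<pi> \<circ> p \<circ> inv \<pi>) x \<noteq> x \<and> x \<in> T \<and> (\<pi> \<circ> p \<circ> inv \<pi>) x \<in> U))" .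
qed

end

section \<open>Conjugacy classes and critical parameters\<close>

lemma orbit_conj:
  assumes "\<pi> permutes V"
  shows "orbit (\<pi> \<circ> p \<circ> inv \<pi>) (\<pi> x) = \<pi> ` orbit p x"
proof (intro equalityI subsetI)
  fix y assume "y \<in> orbit (\<pi> \<circ> p \<circ> inv \<pi>) (\<pi> x)"
  then show "y \<in> \<pi> ` orbit p x"
    by induction (use assms in \<open>auto simp: permutes_inverses intro: orbit.intros\<close>)
next
  have "\<pi> z \<in> orbit (\<pi> \<circ> p \<circ> inv \<pi>) (\<pi> x)" if "z \<in> orbit p x" for z
    using that
  proof induction
    case base
    have "(\<pi> \<circ> p \<circ> inv \<pi>) (\<pi> x) \<in> orbit (\<pi> \<circ> p \<circ> inv \<pi>) (\<pi> x)" by (rule orbit.base)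
    moreover have "(\<pi> \<circ> p \<circ> inv \<pi>) (\<pi> x) = \<pi> (p x)" using assms by (simp add: permutes_inverses)
    ultimately show ?case by (simp only:)
  next
    case (step z)
    then have "(\<pi> \<circ> p \<circ> inv \<pi>) (\<pi> z) \<in> orbit (\<pi> \<circ> p \<circ> inv \<pi>) (\<pi> x)" by (intro orbit.step)
    moreover have "(\<pi> \<circ> p \<circ> inv \<pi>) (\<pi> z) = \<pi> (p z)" using assms by (simp add: permutes_inverses)
    ultimately show ?case by (simp only:)
  qed
  then show "y \<in> orbit (\<pi> \<circ> p \<circ> inv \<pi>) (\<pi> x)" if "y \<in> \<pi> ` orbit p x" for y
    using that by auto
qed

lemma cycle_class_permutes: "p \<in> cycle_class J k n \<Longrightarrow> p permutes {1..n}"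
  by (simp add: cycle_class_def)

lemma cycle_class_conj:
  assumes p: "p \<in> cycle_class J k n" and \<pi>: "\<pi> permutes {1..n}"
  shows "\<pi> \<circ> p \<circ> inv \<pi> \<in> cycle_class J k n"
proof -
  let ?q = "\<pi> \<circ> p \<circ> inv \<pi>"
  have pp: "p permutes {1..n}" using p by (rule cycle_class_permutes)
  have inj: "inj \<pi>" using \<pi> by (rule permutes_inj)
  have card_orbit: "card (orbit ?q (\<pi> x)) = card (orbit p x)" for x
    unfolding orbit_conj[OF \<pi>] using inj by (simp add: card_image inj_on_subset)
  have cyc: "perm_cycles n ?q = (image \<pi>) ` perm_cycles n p"
  proof -
    have "perm_cycles n ?q = orbit ?q ` (\<pi> ` {1..n})"
      using permutes_image[OF \<pi>] by (simp add: perm_cycles_def)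
    also have "\<dots> = (image \<pi>) ` perm_cycles n p"
      unfolding perm_cycles_def image_image orbit_conj[OF \<pi>] ..
    finally show ?thesis .
  qed
  have "card {c \<in> perm_cycles n ?q. card c = j} = card {c \<in> perm_cycles n p. card c = j}" for j
  proof -
    have "{c \<in> perm_cycles n ?q. card c = j} = (image \<pi>) ` {c \<in> perm_cycles n p. card c = j}"
      unfolding cyc using inj by (auto simp: card_image inj_on_subset)
    moreover have "inj_on (image \<pi>) X" for X using inj by (simp add: inj_on_def inj_image_eq_iff)
    ultimately show ?thesis by (simp add: card_image)
  qed
  moreover have "?q x = x" if "x \<in> {1..n}" "card (orbit ?q x) \<notin> {2..J}" for x
  proof -
    define y where "y = inv \<pi> x"
    have y: "x = \<pi> y" "y \<in> {1..n}"
      using \<pi> that(1) permutes_in_image[OF permutes_inv[OF \<pi>], of x]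
      by (simp_all only: y_def permutes_inverses)
    have "card (orbit p y) \<notin> {2..J}" using that(2) card_orbit[of y] y(1) by simp
    then have "p y = y" using p y(2) by (simp add: cycle_class_def)
    then show ?thesis using \<pi> by (simp add: y(1) permutes_inverses)
  qed
  moreover have "?q permutes {1..n}" using pp \<pi> by (intro permutes_compose permutes_inv)
  ultimately show ?thesis using p by (simp add: cycle_class_def)
qed

lemma cycle_class_orbit_card:
  assumes p: "p \<in> cycle_class J k n" and y: "p y \<noteq> y"
  shows "card (orbit p y) \<in> {2..J}"
proof -
  have "y \<in> {1..n}" using cycle_class_permutes[OF p] y permutes_not_in by metis
  then show ?thesis using p y by (auto simp: cycle_class_def)
qed

lemma card_support_length:
  assumes p: "p \<in> cycle_class J k n" and j: "j \<in> {2..J}"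
  shows "card {y \<in> {y. p y \<noteq> y}. card (orbit p y) = j} = j * k j"
proof -
  have pp: "p permutes {1..n}" using p by (rule cycle_class_permutes)
  define C where "C = {c \<in> perm_cycles n p. card c = j}"
  have self: "y \<in> orbit p y" for y using self_in_orbit[OF _ pp] by simp
  have single: "p y = y \<longleftrightarrow> orbit p y = {y}" for y by (simp add: orbit_eq_singleton_iff)
  have "\<Union>C = {y \<in> {y. p y \<noteq> y}. card (orbit p y) = j}"
  proof (intro equalityI subsetI)
    fix y assume "y \<in> \<Union>C"
    then obtain x where x: "x \<in> {1..n}" "card (orbit p x) = j" "y \<in> orbit p x"
      by (auto simp: C_def perm_cycles_def)
    then have "orbit p y = orbit p x" using orbit_eq[OF _ pp] by simp
    then show "y \<in> {y \<in> {y. p y \<noteq> y}. card (orbit p y) = j}" using x j single[of y] by auto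
  next
    fix y assume y: "y \<in> {y \<in> {y. p y \<noteq> y}. card (orbit p y) = j}"
    then have "y \<in> {1..n}" using pp permutes_not_in by fastforce
    then have "orbit p y \<in> C" using y by (simp add: C_def perm_cycles_def)
    then show "y \<in> \<Union>C" using self by blast
  qed
  moreover have "card (\<Union>C) = (\<Sum>c\<in>C. card c)"
  proof (rule card_Union_disjoint)
    show "pairwise disjnt C"
    proof (rule pairwiseI)
      fix c d assume "c \<in> C" "d \<in> C" "c \<noteq> d"
      then show "disjnt c d"
        using orbit_eq[OF _ pp] by (auto simp: C_def perm_cycles_def disjnt_def) (metis finite_atLeastAtMost)+
    qed
    show "finite c" if "c \<in> C" for c
      using that j by (intro card_ge_0_finite) (simp add: C_def)
  qed
  moreover have "(\<Sum>c\<in>C. card c) = j * card C" by (simp add: C_def)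
  moreover have "card C = k j" using p j by (simp add: C_def cycle_class_def)
  ultimately show ?thesis by simp
qed

text \<open>Sums over the moved points depend only on the cycle type. The expected gains are
  therefore the same for every representative \<open>p\<close> and turn into \<open>growth\<close>
  and \<open>decay\<close>.\<close>

lemma sum_support:
  fixes f :: "nat \<Rightarrow> real"
  assumes p: "p \<in> cycle_class J k n"
  shows "(\<Sum>y\<in>{y. p y \<noteq> y}. f (card (orbit p y))) = (\<Sum>j=2..J. real (j * k j) * f j)"
proof -
  have pp: "p permutes {1..n}" using p by (rule cycle_class_permutes)
  have fin: "finite {y. p y \<noteq> y}" using support_subset[OF pp] finite_subset by blast
  have "(\<Sum>y\<in>{y. p y \<noteq> y}. f (card (orbit p y))) =
      (\<Sum>j=2..J. \<Sum>y\<in>{y \<in> {y. p y \<noteq> y}. card (orbit p y) = j}. f (card (orbit p y)))"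
    using cycle_class_orbit_card[OF p] by (intro sum.group[symmetric] fin) auto
  also have "\<dots> = (\<Sum>j=2..J. real (j * k j) * f j)"
  proof (intro sum.cong refl)
    fix j assume j: "j \<in> {2..J}"
    have "(\<Sum>y\<in>{y \<in> {y. p y \<noteq> y}. card (orbit p y) = j}. f (card (orbit p y))) =
        (\<Sum>y\<in>{y \<in> {y. p y \<noteq> y}. card (orbit p y) = j}. f j)"
      by (intro sum.cong) auto
    then show "(\<Sum>y\<in>{y \<in> {y. p y \<noteq> y}. card (orbit p y) = j}. f (card (orbit p y))) = real (j * k j) * f j"
      using card_support_length[OF p j] by simp
  qed
  finally show ?thesis .
qed

lemma card_support_cycle_class:
  assumes p: "p \<in> cycle_class J k n"
  shows "card {y. p y \<noteq> y} = (\<Sum>j=2..J. j * k j)"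
proof -
  have "real (card {y. p y \<noteq> y}) = (\<Sum>y\<in>{y. p y \<noteq> y}. 1)" by simp
  also have "\<dots> = (\<Sum>j=2..J. real (j * k j) * 1)" using sum_support[OF p, of "\<lambda>_. 1"] .
  also have "\<dots> = real (\<Sum>j=2..J. j * k j)" by simp
  finally show ?thesis by linarith
qed

section \<open>Merging rates, their slope at 0, and the choice of characteristics\<close>

locale cycle_type =
  fixes J :: nat and k :: "nat \<Rightarrow> nat"
  assumes nontrivial: "\<exists>j\<in>{2..J}. k j \<noteq> 0"
begin

definition "L = (\<Sum>j=2..J. j * k j)"

definition "\<kappa> = (\<Sum>j=2..J. real (j * (j - 1) * k j))"

text \<open>Merging rate when the other points of a cycle contribute independent factors of mean
  \<open>1 + h\<close>: each of the \<open>j * k j\<close> points in cycles of length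
  \<open>j\<close> has \<open>j - 1\<close> partners. The slope at 0 is \<open>\<kappa>\<close>, the
  inverse of the critical time.\<close>

definition "growth h = (\<Sum>j=2..J. real (j * k j) * ((1 + h) ^ (j - 1) - 1))"

text \<open>Equals \<open>- growth (- h)\<close>: the partners now contribute factors of mean
  \<open>1 - h\<close>.\<close>

definition "decay h = (\<Sum>j=2..J. real (j * k j) * (1 - (1 - h) ^ (j - 1)))"

lemma L_pos: "0 < L"
  unfolding L_def using nontrivial by (auto simp: sum_nonneg_eq_0_iff intro!: gr0I)

lemma \<kappa>_pos: "0 < \<kappa>"
proof -
  obtain j where j: "j \<in> {2..J}" "k j \<noteq> 0" using nontrivial by auto
  have "0 < real (j * (j - 1) * k j)" using j by auto
  also have "\<dots> \<le> \<kappa>" unfolding \<kappa>_def using j by (intro member_le_sum) auto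
  finally show ?thesis .
qed

lemma perm_classI:
  assumes "1 \<le> n" "cycle_class J k n \<noteq> {}"
  shows "perm_class {1..n} (cycle_class J k n) L"
  using assms cycle_class_permutes cycle_class_conj card_support_cycle_class
  by (auto simp: perm_class_def L_def)

lemma growth_mono: "0 \<le> h \<Longrightarrow> h \<le> h' \<Longrightarrow> growth h \<le> growth h'"
  unfolding growth_def by (intro sum_mono mult_left_mono diff_right_mono power_mono) auto

lemma decay_mono: "h \<le> h' \<Longrightarrow> h' \<le> 1 \<Longrightarrow> decay h \<le> decay h'"
  unfolding decay_def by (intro sum_mono mult_left_mono diff_left_mono power_mono) auto

lemma growth_deriv: "(growth has_real_derivative \<kappa>) (at 0)"
  unfolding growth_def[abs_def] \<kappa>_def
proof (rule DERIV_sum)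
  fix j assume j: "j \<in> {2..J}"
  have "((\<lambda>h. real (j * k j) * ((1 + h) ^ (j - 1) - 1)) has_real_derivative
      real (j * k j) * (real (j - 1) * (1 + 0) ^ (j - 1 - 1))) (at 0)"
    by (auto intro!: derivative_eq_intros)
  then show "((\<lambda>h. real (j * k j) * ((1 + h) ^ (j - 1) - 1)) has_real_derivative real (j * (j - 1) * k j)) (at 0)"
    by (simp add: ac_simps)
qed

lemma decay_deriv: "(decay has_real_derivative \<kappa>) (at 0)"
  unfolding decay_def[abs_def] \<kappa>_def
proof (rule DERIV_sum)
  fix j assume j: "j \<in> {2..J}"
  have "((\<lambda>h. real (j * k j) * (1 - (1 - h) ^ (j - 1))) has_real_derivative
      real (j * k j) * (real (j - 1) * (1 - 0) ^ (j - 1 - 1))) (at 0)"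
    by (auto intro!: derivative_eq_intros)
  then show "((\<lambda>h. real (j * k j) * (1 - (1 - h) ^ (j - 1))) has_real_derivative real (j * (j - 1) * k j)) (at 0)"
    by (simp add: ac_simps)
qed

lemma growth_0 [simp]: "growth 0 = 0" and decay_0 [simp]: "decay 0 = 0"
  by (simp_all add: growth_def decay_def)

lemma deriv_quotient_at_right:
  fixes f :: "real \<Rightarrow> real"
  assumes "(f has_real_derivative D) (at 0)" "f 0 = 0"
  shows "((\<lambda>x. f x / x) \<longlongrightarrow> D) (at_right 0)"
proof -
  have "((\<lambda>x. (f x - f 0) / (x - 0)) \<longlongrightarrow> D) (at 0)"
    using assms(1) unfolding has_field_derivative_iff .
  then show ?thesis using assms(2) by (auto intro: tendsto_mono[OF at_le])
qed

text \<open>Everything is scaled with the initial exponent \<open>a\<close>, which tends to 0: then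
  \<open>exp a - 1\<close> is about \<open>a\<close>, and \<open>growth (\<rho> * a)\<close> about
  \<open>\<kappa> * \<rho> * a\<close>. A \<open>\<rho>\<close> strictly between 1 and
  \<open>1 / (\<kappa> * t)\<close> leaves room on both sides; the interval from \<open>a\<close> to
  \<open>\<rho> * a\<close> is divided at its midpoint between \<open>h\<close> and
  \<open>\<epsilon>\<close>.\<close>

lemma subcritical_parameters:
  assumes t: "0 < t" "\<kappa> * t < 1"
  obtains a h \<epsilon> where "0 < a" "exp a - 1 < h" "0 < \<epsilon>" "t * growth (h + \<epsilon>) < a"
proof -
  define \<rho> where "\<rho> = (1 + 1 / (\<kappa> * t)) / 2"
  have kt: "0 < \<kappa> * t" using t \<kappa>_pos by simp
  have inv: "1 < 1 / (\<kappa> * t)" using kt t(2) by (simp add: field_simps)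
  have \<rho>: "1 < \<rho>" "\<rho> < 1 / (\<kappa> * t)" using inv by (simp_all add: \<rho>_def)
  have \<rho>t: "\<kappa> * (\<rho> * t) < 1" using \<rho>(2) kt by (simp add: pos_less_divide_eq ac_simps)
  have e1: "((\<lambda>x. (exp x - 1) / x) \<longlongrightarrow> 1) (at_right (0::real))"
    by (rule deriv_quotient_at_right) (auto intro!: derivative_eq_intros)
  have d: "((\<lambda>x. t * growth (\<rho> * x)) has_real_derivative t * (\<kappa> * \<rho>)) (at 0)"
    using DERIV_chain2[of growth \<kappa> "\<lambda>x. \<rho> * x" 0 \<rho> UNIV] growth_deriv
    by (auto intro!: derivative_eq_intros DERIV_cmult)
  have e2: "((\<lambda>x. t * growth (\<rho> * x) / x) \<longlongrightarrow> t * (\<kappa> * \<rho>)) (at_right 0)"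
    by (rule deriv_quotient_at_right[OF d]) simp
  have "\<forall>\<^sub>F x in at_right 0. (exp x - 1) / x < (1 + \<rho>) / 2"
    using \<rho> by (intro order_tendstoD(2)[OF e1]) simp
  moreover have "\<forall>\<^sub>F x in at_right 0. t * growth (\<rho> * x) / x < 1"
    using \<rho>t by (intro order_tendstoD(2)[OF e2]) (simp add: ac_simps)
  moreover have "\<forall>\<^sub>F x in at_right (0::real). 0 < x" by (simp add: eventually_at_right_less)
  ultimately have "\<forall>\<^sub>F x in at_right 0. (exp x - 1) / x < (1 + \<rho>) / 2 \<and> t * growth (\<rho> * x) / x < 1 \<and> 0 < x"
    by eventually_elim simp
  then obtain a where a: "(exp a - 1) / a < (1 + \<rho>) / 2" "t * growth (\<rho> * a) / a < 1" "0 < a"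
    using eventually_happens'[OF trivial_limit_at_right_real] by blast
  show ?thesis
  proof (rule that[of a "(1 + \<rho>) / 2 * a" "(\<rho> - 1) / 2 * a"])
    have "(1 + \<rho>) / 2 * a + (\<rho> - 1) / 2 * a = \<rho> * a" by (simp add: field_simps)
    then show "t * growth ((1 + \<rho>) / 2 * a + (\<rho> - 1) / 2 * a) < a"
      using a by (simp add: pos_divide_less_eq)
  qed (use a \<rho> in \<open>auto simp: pos_divide_less_eq\<close>)
qed

text \<open>Mirror image with \<open>\<rho>\<close> strictly between
  \<open>1 / (\<kappa> * t)\<close> and 1: while the functional stays above \<open>h'\<close>, any
  speed up to \<open>decay h'\<close> is admissible, and this is enough to use up the exponent
  \<open>a\<close> before time \<open>t\<close>.\<close>

lemma supercritical_parameters: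
  assumes t: "0 < t" "1 < \<kappa> * t"
  obtains a h h' where "0 < a" "0 < h'" "h' < h" "h < 1 - exp (- a)" "a < t * decay h'"
proof -
  define \<rho> where "\<rho> = (1 + 1 / (\<kappa> * t)) / 2"
  have inv: "0 < 1 / (\<kappa> * t)" "1 / (\<kappa> * t) < 1" using t by auto
  have "0 < (1 + r) / 2 \<and> (1 + r) / 2 < 1 \<and> r < (1 + r) / 2" if "0 < r" "r < 1" for r :: real
    using that by auto
  from this[OF inv] have \<rho>: "0 < \<rho>" "\<rho> < 1" "1 / (\<kappa> * t) < \<rho>" unfolding \<rho>_def by blast+
  have \<rho>t: "1 < \<kappa> * (\<rho> * t)" using \<rho>(3) t by (simp add: pos_divide_less_eq ac_simps)
  have e1: "((\<lambda>x. (1 - exp (- x)) / x) \<longlongrightarrow> 1) (at_right (0::real))"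
    by (rule deriv_quotient_at_right) (auto intro!: derivative_eq_intros)
  have d: "((\<lambda>x. t * decay (\<rho> * x)) has_real_derivative t * (\<kappa> * \<rho>)) (at 0)"
    using DERIV_chain2[of decay \<kappa> "\<lambda>x. \<rho> * x" 0 \<rho> UNIV] decay_deriv
    by (auto intro!: derivative_eq_intros DERIV_cmult)
  have e2: "((\<lambda>x. t * decay (\<rho> * x) / x) \<longlongrightarrow> t * (\<kappa> * \<rho>)) (at_right 0)"
    by (rule deriv_quotient_at_right[OF d]) simp
  have "\<forall>\<^sub>F x in at_right 0. (1 + \<rho>) / 2 < (1 - exp (- x)) / x"
    using \<rho> by (intro order_tendstoD(1)[OF e1]) simp
  moreover have "\<forall>\<^sub>F x in at_right 0. 1 < t * decay (\<rho> * x) / x"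
    using \<rho>t by (intro order_tendstoD(1)[OF e2]) (simp add: ac_simps)
  moreover have "\<forall>\<^sub>F x in at_right (0::real). 0 < x" by (simp add: eventually_at_right_less)
  ultimately have "\<forall>\<^sub>F x in at_right 0. (1 + \<rho>) / 2 < (1 - exp (- x)) / x \<and> 1 < t * decay (\<rho> * x) / x \<and> 0 < x"
    by eventually_elim simp
  then obtain a where a: "(1 + \<rho>) / 2 < (1 - exp (- a)) / a" "1 < t * decay (\<rho> * a) / a" "0 < a"
    using eventually_happens'[OF trivial_limit_at_right_real] by blast
  show ?thesis
  \<comment> \<open>The smaller multiple \<open>\<rho> * a\<close> is \<open>h'\<close> and the
    larger one is \<open>h\<close>; the gap between them will absorb the change of the exponent
    within one step.\<close>
  proof (rule that[of a "\<rho> * a" "(1 + \<rho>) / 2 * a"])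
  qed (use a \<rho> in \<open>auto simp: pos_less_divide_eq\<close>)
qed

end

section \<open>The subcritical regime\<close>

text \<open>Convexity in the exponent: lowering it by \<open>d\<close> releases at least
  \<open>d\<close> times the derivative at the lower exponent, which is the quantity to which the
  merging gain at that exponent is proportional.\<close>

lemma small_exp_step:
  assumes "0 \<le> d"
  shows "small_exp B (\<alpha> - d) m + d * small_deriv B (\<alpha> - d) m \<le> small_exp B \<alpha> m"
proof -
  have "exp ((\<alpha> - d) * real m) * (1 + d * real m) \<le> exp ((\<alpha> - d) * real m) * exp (d * real m)"
    by (intro mult_left_mono exp_ge_add_one_self) auto
  also have "\<dots> = exp (\<alpha> * real m)" by (simp add: exp_add[symmetric] algebra_simps)
  finally show ?thesis by (simp add: small_exp_def small_deriv_def algebra_simps)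
qed

lemma big_exp_step:
  assumes "0 \<le> d"
  shows "big_exp B (\<alpha> - d) m + d * big_deriv B (\<alpha> - d) m \<le> big_exp B \<alpha> m"
proof -
  have "exp ((\<alpha> - d) * real m) * (1 + d * real m) \<le> exp ((\<alpha> - d) * real m) * exp (d * real m)"
    by (intro mult_left_mono exp_ge_add_one_self) auto
  also have "\<dots> = exp (\<alpha> * real m)" by (simp add: exp_add[symmetric] algebra_simps)
  finally show ?thesis by (simp add: big_exp_def big_deriv_def algebra_simps)
qed

lemma small_exp_diff:
  assumes "0 \<le> d" "0 \<le> \<alpha>"
  shows "\<bar>small_exp B (\<alpha> - d) m - small_exp B \<alpha> m\<bar> \<le> d * (real B * exp (\<alpha> * real B))"
proof (cases "m \<le> B")
  case True
  have "exp (\<alpha> * real m) * (1 - d * real m) \<le> exp (\<alpha> * real m) * exp (- (d * real m))"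
    using exp_ge_add_one_self[of "- (d * real m)"] by (intro mult_left_mono) auto
  also have "\<dots> = exp ((\<alpha> - d) * real m)" by (simp add: exp_add[symmetric] algebra_simps)
  finally have "exp (\<alpha> * real m) - exp ((\<alpha> - d) * real m) \<le> d * (real m * exp (\<alpha> * real m))"
    by (simp add: algebra_simps)
  also have "\<dots> \<le> d * (real B * exp (\<alpha> * real B))"
    using True assms by (intro mult_left_mono mult_mono) (auto intro: mult_left_mono)
  finally have "exp (\<alpha> * real m) - exp ((\<alpha> - d) * real m) \<le> d * (real B * exp (\<alpha> * real B))" .
  moreover have "exp ((\<alpha> - d) * real m) \<le> exp (\<alpha> * real m)"
    using assms by (auto intro: mult_right_mono)
  ultimately show ?thesis using True by (simp add: small_exp_def)
qed (use assms in \<open>simp add: small_exp_def\<close>)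

lemma small_exp_bounds:
  assumes "0 \<le> \<alpha>" "\<alpha> \<le> a"
  shows "small_exp B \<alpha> m \<le> exp (a * real B)"
proof (cases "m \<le> B")
  case True
  have "\<alpha> * real m \<le> a * real B" using True assms by (intro mult_mono) auto
  then show ?thesis using True by (simp add: small_exp_def order.trans[of _ "exp (\<alpha> * real m)"])
qed (simp add: small_exp_def)

lemma exp_le_small_big:
  assumes "\<mu> \<le> \<mu>'" "\<mu>' \<le> \<alpha>"
  shows "exp (\<mu> * real m) \<le> 1 + small_exp B \<alpha> m + big_exp B \<mu>' m"
  using assms by (auto simp: small_exp_def big_exp_def intro: mult_right_mono add_increasing)

text \<open>If neither bound is violated at a first time, the sequence is good throughout: goodness
  before \<open>j\<close> makes \<open>j\<close> a candidate for both exits, and both are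
  excluded.\<close>

lemma all_good_if_no_exit:
  assumes H: "\<not> (\<exists>j\<le>m. (\<forall>i<j. Good (take i zs)) \<and> \<not> P (take j zs))"
    and W: "\<not> (\<exists>j\<le>m. (\<forall>i<j. Good (take i zs)) \<and> \<not> Q (take j zs))"
    and G: "\<And>zs. P zs \<Longrightarrow> Q zs \<Longrightarrow> Good zs"
  shows "j \<le> m \<Longrightarrow> Good (take j zs)"
proof (induction j rule: less_induct)
  case (less j)
  then have "\<forall>i<j. Good (take i zs)" by auto
  then show ?case using H W G less.prems by blast
qed

text \<open>The exponent \<open>lam\<close> decreases from \<open>a\<close> by \<open>c / n\<close>
  per step and stays above \<open>e\<close>. \<open>H\<close> covers classes up to \<open>B\<close>
  and is concentrated by \<open>pr_drift\<close>; \<open>W\<close> covers the larger ones and is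
  kept small by \<open>pr_drift_nonneg\<close>; each drift estimate uses both bounds. In the result
  \<open>C1\<close> stems from large partners, \<open>C2\<close> from small classes crossing
  \<open>B\<close>, \<open>R\<close> from collisions, and \<open>CJ / n\<close> bounds a jump of
  \<open>H\<close>.\<close>

lemma (in cycle_type) subcritical_bound:
  fixes n m B :: nat and t a h \<epsilon> c e \<theta> :: real
  assumes n: "1 \<le> n" "cycle_class J k n \<noteq> {}" and m: "real m \<le> t * real n"
    and par: "0 < t" "0 < a" "0 < c" "0 < e" "e = a - c * t" "exp a - 1 < h" "0 < \<epsilon>" "1 \<le> B" "1 \<le> real n * \<epsilon>"
  defines "\<eta> \<equiv> e / 4"
  defines "C1 \<equiv> (\<Sum>j=2..J. real (j * k j) * (real (j - 1) * ((1 + h) * (1 + h + \<epsilon>) ^ J))) / \<eta>"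
    and "C2 \<equiv> (\<Sum>j=2..J. real (j * k j) * (1 + h) ^ J) / \<eta>"
    and "Mx \<equiv> real B + 2 / e * ln (real n * \<epsilon>)"
  defines "R \<equiv> real L ^ 3 * Mx\<^sup>2 * (1 + h + \<epsilon>) ^ L"
    and "CJ \<equiv> (real L + c) * (real B * exp (a * real B))"
  assumes ratio: "inj_ratio n L \<le> 2" "inj_ratio n L * (growth (h + \<epsilon>) + C1 / real B) \<le> c"
    and \<theta>: "0 \<le> \<theta>" "\<theta> * CJ \<le> 1"
  shows "pr (cycle_class J k n) m [] (\<lambda>zs. \<exists>v\<in>{1..n}. Mx < real (card (component zs v)))
    \<le> exp (- (\<theta> * real n) * (h - (exp a - 1)) +
          real m * (\<theta> * real n * (2 * exp (a * real B) * R / (real n)\<^sup>2) + (\<theta> * real n)\<^sup>2 * (CJ / real n)\<^sup>2))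
      + real m * (2 * (C2 * exp (- \<eta> * real B) + R / real n) / real n) / \<epsilon>"
proof -
  define \<Gamma> where "\<Gamma> = cycle_class J k n"
  define V where "V = {1..n}"
  interpret pc: perm_class V \<Gamma> L
    using perm_classI[OF n] by (simp add: V_def \<Gamma>_def)
  have card_V: "card V = n" by (simp add: V_def)
  have \<eta>: "0 < \<eta>" using par by (simp add: \<eta>_def)
  have n0: "0 < real n" using n by simp
  have h0: "0 < h" using par by (smt (verit) exp_gt_one)
  define s where "s = (\<lambda>(zs :: (nat \<Rightarrow> nat) list) v. card (component zs v))"
  define lam where "lam = (\<lambda>i. a - c * real i / real n)"
  \<comment> \<open>The gap \<open>2 * \<eta>\<close> is the one required by
    \<open>avg_merge_gain_big\<close>; with \<open>\<eta> = e / 4\<close> this exponent still stays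
    above \<open>e / 2\<close>.\<close>
  define mu where "mu = (\<lambda>i. lam i - 2 * \<eta>)"
  define H where "H = (\<lambda>zs. avg V (\<lambda>v. small_exp B (lam (length zs)) (s zs v)))"
  define W where "W = (\<lambda>zs. avg V (\<lambda>v. big_exp B (mu (length zs)) (s zs v)))"
  define Good where "Good = (\<lambda>zs. H zs < h \<and> W zs < \<epsilon>)"
  define d where "d = c / real n"
  have d0: "0 \<le> d" using par by (simp add: d_def)
  have lam_ge: "e \<le> lam i" if "i \<le> m" for i
  proof -
    have "real i \<le> t * real n" using that m by linarith
    then have "c * real i \<le> c * (t * real n)" using par by (intro mult_left_mono) auto
    then have "c * real i / real n \<le> c * t" using n0 by (simp add: pos_divide_le_eq ac_simps)
    then show ?thesis using par by (simp add: lam_def)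
  qed
  have lam_le: "lam i \<le> a" for i using par n0 by (simp add: lam_def)
  have lam_Suc: "lam (Suc i) = lam i - d" "mu (Suc i) = mu i - d" for i
    by (simp_all add: lam_def mu_def d_def add_divide_distrib distrib_left)
  have mu_ge: "e / 2 \<le> mu i" if "i \<le> m" for i using lam_ge[OF that] by (simp add: mu_def \<eta>_def)
  have W0: "0 \<le> W zs" for zs unfolding W_def by (intro avg_nonneg big_exp_nonneg)
  have logn: "0 \<le> ln (real n * \<epsilon>)" using par by simp
  have Mx0: "0 \<le> Mx" using logn par by (simp add: Mx_def)
  have R0: "0 \<le> R" using h0 par by (simp add: R_def)
  have C10: "0 \<le> C1" using h0 par \<eta> by (auto simp: C1_def intro!: divide_nonneg_pos sum_nonneg mult_nonneg_nonneg)
  have C20: "0 \<le> C2" using h0 par \<eta> by (auto simp: C2_def intro!: divide_nonneg_pos sum_nonneg mult_nonneg_nonneg)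
  have r0: "0 \<le> inj_ratio n L" by (rule inj_ratio_nonneg)
  \<comment> \<open>A single class for which the exponential exceeds \<open>n * \<epsilon>\<close>
    would by itself push \<open>W\<close> above \<open>\<epsilon>\<close>. This gives the
    logarithmic bound \<open>Mx\<close>, which in turn makes collisions rare.\<close>
  have big: "real (s zs v) \<le> Mx" if zs: "Good zs" "length zs \<le> m" and v: "v \<in> V" for zs v
  proof (cases "s zs v \<le> B")
    case True
    then show ?thesis using logn par unfolding Mx_def by (smt (verit) divide_nonneg_pos mult_nonneg_nonneg of_nat_le_iff)
  next
    case False
    have "exp (mu (length zs) * real (s zs v)) = big_exp B (mu (length zs)) (s zs v)"
      using False by (simp add: big_exp_def)
    also have "\<dots> \<le> (\<Sum>v\<in>V. big_exp B (mu (length zs)) (s zs v))"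
      using v pc.finV by (intro member_le_sum big_exp_nonneg) auto
    also have "\<dots> = real n * W zs" using n0 by (simp add: W_def avg_def card_V)
    also have "\<dots> < real n * \<epsilon>" using zs n0 by (simp add: Good_def)
    finally have "mu (length zs) * real (s zs v) \<le> ln (real n * \<epsilon>)"
      using par by (subst ln_ge_iff) auto
    moreover have "e / 2 * real (s zs v) \<le> mu (length zs) * real (s zs v)"
      using mu_ge[OF zs(2)] by (intro mult_right_mono) auto
    ultimately have "e / 2 * real (s zs v) \<le> ln (real n * \<epsilon>)" by linarith
    then have "real (s zs v) \<le> 2 / e * ln (real n * \<epsilon>)"
      using par(4) by (simp add: field_simps)
    then show ?thesis unfolding Mx_def by simp
  qed
  \<comment> \<open>The untruncated moment is recovered from both truncations, because its exponent
    lies below \<open>lam\<close> and \<open>mu\<close> of the step before.\<close>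
  have Z_le: "avg V (\<lambda>v. exp (mu (Suc (length zs)) * real (s zs v))) \<le> 1 + h + \<epsilon>" if "Good zs" for zs
  proof -
    have "avg V (\<lambda>v. exp (mu (Suc (length zs)) * real (s zs v)))
        \<le> avg V (\<lambda>v. 1 + small_exp B (lam (length zs)) (s zs v) + big_exp B (mu (length zs)) (s zs v))"
      using d0 \<eta> by (intro avg_mono exp_le_small_big) (auto simp: lam_Suc, simp add: mu_def)
    also have "\<dots> = 1 + H zs + W zs"
      using pc.finV pc.V_nonempty by (simp add: avg_add H_def W_def)
    finally show ?thesis using that by (simp add: Good_def)
  qed
  have Z_ge: "1 \<le> avg V (\<lambda>v. exp (mu (Suc (length zs)) * real (s zs v)))" if "length zs < m" for zs
    using mu_ge[of "Suc (length zs)"] that par pc.finV pc.V_nonempty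
    by (intro avg_ge_const) auto
  have err: "K * real L ^ 3 * Mx\<^sup>2 * avg V (\<lambda>v. exp (mu (Suc (length zs)) * real (s zs v))) ^ L / real n \<le> K * (R / real n)"
    if "Good zs" "length zs < m" "0 \<le> K" for zs K
  proof -
    have "avg V (\<lambda>v. exp (mu (Suc (length zs)) * real (s zs v))) ^ L \<le> (1 + h + \<epsilon>) ^ L"
      using Z_le[OF that(1)] Z_ge[OF that(2)] by (intro power_mono) auto
    then have "K * real L ^ 3 * Mx\<^sup>2 * avg V (\<lambda>v. exp (mu (Suc (length zs)) * real (s zs v))) ^ L
        \<le> K * real L ^ 3 * Mx\<^sup>2 * (1 + h + \<epsilon>) ^ L"
      using that by (intro mult_left_mono) auto
    then show ?thesis using n0 by (simp add: R_def divide_right_mono ac_simps)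
  qed
  have H_split: "avg V (\<lambda>v. small_exp B (lam (Suc (length zs))) (s zs v))
      + d * avg V (\<lambda>v. small_deriv B (lam (Suc (length zs))) (s zs v)) \<le> H zs" for zs
    unfolding H_def avg_cmult[symmetric] avg_add[symmetric] lam_Suc by (intro avg_mono small_exp_step d0)
  have W_split: "avg V (\<lambda>v. big_exp B (mu (Suc (length zs))) (s zs v))
      + d * avg V (\<lambda>v. big_deriv B (mu (Suc (length zs))) (s zs v)) \<le> W zs" for zs
    unfolding W_def avg_cmult[symmetric] avg_add[symmetric] lam_Suc by (intro avg_mono big_exp_step d0)
  have small_deriv0: "0 \<le> avg V (\<lambda>v. small_deriv B \<alpha> (s zs v))" for \<alpha> zs
    by (intro avg_nonneg) (simp add: small_deriv_def)
  have big_deriv0: "0 \<le> avg V (\<lambda>v. big_deriv B \<alpha> (s zs v))" for \<alpha> zs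
    by (intro avg_nonneg) (simp add: big_deriv_def)
  have orb: "finite {y. p y \<noteq> y}" "\<And>y. y \<in> {y. p y \<noteq> y} \<Longrightarrow> orbit p y \<subseteq> {y. p y \<noteq> y}"
     "\<And>y. y \<in> {y. p y \<noteq> y} \<Longrightarrow> y \<in> orbit p y" if "p \<in> \<Gamma>" for p
    using pc.finite_support[OF that] orbit_subset_support[OF pc.\<Gamma>_permutes[OF that]]
      self_in_orbit[OF pc.finV pc.\<Gamma>_permutes[OF that]] by blast+
  have small_le: "avg V (\<lambda>v. small_exp B (lam (Suc (length zs))) (s zs v)) \<le> h" if "Good zs" for zs
    using H_split[of zs] mult_nonneg_nonneg[OF d0 small_deriv0[of "lam (Suc (length zs))" zs]] that
    unfolding Good_def by linarith
  have small_ge: "0 \<le> avg V (\<lambda>v. small_exp B (lam (Suc (length zs))) (s zs v))" if "length zs < m" for zs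
    using lam_ge[of "Suc (length zs)"] that par by (intro avg_nonneg small_exp_nonneg) auto
  have rG: "inj_ratio n L * growth (h + \<epsilon>) \<le> c"
  proof -
    have "0 \<le> inj_ratio n L * (C1 / real B)" using r0 C10 by simp
    then show ?thesis using ratio(2) by (simp add: distrib_left)
  qed

  \<comment> \<open>The step is taken in two moves: the exponent is lowered on the old components,
    then the permutation is added at the new exponent. What the first move releases pays for the
    gain of the second.\<close>
  have H_drift: "avg \<Gamma> (\<lambda>g. H (zs @ [g])) \<le> H zs + 2 * exp (a * real B) * R / (real n)\<^sup>2"
    if zs: "set zs \<subseteq> \<Gamma>" "length zs < m" "Good zs" for zs
  proof -
    let ?l = "lam (Suc (length zs))"
    let ?\<phi> = "avg V (\<lambda>v. small_exp B ?l (s zs v))" and ?\<phi>' = "avg V (\<lambda>v. small_deriv B ?l (s zs v))"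
    have l: "0 \<le> ?l" "?l \<le> a" using lam_ge[of "Suc (length zs)"] lam_le zs par by auto
    have muS: "0 \<le> mu (Suc (length zs))" using mu_ge[of "Suc (length zs)"] zs par by auto
    have gain: "avg ({y. p y \<noteq> y} \<rightarrow>\<^sub>E V) (merge_gain {y. p y \<noteq> y} (orbit p) (\<lambda>v. card (component zs v)) (small_exp B ?l))
        \<le> ?\<phi>' * growth (h + \<epsilon>)" if p: "p \<in> \<Gamma>" for p
    proof -
      have "avg ({y. p y \<noteq> y} \<rightarrow>\<^sub>E V) (merge_gain {y. p y \<noteq> y} (orbit p) (\<lambda>v. card (component zs v)) (small_exp B ?l))
        \<le> ?\<phi>' * (\<Sum>y\<in>{y. p y \<noteq> y}. (1 + ?\<phi>) ^ (card (orbit p y) - 1) - 1)"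
        unfolding s_def using orb[OF p] l by (intro avg_merge_gain_small pc.finV pc.V_nonempty) auto
      also have "(\<Sum>y\<in>{y. p y \<noteq> y}. (1 + ?\<phi>) ^ (card (orbit p y) - 1) - 1) = growth ?\<phi>"
        using sum_support[of p J k n "\<lambda>j. (1 + ?\<phi>) ^ (j - 1) - 1"] p by (simp add: growth_def \<Gamma>_def)
      also have "\<dots> \<le> growth (h + \<epsilon>)"
        using small_le[OF zs(3)] small_ge[OF zs(2)] par by (intro growth_mono) auto
      finally show ?thesis using small_deriv0 by (simp add: mult_left_mono)
    qed
    have f_le: "small_exp B ?l x \<le> exp (a * real B) * exp (mu (Suc (length zs)) * real x)" for x
    proof -
      have "exp (a * real B) * 1 \<le> exp (a * real B) * exp (mu (Suc (length zs)) * real x)"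
        using muS by (intro mult_left_mono) auto
      then show ?thesis using small_exp_bounds[OF l, of B x] by linarith
    qed
    have "avg \<Gamma> (\<lambda>g. \<Sum>v\<in>V. small_exp B ?l (card (component (zs @ [g]) v)))
      \<le> (\<Sum>v\<in>V. small_exp B ?l (card (component zs v))) + inj_ratio (card V) L *
         (?\<phi>' * growth (h + \<epsilon>) + exp (a * real B) * real L ^ 3 * Mx\<^sup>2 *
            avg V (\<lambda>v. exp (mu (Suc (length zs)) * real (card (component zs v)))) ^ L / real (card V))"
      using gain big[OF zs(3)] zs muS l f_le
      by (intro pc.avg_component_sum_le) (auto simp: s_def small_exp_nonneg)
    also have "\<dots> \<le> (\<Sum>v\<in>V. small_exp B ?l (card (component zs v))) +
        (c * ?\<phi>' + 2 * (exp (a * real B) * (R / real n)))"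
    proof -
      have "inj_ratio n L * (?\<phi>' * growth (h + \<epsilon>)) \<le> c * ?\<phi>'"
        using mult_right_mono[OF rG small_deriv0[of ?l zs]] by (simp add: ac_simps)
      moreover have "inj_ratio n L * (exp (a * real B) * real L ^ 3 * Mx\<^sup>2 *
            avg V (\<lambda>v. exp (mu (Suc (length zs)) * real (s zs v))) ^ L / real n) \<le> 2 * (exp (a * real B) * (R / real n))"
        using err[OF zs(3,2), of "exp (a * real B)"] ratio(1) r0 R0 n0 Mx0
        by (intro mult_mono') (auto intro!: mult_nonneg_nonneg divide_nonneg_pos avg_nonneg zero_le_power)
      ultimately show ?thesis unfolding card_V s_def by (simp only: distrib_left)
    qed
    finally have "avg \<Gamma> (\<lambda>g. \<Sum>v\<in>V. small_exp B ?l (card (component (zs @ [g]) v))) / real n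
       \<le> ((\<Sum>v\<in>V. small_exp B ?l (card (component zs v))) +
        (c * ?\<phi>' + 2 * (exp (a * real B) * (R / real n)))) / real n"
      using n0 by (intro divide_right_mono) auto
    also have "\<dots> = ?\<phi> + d * ?\<phi>' + 2 * exp (a * real B) * R / (real n)\<^sup>2"
      using n0 by (simp add: avg_def card_V s_def d_def add_divide_distrib power2_eq_square)
    also have "\<dots> \<le> H zs + 2 * exp (a * real B) * R / (real n)\<^sup>2"
      using H_split[of zs] by simp
    also have "avg \<Gamma> (\<lambda>g. \<Sum>v\<in>V. small_exp B ?l (card (component (zs @ [g]) v))) / real n = avg \<Gamma> (\<lambda>g. H (zs @ [g]))"
      by (simp add: H_def s_def avg_def card_V sum_divide_distrib[symmetric])
    finally show ?thesis .
  qed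

  have W_drift: "avg \<Gamma> (\<lambda>g. W (zs @ [g])) \<le> W zs + 2 * (C2 * exp (- \<eta> * real B) + R / real n) / real n"
    if zs: "set zs \<subseteq> \<Gamma>" "length zs < m" "Good zs" for zs
  proof -
    let ?l = "mu (Suc (length zs))"
    let ?w = "avg V (\<lambda>v. big_exp B ?l (s zs v))" and ?w' = "avg V (\<lambda>v. big_deriv B ?l (s zs v))"
    let ?Z = "avg V (\<lambda>v. exp (?l * real (s zs v)))"
    let ?\<Phi> = "1 + avg V (\<lambda>v. small_exp B (lam (Suc (length zs))) (s zs v))"
    let ?b = "?w' * (growth (h + \<epsilon>) + C1 / real B) + C2 * exp (- \<eta> * real B)"
    have l: "0 \<le> ?l" using mu_ge[of "Suc (length zs)"] zs par by auto
    have lam_mu: "?l + 2 * \<eta> = lam (Suc (length zs))" by (simp add: mu_def)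
    have \<Phi>: "0 \<le> ?\<Phi>" "?\<Phi> \<le> 1 + h" "1 \<le> ?\<Phi>" using small_le[OF zs(3)] small_ge[OF zs(2)] by auto
    have Z: "1 \<le> ?Z" "?Z \<le> 1 + h + \<epsilon>" using Z_ge[OF zs(2)] Z_le[OF zs(3)] by auto
    have w0: "0 \<le> ?w" by (intro avg_nonneg big_exp_nonneg)
    \<comment> \<open>Above \<open>B\<close> the derivative carries a factor of at least
      \<open>B\<close>. So the gain from large partners is a fraction \<open>C1 / B\<close> of the
      derivative term and can be paid by the speed \<open>c\<close> too.\<close>
    have w_le: "?w \<le> ?w' / real B"
    proof -
      have "?w \<le> avg V (\<lambda>v. big_deriv B ?l (s zs v) * (1 / real B))"
        using par by (intro avg_mono) (auto simp: big_exp_def big_deriv_def field_simps)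
      then show ?thesis unfolding avg_cmult_right by simp
    qed
    have gain: "avg ({y. p y \<noteq> y} \<rightarrow>\<^sub>E V) (merge_gain {y. p y \<noteq> y} (orbit p) (\<lambda>v. card (component zs v)) (big_exp B ?l))
        \<le> ?b" if p: "p \<in> \<Gamma>" for p
    proof -
      have "avg ({y. p y \<noteq> y} \<rightarrow>\<^sub>E V) (merge_gain {y. p y \<noteq> y} (orbit p) (\<lambda>v. card (component zs v)) (big_exp B ?l))
        \<le> (\<Sum>y\<in>{y. p y \<noteq> y}. ?w' * (?Z ^ (card (orbit p y) - 1) - 1)
          + real (card (orbit p y) - 1) * (?\<Phi> / \<eta> * ?w * ?Z ^ (card (orbit p y) - 2))
          + exp (- \<eta> * real B) / \<eta> * ?\<Phi> ^ card (orbit p y))"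
        unfolding s_def lam_mu[symmetric] using orb[OF p] l \<eta>
        by (intro avg_merge_gain_big pc.finV pc.V_nonempty) auto
      also have "\<dots> = (\<Sum>j=2..J. real (j * k j) * (?w' * (?Z ^ (j - 1) - 1)
          + real (j - 1) * (?\<Phi> / \<eta> * ?w * ?Z ^ (j - 2)) + exp (- \<eta> * real B) / \<eta> * ?\<Phi> ^ j))"
        by (rule sum_support) (use p in \<open>simp add: \<Gamma>_def\<close>)
      also have "\<dots> \<le> (\<Sum>j=2..J. real (j * k j) * (?w' * ((1 + (h + \<epsilon>)) ^ (j - 1) - 1)
          + ?w' / real B * (real (j - 1) * ((1 + h) * (1 + h + \<epsilon>) ^ J)) / \<eta>
          + exp (- \<eta> * real B) * (1 + h) ^ J / \<eta>))"
      proof (intro sum_mono mult_left_mono add_mono)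
        fix j assume j: "j \<in> {2..J}"
        have "?Z ^ (j - 1) \<le> (1 + (h + \<epsilon>)) ^ (j - 1)" using Z by (intro power_mono) auto
        then show "?Z ^ (j - 1) - 1 \<le> (1 + (h + \<epsilon>)) ^ (j - 1) - 1" by simp
        have "?Z ^ (j - 2) \<le> (1 + h + \<epsilon>) ^ (j - 2)" using Z by (intro power_mono) auto
        also have "\<dots> \<le> (1 + h + \<epsilon>) ^ J" using j h0 par by (intro power_increasing) auto
        finally have ZJ: "?Z ^ (j - 2) \<le> (1 + h + \<epsilon>) ^ J" .
        have "?\<Phi> * ?w * ?Z ^ (j - 2) \<le> (1 + h) * (?w' / real B) * (1 + h + \<epsilon>) ^ J"
          using \<Phi> w0 w_le ZJ Z h0 by (intro mult_mono mult_nonneg_nonneg) auto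
        then have "real (j - 1) * (?\<Phi> * ?w * ?Z ^ (j - 2)) / \<eta> \<le> real (j - 1) * ((1 + h) * (?w' / real B) * (1 + h + \<epsilon>) ^ J) / \<eta>"
          using \<eta> by (intro divide_right_mono mult_left_mono) auto
        then show "real (j - 1) * (?\<Phi> / \<eta> * ?w * ?Z ^ (j - 2))
          \<le> ?w' / real B * (real (j - 1) * ((1 + h) * (1 + h + \<epsilon>) ^ J)) / \<eta>"
          by (simp add: ac_simps)
        have "?\<Phi> ^ j \<le> (1 + h) ^ j" using \<Phi> by (intro power_mono) auto
        also have "\<dots> \<le> (1 + h) ^ J" using j h0 by (intro power_increasing) auto
        finally show "exp (- \<eta> * real B) / \<eta> * ?\<Phi> ^ j \<le> exp (- \<eta> * real B) * (1 + h) ^ J / \<eta>"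
          using \<eta> by (simp add: divide_right_mono)
      qed (use big_deriv0 in auto)
      also have "\<dots> = ?w' * (\<Sum>j=2..J. real (j * k j) * ((1 + (h + \<epsilon>)) ^ (j - 1) - 1)) +
          ?w' / real B * ((\<Sum>j=2..J. real (j * k j) * (real (j - 1) * ((1 + h) * (1 + h + \<epsilon>) ^ J))) / \<eta>) +
          exp (- \<eta> * real B) * ((\<Sum>j=2..J. real (j * k j) * (1 + h) ^ J) / \<eta>)"
        unfolding sum_distrib_left sum_divide_distrib sum.distrib[symmetric]
        by (intro sum.cong refl) (simp add: distrib_left ac_simps)
      also have "\<dots> = ?b"
        unfolding growth_def[symmetric] C1_def[symmetric] C2_def[symmetric] by (simp add: distrib_left distrib_right ac_simps)
      finally show ?thesis .
    qed
    have f_le: "big_exp B ?l x \<le> 1 * exp (?l * real x)" for x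
      by (simp add: big_exp_def)
    have "avg \<Gamma> (\<lambda>g. \<Sum>v\<in>V. big_exp B ?l (card (component (zs @ [g]) v)))
      \<le> (\<Sum>v\<in>V. big_exp B ?l (card (component zs v))) + inj_ratio (card V) L *
         (?b + 1 * real L ^ 3 * Mx\<^sup>2 *
            avg V (\<lambda>v. exp (?l * real (card (component zs v)))) ^ L / real (card V))"
      using gain big[OF zs(3)] zs l f_le
      by (intro pc.avg_component_sum_le) (auto simp: s_def big_exp_nonneg)
    also have "\<dots> \<le> (\<Sum>v\<in>V. big_exp B ?l (card (component zs v))) +
        (c * ?w' + 2 * (C2 * exp (- \<eta> * real B) + R / real n))"
    proof -
      have "inj_ratio n L * (?w' * (growth (h + \<epsilon>) + C1 / real B)) \<le> c * ?w'"
        using mult_right_mono[OF ratio(2) big_deriv0[of ?l zs]] by (simp add: ac_simps)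
      moreover have "inj_ratio n L * (C2 * exp (- \<eta> * real B) + 1 * real L ^ 3 * Mx\<^sup>2 *
            avg V (\<lambda>v. exp (?l * real (s zs v))) ^ L / real n) \<le> 2 * (C2 * exp (- \<eta> * real B) + R / real n)"
        using err[OF zs(3,2), of 1] ratio(1) r0 R0 n0 C20 Mx0
        by (intro mult_mono') (auto intro!: add_nonneg_nonneg mult_nonneg_nonneg divide_nonneg_pos avg_nonneg zero_le_power)
      ultimately show ?thesis unfolding card_V s_def by (simp only: distrib_left add.assoc)
    qed
    finally have "avg \<Gamma> (\<lambda>g. \<Sum>v\<in>V. big_exp B ?l (card (component (zs @ [g]) v))) / real n
       \<le> ((\<Sum>v\<in>V. big_exp B ?l (card (component zs v))) +
        (c * ?w' + 2 * (C2 * exp (- \<eta> * real B) + R / real n))) / real n"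
      using n0 by (intro divide_right_mono) auto
    also have "\<dots> = ?w + d * ?w' + 2 * (C2 * exp (- \<eta> * real B) + R / real n) / real n"
      using n0 by (simp add: avg_def card_V s_def d_def add_divide_distrib)
    also have "\<dots> \<le> W zs + 2 * (C2 * exp (- \<eta> * real B) + R / real n) / real n"
      using W_split[of zs] by simp
    also have "avg \<Gamma> (\<lambda>g. \<Sum>v\<in>V. big_exp B ?l (card (component (zs @ [g]) v))) / real n = avg \<Gamma> (\<lambda>g. W (zs @ [g]))"
      by (simp add: W_def s_def avg_def card_V sum_divide_distrib[symmetric])
    finally show ?thesis .
  qed

  have H_jump: "\<bar>H (zs @ [g]) - H zs\<bar> \<le> CJ / real n"
    if zs: "set zs \<subseteq> \<Gamma>" "length zs < m" "Good zs" and g: "g \<in> \<Gamma>" for zs g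
  proof -
    let ?l = "lam (Suc (length zs))"
    have l: "0 \<le> ?l" "?l \<le> a" using lam_ge[of "Suc (length zs)"] lam_le zs par by auto
    have jump: "\<bar>(\<Sum>v\<in>V. small_exp B ?l (card (component (zs @ [g]) v))) - (\<Sum>v\<in>V. small_exp B ?l (card (component zs v)))\<bar>
        \<le> real L * (real B * exp (a * real B))"
    proof (rule pc.component_sum_jump[OF zs(1) g, where D = "\<lambda>x. if x \<le> B then exp (a * real B) else 0"])
      fix x x' :: nat assume "1 \<le> x" "x \<le> x'"
      then show "\<bar>small_exp B ?l x' - small_exp B ?l x\<bar> \<le> (if x \<le> B then exp (a * real B) else 0)"
        using small_exp_bounds[OF l, of B x] small_exp_bounds[OF l, of B x']
          small_exp_nonneg[OF l(1), of B x] small_exp_nonneg[OF l(1), of B x']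
        by (auto simp: abs_le_iff) (auto simp: small_exp_def)
    qed (auto intro: mult_right_mono)
    have "\<bar>avg V (\<lambda>v. small_exp B ?l (s zs v)) - H zs\<bar> \<le> avg V (\<lambda>v. \<bar>small_exp B ?l (s zs v) - small_exp B (lam (length zs)) (s zs v)\<bar>)"
      unfolding H_def avg_diff[symmetric] by (simp add: avg_def divide_right_mono)
    also have "\<dots> \<le> d * (real B * exp (a * real B))"
    proof (intro avg_le_const pc.finV pc.V_nonempty)
      fix v
      have "lam (length zs) \<ge> 0" using lam_ge[of "length zs"] zs par by auto
      then have "\<bar>small_exp B ?l (s zs v) - small_exp B (lam (length zs)) (s zs v)\<bar> \<le> d * (real B * exp (lam (length zs) * real B))"
        unfolding lam_Suc by (intro small_exp_diff d0)
      also have "\<dots> \<le> d * (real B * exp (a * real B))"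
        using lam_le d0 by (intro mult_left_mono) (auto intro: mult_right_mono)
      finally show "\<bar>small_exp B ?l (s zs v) - small_exp B (lam (length zs)) (s zs v)\<bar> \<le> d * (real B * exp (a * real B))" .
    qed
    finally have time: "\<bar>avg V (\<lambda>v. small_exp B ?l (s zs v)) - H zs\<bar> \<le> d * (real B * exp (a * real B))" .
    have "\<bar>H (zs @ [g]) - avg V (\<lambda>v. small_exp B ?l (s zs v))\<bar> \<le> real L * (real B * exp (a * real B)) / real n"
    proof -
      have "H (zs @ [g]) - avg V (\<lambda>v. small_exp B ?l (s zs v)) =
        ((\<Sum>v\<in>V. small_exp B ?l (card (component (zs @ [g]) v))) - (\<Sum>v\<in>V. small_exp B ?l (card (component zs v)))) / real n"
        by (simp add: H_def s_def avg_def card_V diff_divide_distrib)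
      then show ?thesis using jump n0 by (simp add: divide_right_mono)
    qed
    moreover have "CJ / real n = real L * (real B * exp (a * real B)) / real n + d * (real B * exp (a * real B))"
      by (simp add: CJ_def d_def add_divide_distrib distrib_right)
    ultimately show ?thesis using time by linarith
  qed

  have H_start: "H [] = exp a - 1"
  proof -
    have "H [] = avg V (\<lambda>_. exp a - 1)" unfolding H_def using par
      by (intro avg_cong) (auto simp: s_def lam_def small_exp_def)
    then show ?thesis using pc.finV pc.V_nonempty by simp
  qed
  have W_start: "W [] = 0"
  proof -
    have "W [] = avg V (\<lambda>_. 0)" unfolding W_def using par
      by (intro avg_cong) (auto simp: s_def big_exp_def)
    then show ?thesis by (simp add: avg_def)
  qed
  let ?PH = "\<lambda>zs. \<exists>j\<le>m. (\<forall>i<j. Good (take i zs)) \<and> h \<le> H (take j zs)"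
  let ?PW = "\<lambda>zs. \<exists>j\<le>m. (\<forall>i<j. Good (take i zs)) \<and> \<epsilon> \<le> W (take j zs)"
  have bH: "pr \<Gamma> m [] ?PH \<le> exp (- (\<theta> * real n) * (h - H []) +
      real m * (\<theta> * real n * (2 * exp (a * real B) * R / (real n)\<^sup>2) + (\<theta> * real n)\<^sup>2 * (CJ / real n)\<^sup>2))"
    using \<theta> n0 R0 H_drift H_jump
    by (intro pr_drift pc.finite_\<Gamma> pc.\<Gamma>_nonempty) auto
  have bW: "pr \<Gamma> m [] ?PW \<le> (W [] + real m * (2 * (C2 * exp (- \<eta> * real B) + R / real n) / real n)) / \<epsilon>"
    using n0 R0 C20 par W0 W_drift
    by (intro pr_drift_nonneg pc.finite_\<Gamma> pc.\<Gamma>_nonempty) auto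
  have "pr \<Gamma> m [] (\<lambda>zs. \<exists>v\<in>{1..n}. Mx < real (card (component zs v))) \<le> pr \<Gamma> m [] (\<lambda>zs. ?PH zs \<or> ?PW zs)"
  proof (rule pr_mono, rule ccontr)
    fix ys assume ys: "length ys = m" "set ys \<subseteq> \<Gamma>" "\<exists>v\<in>{1..n}. Mx < real (card (component ([] @ ys) v))"
      and no: "\<not> (?PH ([] @ ys) \<or> ?PW ([] @ ys))"
    have "Good (take m ys)"
      by (rule all_good_if_no_exit[where P = "\<lambda>zs. H zs < h" and Q = "\<lambda>zs. W zs < \<epsilon>" and m = m])
        (use no in \<open>auto simp: Good_def not_less\<close>)
    then have "Good ys" using ys by simp
    then show False using big[of ys] ys by (force simp: V_def s_def)
  qed
  also have "\<dots> \<le> pr \<Gamma> m [] ?PH + pr \<Gamma> m [] ?PW" by (rule pr_disj)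
  finally show ?thesis using bH bW unfolding H_start W_start \<Gamma>_def by simp
qed

section \<open>Logarithmic components below the critical time\<close>

lemma log_square_over_linear: "(\<lambda>n. (b + q * ln (real n))\<^sup>2 / real n) \<longlonglongrightarrow> 0"
proof -
  have 1: "(\<lambda>n. 1 / real n) \<longlonglongrightarrow> 0" by real_asymp
  have 2: "(\<lambda>n. ln (real n) / real n) \<longlonglongrightarrow> 0" by real_asymp
  have 3: "(\<lambda>n. (ln (real n))\<^sup>2 / real n) \<longlonglongrightarrow> 0" by real_asymp
  have "(\<lambda>n. b\<^sup>2 * (1 / real n) + 2 * b * q * (ln (real n) / real n) + q\<^sup>2 * ((ln (real n))\<^sup>2 / real n)) \<longlonglongrightarrow> b\<^sup>2 * 0 + 2 * b * q * 0 + q\<^sup>2 * 0"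
    by (intro tendsto_add tendsto_mult tendsto_const 1 2 3)
  then show ?thesis
    by (simp add: power2_sum power_mult_distrib add_divide_distrib algebra_simps)
qed

context cycle_type begin

lemma growth_nonneg: "0 \<le> h \<Longrightarrow> 0 \<le> growth h"
  using growth_mono[of 0 h] by simp

text \<open>\<open>\<beta> = 4 / e\<close> is fixed before the tolerance \<open>\<delta>\<close>:
  the cut-off \<open>B\<close> depends on \<open>\<delta>\<close>, but it enters \<open>Mx\<close>
  only additively and is swallowed by half of \<open>4 / e * ln n\<close>. After that
  \<open>B\<close>, \<open>\<theta>\<close> and the range of \<open>n\<close> are chosen in this
  order.\<close>

lemma subcritical_components:
  assumes t: "0 < t" "\<kappa> * t < 1"
  obtains \<beta> where "0 < \<beta>" "\<And>\<delta>. 0 < \<delta> \<Longrightarrow> \<forall>\<^sub>F n in sequentially. cycle_class J k n \<noteq> {} \<longrightarrow>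
      pr (cycle_class J k n) (nat \<lfloor>t * real n\<rfloor>) [] (\<lambda>zs. \<exists>v\<in>{1..n}. \<beta> * ln (real n) < real (card (component zs v))) \<le> \<delta>"
proof -
  obtain a h \<epsilon> where par: "0 < a" "exp a - 1 < h" "0 < \<epsilon>" "t * growth (h + \<epsilon>) < a"
    using subcritical_parameters[OF t] by metis
  \<comment> \<open>A speed strictly between the two values dominates the merging gain, with room
    for \<open>C1 / B\<close> and \<open>inj_ratio\<close>, and leaves an exponent
    \<open>e > 0\<close> at time \<open>t\<close>.\<close>
  define c where "c = (growth (h + \<epsilon>) + a / t) / 2"
  define e where "e = a - c * t"
  have h0: "0 < h" using par by (smt (verit) exp_gt_one)
  have g: "growth (h + \<epsilon>) < a / t" using par t by (simp add: pos_less_divide_eq mult.commute)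
  have c: "0 < c" "growth (h + \<epsilon>) < c" "c < a / t"
  proof -
    have g0: "0 \<le> growth (h + \<epsilon>)" using h0 par(3) by (intro growth_nonneg) simp
    have "0 < (x + y) / 2 \<and> x < (x + y) / 2 \<and> (x + y) / 2 < y" if "0 \<le> x" "x < y" for x y :: real
      using that by auto
    from this[OF g0 g] show "0 < c" "growth (h + \<epsilon>) < c" "c < a / t" unfolding c_def by blast+
  qed
  have e: "0 < e" using c t by (simp add: e_def pos_less_divide_eq)
  define \<eta> where "\<eta> = e / 4"
  define C1 where "C1 = (\<Sum>j=2..J. real (j * k j) * (real (j - 1) * ((1 + h) * (1 + h + \<epsilon>) ^ J))) / \<eta>"
  define C2 where "C2 = (\<Sum>j=2..J. real (j * k j) * (1 + h) ^ J) / \<eta>"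
  show ?thesis
  proof (rule that[of "4 / e"])
    show "0 < 4 / e" using e by simp
    fix \<delta> :: real assume \<delta>: "0 < \<delta>"
    have "\<forall>\<^sub>F B in sequentially. growth (h + \<epsilon>) + C1 / real B < c"
    proof -
      have "(\<lambda>B. growth (h + \<epsilon>) + C1 / real B) \<longlonglongrightarrow> growth (h + \<epsilon>) + 0"
        by (intro tendsto_add tendsto_const lim_const_over_n)
      then show ?thesis by (rule order_tendstoD(2)) (use c in simp)
    qed
    moreover have "\<forall>\<^sub>F B in sequentially. t * (2 * (C2 * exp (- \<eta> * real B))) / \<epsilon> < \<delta> / 4"
    proof -
      have "(\<lambda>B::nat. exp (- \<eta> * real B)) \<longlonglongrightarrow> 0"
        using e unfolding \<eta>_def by real_asymp
      then have "(\<lambda>B. t * (2 * (C2 * exp (- \<eta> * real B))) / \<epsilon>) \<longlonglongrightarrow> t * (2 * (C2 * 0)) / \<epsilon>"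
        using par by (intro tendsto_intros) auto
      then show ?thesis using \<delta> by (intro order_tendstoD(2)) auto
    qed
    moreover have "\<forall>\<^sub>F B in sequentially. (1::nat) \<le> B" by (rule eventually_ge_at_top)
    ultimately have "\<forall>\<^sub>F B in sequentially. growth (h + \<epsilon>) + C1 / real B < c \<and>
       t * (2 * (C2 * exp (- \<eta> * real B))) / \<epsilon> < \<delta> / 4 \<and> 1 \<le> B"
      by eventually_elim simp
    then obtain B where B: "growth (h + \<epsilon>) + C1 / real B < c"
       "t * (2 * (C2 * exp (- \<eta> * real B))) / \<epsilon> < \<delta> / 4" "1 \<le> B"
      by (metis (mono_tags, lifting) eventually_happens trivial_limit_sequentially)
    define CJ where "CJ = (real L + c) * (real B * exp (a * real B))"
    define D where "D = h - (exp a - 1)"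
    have D: "0 < D" using par by (simp add: D_def)
    have CJ: "0 < CJ" using c B by (simp add: CJ_def add_nonneg_pos)
    \<comment> \<open>The first entry makes \<open>pr_drift\<close> applicable; the second keeps the
      quadratic term below half of the linear gain \<open>\<theta> * D\<close>.\<close>
    define \<theta> where "\<theta> = min (1 / CJ) (D / (2 * t * CJ\<^sup>2))"
    have \<theta>: "0 < \<theta>" "\<theta> * CJ \<le> 1" "t * (\<theta>\<^sup>2 * CJ\<^sup>2) \<le> \<theta> * D / 2"
    proof -
      show pos: "0 < \<theta>" using CJ D t by (simp add: \<theta>_def)
      have "\<theta> \<le> 1 / CJ" by (simp add: \<theta>_def)
      then show "\<theta> * CJ \<le> 1" using CJ by (simp add: pos_le_divide_eq)
      have "\<theta> \<le> D / (2 * t * CJ\<^sup>2)" by (simp add: \<theta>_def)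
      then have "\<theta> * (2 * t * CJ\<^sup>2) \<le> D" using CJ t by (subst (asm) pos_le_divide_eq) auto
      then have "\<theta> * (\<theta> * (2 * t * CJ\<^sup>2)) \<le> \<theta> * D" using pos by (intro mult_left_mono) auto
      then show "t * (\<theta>\<^sup>2 * CJ\<^sup>2) \<le> \<theta> * D / 2" by (simp add: power2_eq_square algebra_simps)
    qed
    define Mx where "Mx = (\<lambda>n. real B + 2 / e * ln (real n * \<epsilon>))"
    define R where "R = (\<lambda>n. real L ^ 3 * (Mx n)\<^sup>2 * (1 + h + \<epsilon>) ^ L)"
    have Rlim: "(\<lambda>n. R n / real n) \<longlonglongrightarrow> 0"
    proof (rule Lim_transform_eventually)
      show "(\<lambda>n. (real L ^ 3 * (1 + h + \<epsilon>) ^ L) * (((real B + 2 / e * ln \<epsilon>) + 2 / e * ln (real n))\<^sup>2 / real n)) \<longlonglongrightarrow> 0"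
        by (rule tendsto_mult_right_zero[OF log_square_over_linear])
      show "\<forall>\<^sub>F n in sequentially. (real L ^ 3 * (1 + h + \<epsilon>) ^ L) * (((real B + 2 / e * ln \<epsilon>) + 2 / e * ln (real n))\<^sup>2 / real n) = R n / real n"
        using eventually_gt_at_top[of 0]
      proof eventually_elim
        case (elim n)
        then have "ln (real n * \<epsilon>) = ln (real n) + ln \<epsilon>" using par by (simp add: ln_mult)
        then have "Mx n = (real B + 2 / e * ln \<epsilon>) + 2 / e * ln (real n)"
          by (simp add: Mx_def add_divide_distrib distrib_left)
        then show ?case by (simp only: R_def) simp
      qed
    qed
    have ev1: "\<forall>\<^sub>F n in sequentially. inj_ratio n L < 2"
      using inj_ratio_tendsto[of L] by (rule order_tendstoD(2)) simp
    have ev2: "\<forall>\<^sub>F n in sequentially. inj_ratio n L * (growth (h + \<epsilon>) + C1 / real B) < c"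
      using tendsto_mult[OF inj_ratio_tendsto[of L] tendsto_const[of "growth (h + \<epsilon>) + C1 / real B"]] B(1)
      by (intro order_tendstoD(2)) auto
    have ev3: "\<forall>\<^sub>F n in sequentially. Mx n \<le> 4 / e * ln (real n)"
    proof -
      have "filterlim (\<lambda>n. 2 / e * ln (real n)) at_top sequentially"
        using e by (intro filterlim_tendsto_pos_mult_at_top[OF tendsto_const]) (auto, real_asymp)
      then have "\<forall>\<^sub>F n in sequentially. real B + 2 / e * ln \<epsilon> \<le> 2 / e * ln (real n)"
        by (simp add: filterlim_at_top)
      then show ?thesis using eventually_gt_at_top[of 0]
      proof eventually_elim
        case (elim n)
        then have "ln (real n * \<epsilon>) = ln (real n) + ln \<epsilon>" using par by (simp add: ln_mult)
        then have "Mx n = (real B + 2 / e * ln \<epsilon>) + 2 / e * ln (real n)"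
          by (simp add: Mx_def add_divide_distrib distrib_left)
        then show ?case using elim by simp
      qed
    qed
    have ev4: "\<forall>\<^sub>F n in sequentially. t * (2 * (R n / real n)) / \<epsilon> < \<delta> / 4"
    proof -
      have "(\<lambda>n. t * (2 * (R n / real n)) / \<epsilon>) \<longlonglongrightarrow> t * (2 * 0) / \<epsilon>"
        using par by (intro tendsto_intros Rlim) auto
      then show ?thesis using \<delta> by (intro order_tendstoD(2)) auto
    qed
    have ev5: "\<forall>\<^sub>F n in sequentially. t * (\<theta> * (2 * exp (a * real B) * (R n / real n))) < \<theta> * D / 4"
    proof -
      have "(\<lambda>n. t * (\<theta> * (2 * exp (a * real B) * (R n / real n)))) \<longlonglongrightarrow> t * (\<theta> * (2 * exp (a * real B) * 0))"
        by (intro tendsto_intros Rlim)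
      then show ?thesis using \<theta> D by (intro order_tendstoD(2)) auto
    qed
    have ev6: "\<forall>\<^sub>F n in sequentially. exp (- (\<theta> * D / 4) * real n) < \<delta> / 2"
    proof -
      have "0 < \<theta> * D / 4" using \<theta> D by simp
      moreover have "(\<lambda>n. exp (- x * real n)) \<longlonglongrightarrow> 0" if "0 < x" for x :: real
        using that by real_asymp
      ultimately have "(\<lambda>n. exp (- (\<theta> * D / 4) * real n)) \<longlonglongrightarrow> 0" by blast
      then show ?thesis using \<delta> by (intro order_tendstoD(2)) auto
    qed
    have ev7: "\<forall>\<^sub>F n in sequentially. 1 \<le> real n * \<epsilon>"
    proof -
      have "filterlim (\<lambda>n. real n * \<epsilon>) at_top sequentially"
        using par by real_asymp
      then show ?thesis by (simp add: filterlim_at_top)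
    qed
    show "\<forall>\<^sub>F n in sequentially. cycle_class J k n \<noteq> {} \<longrightarrow>
      pr (cycle_class J k n) (nat \<lfloor>t * real n\<rfloor>) [] (\<lambda>zs. \<exists>v\<in>{1..n}. 4 / e * ln (real n) < real (card (component zs v))) \<le> \<delta>"
      using ev1 ev2 ev3 ev4 ev5 ev6 ev7 eventually_ge_at_top[of 1]
    proof eventually_elim
      case (elim n)
      define m where "m = nat \<lfloor>t * real n\<rfloor>"
      have n0: "0 < real n" using elim by simp
      have m: "real m \<le> t * real n" using t n0 by (simp add: m_def of_nat_nat)
      have R0: "0 \<le> R n" using h0 par by (simp add: R_def)
      show ?case
      proof
        assume ne: "cycle_class J k n \<noteq> {}"
        have "pr (cycle_class J k n) m [] (\<lambda>zs. \<exists>v\<in>{1..n}. 4 / e * ln (real n) < real (card (component zs v)))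
            \<le> pr (cycle_class J k n) m [] (\<lambda>zs. \<exists>v\<in>{1..n}. Mx n < real (card (component zs v)))"
          using elim(3) by (intro pr_mono) (meson order_le_less_trans)
        also have "\<dots> \<le> exp (- (\<theta> * real n) * (h - (exp a - 1)) +
          real m * (\<theta> * real n * (2 * exp (a * real B) * R n / (real n)\<^sup>2) + (\<theta> * real n)\<^sup>2 * (CJ / real n)\<^sup>2))
          + real m * (2 * (C2 * exp (- \<eta> * real B) + R n / real n) / real n) / \<epsilon>"
          unfolding Mx_def R_def CJ_def C2_def \<eta>_def
          by (rule subcritical_bound[OF _ ne m t(1) par(1) c(1) e e_def par(2,3) B(3)])
            (use elim \<theta> in \<open>simp_all add: CJ_def C1_def \<eta>_def\<close>)
        also have "\<dots> \<le> \<delta> / 2 + \<delta> / 2"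
        proof (rule add_mono)
          have "real m * (\<theta> * real n * (2 * exp (a * real B) * R n / (real n)\<^sup>2) + (\<theta> * real n)\<^sup>2 * (CJ / real n)\<^sup>2)
              \<le> (t * real n) * (\<theta> * real n * (2 * exp (a * real B) * R n / (real n)\<^sup>2) + (\<theta> * real n)\<^sup>2 * (CJ / real n)\<^sup>2)"
            using m \<theta> R0 by (intro mult_right_mono) auto
          also have "\<dots> = real n * (t * (\<theta> * (2 * exp (a * real B) * (R n / real n))) + t * (\<theta>\<^sup>2 * CJ\<^sup>2))"
            using n0 by (simp add: power2_eq_square field_simps)
          also have "\<dots> \<le> real n * (\<theta> * D / 4 + \<theta> * D / 2)"
            using elim(5) \<theta>(3) by (intro mult_left_mono add_mono) auto
          finally have "- (\<theta> * real n) * (h - (exp a - 1)) +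
            real m * (\<theta> * real n * (2 * exp (a * real B) * R n / (real n)\<^sup>2) + (\<theta> * real n)\<^sup>2 * (CJ / real n)\<^sup>2)
            \<le> - (\<theta> * D / 4) * real n"
            unfolding D_def[symmetric] by (simp add: algebra_simps)
          then have "exp (- (\<theta> * real n) * (h - (exp a - 1)) +
            real m * (\<theta> * real n * (2 * exp (a * real B) * R n / (real n)\<^sup>2) + (\<theta> * real n)\<^sup>2 * (CJ / real n)\<^sup>2))
            \<le> exp (- (\<theta> * D / 4) * real n)" by simp
          then show "exp (- (\<theta> * real n) * (h - (exp a - 1)) +
            real m * (\<theta> * real n * (2 * exp (a * real B) * R n / (real n)\<^sup>2) + (\<theta> * real n)\<^sup>2 * (CJ / real n)\<^sup>2)) \<le> \<delta> / 2"
            using elim(6) by linarith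
          have "0 \<le> C2" using h0 e by (auto simp: C2_def \<eta>_def intro!: divide_nonneg_pos sum_nonneg mult_nonneg_nonneg)
          then have "real m * (2 * (C2 * exp (- \<eta> * real B) + R n / real n) / real n) / \<epsilon>
              \<le> (t * real n) * (2 * (C2 * exp (- \<eta> * real B) + R n / real n) / real n) / \<epsilon>"
            using m R0 par by (intro divide_right_mono mult_right_mono) auto
          also have "\<dots> = t * (2 * (C2 * exp (- \<eta> * real B))) / \<epsilon> + t * (2 * (R n / real n)) / \<epsilon>"
            using n0 by (simp add: add_divide_distrib distrib_left)
          also have "\<dots> \<le> \<delta> / 4 + \<delta> / 4" using elim(4) B(2) by linarith
          finally show "real m * (2 * (C2 * exp (- \<eta> * real B) + R n / real n) / real n) / \<epsilon> \<le> \<delta> / 2" by simp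
        qed
        finally show "pr (cycle_class J k n) (nat \<lfloor>t * real n\<rfloor>) [] (\<lambda>zs. \<exists>v\<in>{1..n}. 4 / e * ln (real n) < real (card (component zs v))) \<le> \<delta>"
          by (simp add: m_def)
      qed
    qed
  qed
qed

end

section \<open>Counting components and cycles\<close>

lemma component_class_image:
  assumes "\<And>x. component as x \<subseteq> component bs x"
  shows "(\<Union>x\<in>component as v. component bs x) = component bs v"
proof -
  have "component bs x = component bs v" if "x \<in> component as v" for x
    using that assms by (intro component_eq) blast
  then show ?thesis using component_refl[of v as] by blast
qed

lemma card_components_antimono:
  assumes "finite V" "\<And>x. component as x \<subseteq> component bs x"
  shows "card (component bs ` V) \<le> card (component as ` V)"
proof -
  have "component bs ` V = (\<lambda>C. \<Union>x\<in>C. component bs x) ` component as ` V"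
    by (simp add: image_image component_class_image[OF assms(2)])
  moreover have "card ((\<lambda>C. \<Union>x\<in>C. component bs x) ` component as ` V) \<le> card (component as ` V)"
    using assms(1) by (intro card_image_le finite_imageI)
  ultimately show ?thesis by (simp only:)
qed

text \<open>A new component is contained in an old one or in the union of those of \<open>a\<close>
  and \<open>b\<close>. Hence old components other than that of \<open>b\<close> stay distinct, and
  at most one is lost.\<close>

lemma card_components_transpose:
  assumes "finite V"
  shows "card (component zs ` V) \<le> Suc (card (component (zs @ [Transposition.transpose a b]) ` V))"
proof -
  define S where "S = (\<lambda>v. if v \<in> component zs a \<union> component zs b then component zs a \<union> component zs b else component zs v)"
  have mono: "component zs x \<subseteq> component (zs @ [Transposition.transpose a b]) x" for x by (rule component_mono) auto
  have S_eq: "component zs w \<subseteq> S v" if "w \<in> S v" for v w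
  proof (cases "v \<in> component zs a \<union> component zs b")
    case True
    then have "component zs w = component zs a \<or> component zs w = component zs b"
      using that component_eq[of w zs a] component_eq[of w zs b] by (auto simp: S_def)
    then show ?thesis using True by (auto simp: S_def)
  next
    case False
    then show ?thesis using that component_eq[of w zs v] by (simp add: S_def)
  qed
  have sub: "component (zs @ [Transposition.transpose a b]) v \<subseteq> S v" for v
  proof (rule component_append_subset[OF _ S_eq])
    show "v \<in> S v" by (simp add: S_def)
    fix w u assume w: "w \<in> S v" "u = Transposition.transpose a b w \<or> w = Transposition.transpose a b u"
    then have u: "u = Transposition.transpose a b w" by auto
    show "u \<in> S v"
    proof (cases "w = a \<or> w = b")
      case True
      have "v \<in> component zs a \<union> component zs b"
      proof (rule ccontr)
        assume "v \<notin> component zs a \<union> component zs b"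
        then have "w \<in> component zs v" "v \<notin> component zs a \<union> component zs b" using w by (simp_all add: S_def)
        then have "v \<in> component zs w" using component_sym[of w zs v] by simp
        then show False using True \<open>v \<notin> component zs a \<union> component zs b\<close> by auto
      qed
      then show ?thesis using True u by (auto simp: S_def)
    next
      case False
      then show ?thesis using w(1) u by simp
    qed
  qed
  define f where "f = (\<lambda>C. \<Union>x\<in>C. component (zs @ [Transposition.transpose a b]) x)"
  have f: "f (component zs v) = component (zs @ [Transposition.transpose a b]) v" for v
    unfolding f_def by (rule component_class_image[OF mono])
  have "inj_on f (component zs ` V - {component zs b})"
  proof (rule inj_onI)
    fix C D assume *: "C \<in> component zs ` V - {component zs b}" "D \<in> component zs ` V - {component zs b}" "f C = f D"
    then obtain v w where vw: "C = component zs v" "D = component zs w" by auto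
    then have "component (zs @ [Transposition.transpose a b]) v = component (zs @ [Transposition.transpose a b]) w" using * by (simp add: f)
    then have wS: "w \<in> S v" using sub[of v] component_refl[of w "zs @ [Transposition.transpose a b]"] by auto
    have nb: "v \<notin> component zs b" "w \<notin> component zs b"
      using *(1,2) component_eq[of v zs b] component_eq[of w zs b] unfolding vw by blast+
    show "C = D"
    proof (cases "v \<in> component zs a \<union> component zs b")
      case True
      then have "v \<in> component zs a" "w \<in> component zs a" using nb wS by (auto simp: S_def)
      then show ?thesis using vw component_eq by metis
    next
      case False
      then have "w \<in> component zs v" using wS by (simp add: S_def)
      then show ?thesis using vw component_eq by metis
    qed
  qed
  moreover have "f ` (component zs ` V - {component zs b}) \<subseteq> component (zs @ [Transposition.transpose a b]) ` V"
    using f by auto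
  ultimately have "card (component zs ` V - {component zs b}) \<le> card (component (zs @ [Transposition.transpose a b]) ` V)"
    using assms by (intro card_inj_on_le) auto
  moreover have "card (component zs ` V) \<le> Suc (card (component zs ` V - {component zs b}))"
    using card_Suc_Diff1[of "component zs ` V" "component zs b"] assms
    by (cases "component zs b \<in> component zs ` V") auto
  ultimately show ?thesis by linarith
qed

lemma card_components_transpose_redundant:
  assumes "finite V" "b \<in> component zs a"
  shows "card (component zs ` V) \<le> card (component (zs @ [Transposition.transpose a b]) ` V)"
proof (rule card_components_antimono[OF assms(1)])
  fix v
  show "component (zs @ [Transposition.transpose a b]) v \<subseteq> component zs v"
  proof (rule component_append_subset)
    show "component zs w \<subseteq> component zs v" if "w \<in> component zs v" for w
      using component_eq[OF that] by simp
    show "u \<in> component zs v" if "w \<in> component zs v" "u = Transposition.transpose a b w \<or> w = Transposition.transpose a b u" for w u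
    proof -
      have "u = Transposition.transpose a b w" using that by auto
      moreover have "component zs b = component zs a" using component_eq[OF assms(2)] .
      ultimately show ?thesis using that(1) component_eq component_refl
        by (metis transpose_apply_first transpose_apply_second transpose_apply_other)
    qed
  qed simp
qed

lemma card_components_transposes:
  assumes "finite V"
  shows "card (component zs ` V) \<le> length es + card (component (zs @ map (\<lambda>y. Transposition.transpose y (g y)) es) ` V)"
proof (induction es arbitrary: zs)
  case (Cons e es)
  have "card (component zs ` V) \<le> Suc (card (component (zs @ [Transposition.transpose e (g e)]) ` V))"
    by (rule card_components_transpose[OF assms])
  also have "\<dots> \<le> Suc (length es + card (component ((zs @ [Transposition.transpose e (g e)]) @ map (\<lambda>y. Transposition.transpose y (g y)) es) ` V))"
    using Cons by blast
  finally show ?case by simp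
qed simp

text \<open>A permutation is replaced by one transposition fewer than its number of points, cycle by cycle; the
  first of them may be chosen to be any \<open>(x g(x))\<close>.\<close>

lemma card_components_append:
  assumes V: "finite V" and g: "g permutes V" and x: "g x \<noteq> x"
  shows "card (component zs ` V) + card (orbit g ` {y. g y \<noteq> y}) + of_bool (g x \<in> component zs x)
    \<le> card (component (zs @ [g]) ` V) + card {y. g y \<noteq> y}"
proof -
  define Y where "Y = {y. g y \<noteq> y}"
  have Y: "finite Y" using support_subset[OF g] V finite_subset by (auto simp: Y_def)
  \<comment> \<open>Representatives open every cycle into a path: \<open>F\<close> consists of the
    moved points whose outgoing edge does not end in a representative. Taking \<open>x\<close> as
    the representative of its own cycle keeps the edge from \<open>x\<close> to \<open>g x\<close>,
    since \<open>g x\<close> differs from \<open>x\<close>.\<close>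
  define rep where "rep = (\<lambda>C. if x \<in> C then x else SOME y. y \<in> C)"
  define R where "R = rep ` orbit g ` Y"
  define F where "F = {y \<in> Y. g y \<notin> R}"
  have self: "y \<in> orbit g y" for y by (rule self_in_orbit[OF V g])
  have rep_in: "rep (orbit g y) \<in> orbit g y" for y
    unfolding rep_def using self[of y] someI[of "\<lambda>z. z \<in> orbit g y" y] by auto
  have orbY: "orbit g y \<subseteq> Y" if "y \<in> Y" for y using orbit_subset_support[OF g] that by (simp add: Y_def)
  have RY: "R \<subseteq> Y" unfolding R_def using rep_in orbY by blast
  have inj_rep: "inj_on rep (orbit g ` Y)"
  proof (rule inj_onI)
    fix C D assume "C \<in> orbit g ` Y" "D \<in> orbit g ` Y" "rep C = rep D"
    then obtain y z where "C = orbit g y" "D = orbit g z" "rep (orbit g y) = rep (orbit g z)" by auto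
    then show "C = D" using rep_in[of y] rep_in[of z] orbit_eq[OF V g] by metis
  qed
  have cardR: "card R = card (orbit g ` Y)" unfolding R_def by (rule card_image[OF inj_rep])
  have R_unique: "r = rep (orbit g r)" if "r \<in> R" for r
  proof -
    from that obtain y where y: "r = rep (orbit g y)" by (auto simp: R_def)
    then have "orbit g r = orbit g y" using rep_in[of y] orbit_eq[OF V g] by metis
    then show ?thesis using y by simp
  qed
  have "card F + card R = card Y"
  proof -
    have "g ` Y = Y" using g Y by (intro endo_inj_surj) (auto simp: Y_def permutes_eq_iff inj_on_def)
    then have "g ` F = Y - R" by (auto simp: F_def)
    then have "card F = card (Y - R)" using g by (metis card_image inj_on_subset permutes_inj subset_UNIV)
    then show ?thesis using RY Y by (simp add: card_Diff_subset finite_subset card_mono)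
  qed
  moreover have xY: "x \<in> Y" using x by (simp add: Y_def)
  have xF: "x \<in> F"
  proof -
    have "g x \<notin> R"
    proof
      assume "g x \<in> R"
      then have "g x = rep (orbit g (g x))" by (rule R_unique)
      also have "orbit g (g x) = orbit g x" using orbit.base[of g x] by (rule orbit_eq[OF V g])
      also have "rep (orbit g x) = x" using self[of x] by (simp add: rep_def)
      finally show False using x by simp
    qed
    then show ?thesis using xY by (simp add: F_def)
  qed
  have "finite (F - {x})" using Y by (simp add: F_def)
  then obtain es where es: "set es = F - {x}" "distinct es" using finite_distinct_list by blast
  let ?ts = "\<lambda>es. map (\<lambda>y. Transposition.transpose y (g y)) es"
  have len: "length (x # es) = card F"
    using es xF distinct_card[of "x # es"] by (simp add: insert_absorb)
  have conn_F: "g y \<in> component (zs @ ?ts (x # es)) y" if "y \<in> F" for y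
  proof -
    have "Transposition.transpose y (g y) \<in> set (zs @ ?ts (x # es))" using that es by auto
    from component_step[OF this, of y] show ?thesis by simp
  qed
  have conn: "g y \<in> component (zs @ ?ts (x # es)) y" for y
  proof (cases "y \<in> Y")
    case True
    define r where "r = rep (orbit g y)"
    have r: "r \<in> R" "r \<in> orbit g y" using True rep_in by (auto simp: r_def R_def)
    have "z \<in> component (zs @ ?ts (x # es)) r" if "z \<in> orbit g r" for z
      using that
    proof induction
      case base
      have rY: "r \<in> Y" using r RY by auto
      show ?case
      proof (cases "g r \<in> R")
        case True
        have "orbit g (g r) = orbit g r" using orbit.base[of g r] by (rule orbit_eq[OF V g])
        then have "g r = r" using R_unique[OF True] R_unique[OF r(1)] by simp
        then show ?thesis by simp
      next
        case False
        then show ?thesis using rY conn_F by (simp add: F_def)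
      qed
    next
      case (step z)
      have zY: "z \<in> Y" using step(1) r RY orbY by blast
      show ?case
      proof (cases "g z \<in> R")
        case True
        have "g z \<in> orbit g r" using step(1) by (rule orbit.step)
        then have "orbit g (g z) = orbit g r" by (rule orbit_eq[OF V g])
        then have "g z = r" using R_unique[OF True] R_unique[OF r(1)] by simp
        then show ?thesis by simp
      next
        case False
        then have "g z \<in> component (zs @ ?ts (x # es)) z" using zY conn_F by (simp add: F_def)
        then show ?thesis using component_trans[OF step.IH] by blast
      qed
    qed
    moreover have "orbit g r = orbit g y" using r(2) by (rule orbit_eq[OF V g])
    ultimately have "y \<in> component (zs @ ?ts (x # es)) r" "g y \<in> component (zs @ ?ts (x # es)) r"
      using self[of y] orbit.base[of g y] by auto
    then show ?thesis using component_sym component_trans by metis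
  next
    case False
    then show ?thesis by (simp add: Y_def)
  qed
  have "component (zs @ [g]) v \<subseteq> component (zs @ ?ts (x # es)) v" for v
  proof (rule component_append_subset)
    fix w assume w: "w \<in> component (zs @ ?ts (x # es)) v"
    show "component zs w \<subseteq> component (zs @ ?ts (x # es)) v"
      using component_mono[of zs "zs @ ?ts (x # es)" w] component_eq[OF w] by auto
    fix u assume "u = g w \<or> w = g u"
    then show "u \<in> component (zs @ ?ts (x # es)) v"
      using w conn[of w] conn[of u] component_trans component_sym by metis
  qed simp
  then have le: "card (component (zs @ ?ts (x # es)) ` V) \<le> card (component (zs @ [g]) ` V)"
    by (rule card_components_antimono[OF V])
  \<comment> \<open>If \<open>x\<close> and \<open>g x\<close> are already joined, the first
    transposition costs no component.\<close>
  have "card (component zs ` V) + of_bool (g x \<in> component zs x) \<le> length (x # es) + card (component (zs @ ?ts (x # es)) ` V)"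
  proof (cases "g x \<in> component zs x")
    case True
    have "card (component zs ` V) \<le> card (component (zs @ [Transposition.transpose x (g x)]) ` V)"
      by (rule card_components_transpose_redundant[OF V True])
    also have "\<dots> \<le> length es + card (component ((zs @ [Transposition.transpose x (g x)]) @ ?ts es) ` V)"
      by (rule card_components_transposes[OF V])
    finally show ?thesis using True by simp
  next
    case False
    then show ?thesis using card_components_transposes[OF V, of zs "x # es" g] by simp
  qed
  then show ?thesis using le len cardR \<open>card F + card R = card Y\<close> unfolding Y_def[symmetric] by linarith
qed

section \<open>Number of cycles when a permutation is multiplied by a step\<close>

context
  fixes V :: "'a set" and \<sigma> g \<tau> :: "'a \<Rightarrow> 'a"
  assumes V: "finite V" and \<sigma>: "\<sigma> permutes V" and g: "g permutes V" and \<tau>: "\<tau> = \<sigma> \<circ> g"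
begin

lemma \<tau>_apply: "\<tau> x = \<sigma> (g x)"
  by (simp add: \<tau>)

lemma \<tau>_permutes: "\<tau> permutes V"
  unfolding \<tau> using g \<sigma> by (rule permutes_compose)

lemma orbit_comp_untouched:
  assumes "orbit \<tau> x \<inter> {y. g y \<noteq> y} = {}"
  shows "orbit \<tau> x = orbit \<sigma> x"
proof (intro equalityI subsetI)
  have fixed: "g z = z" if "z \<in> orbit \<tau> x" for z using that assms by auto
  have gx: "g x = x" using fixed[OF self_in_orbit[OF V \<tau>_permutes]] .
  show "y \<in> orbit \<sigma> x" if "y \<in> orbit \<tau> x" for y
    using that
  proof induction
    case base
    then show ?case using gx orbit.base[of \<sigma> x] by (simp add: \<tau>_apply[of x])
  next
    case (step y)
    then show ?case using fixed[OF step(1)] orbit.step[of y \<sigma> x] by (simp add: \<tau>_apply[of y])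
  qed
  show "y \<in> orbit \<tau> x" if "y \<in> orbit \<sigma> x" for y
    using that
  proof induction
    case base
    then show ?case using gx orbit.base[of \<tau> x] by (simp add: \<tau>_apply[of x])
  next
    case (step y)
    then show ?case using fixed[OF step(2)] orbit.step[OF step(2)] by (simp add: \<tau>_apply[of y])
  qed
qed

lemma orbits_comp_subset:
  "orbit \<tau> ` V \<subseteq> orbit \<tau> ` {y. g y \<noteq> y} \<union> {C \<in> orbit \<sigma> ` V. C \<inter> {y. g y \<noteq> y} = {}}"
proof
  fix C assume "C \<in> orbit \<tau> ` V"
  then obtain x where x: "x \<in> V" "C = orbit \<tau> x" by auto
  show "C \<in> orbit \<tau> ` {y. g y \<noteq> y} \<union> {C \<in> orbit \<sigma> ` V. C \<inter> {y. g y \<noteq> y} = {}}"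
  proof (cases "C \<inter> {y. g y \<noteq> y} = {}")
    case True
    then show ?thesis using x orbit_comp_untouched[of x] by auto
  next
    case False
    then obtain y where y: "y \<in> C" "g y \<noteq> y" by auto
    then have "orbit \<tau> y = C" using x orbit_eq[OF V \<tau>_permutes] by simp
    then show ?thesis using y by auto
  qed
qed

lemma finite_support_g: "finite {y. g y \<noteq> y}"
  using support_subset[OF g] V finite_subset by blast

text \<open>Cycles of the product that avoid the support of \<open>g\<close> are cycles of
  \<open>\<sigma>\<close>; at most one further cycle passes through each moved point.\<close>

lemma card_orbits_comp_le: "card (orbit \<tau> ` V) \<le> card (orbit \<sigma> ` V) + card {y. g y \<noteq> y}"
proof -
  have "card (orbit \<tau> ` V) \<le> card (orbit \<tau> ` {y. g y \<noteq> y} \<union> orbit \<sigma> ` V)"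
    using orbits_comp_subset V finite_support_g by (intro card_mono) auto
  also have "\<dots> \<le> card (orbit \<tau> ` {y. g y \<noteq> y}) + card (orbit \<sigma> ` V)" by (rule card_Un_le)
  also have "\<dots> \<le> card {y. g y \<noteq> y} + card (orbit \<sigma> ` V)"
    using card_image_le[OF finite_support_g] by simp
  finally show ?thesis by simp
qed

text \<open>From \<open>y\<close> the product jumps to \<open>\<sigma> (g y)\<close> and then
  follows the \<open>\<sigma>\<close>-cycle of \<open>g y\<close>. As no other point of this cycle
  is moved by \<open>g\<close>, it continues until it meets \<open>g y\<close> itself.\<close>

lemma orbit_comp_joined:
  assumes inj: "inj_on (orbit \<sigma>) {y. g y \<noteq> y}" and y: "g y \<noteq> y"
  shows "g y \<in> orbit \<tau> y"
proof -
  have gy: "g (g y) \<noteq> g y" using y permutes_eq_iff[OF g] by metis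
  have "z \<in> orbit \<tau> y \<or> g y \<in> orbit \<tau> y" if "z \<in> orbit \<sigma> (g y)" for z
    using that
  proof induction
    case base
    then show ?case using orbit.base[of \<tau> y] by (simp add: \<tau>_apply[of y])
  next
    case (step z)
    show ?case
    proof (cases "g y \<in> orbit \<tau> y")
      case False
      then have z: "z \<in> orbit \<tau> y" "z \<noteq> g y" using step by auto
      have "g z = z"
      proof (rule ccontr)
        assume "g z \<noteq> z"
        moreover have "orbit \<sigma> z = orbit \<sigma> (g y)" using orbit_eq[OF V \<sigma> step(1)] .
        ultimately show False using inj_onD[OF inj] gy z(2) by blast
      qed
      then show ?thesis using orbit.step[OF z(1)] by (simp add: \<tau>_apply[of z])
    qed simp
  qed
  from this[OF self_in_orbit[OF V \<sigma>]] show ?thesis by blast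
qed

text \<open>All \<open>\<sigma>\<close>-cycles met by one cycle of \<open>g\<close> end up in a
  single cycle of the product. So the distinct cycles through the moved points are replaced by at
  most one for each nontrivial cycle of \<open>g\<close>.\<close>

lemma card_orbits_comp_joined:
  assumes inj: "inj_on (orbit \<sigma>) {y. g y \<noteq> y}"
  shows "card (orbit \<tau> ` V) + card {y. g y \<noteq> y} \<le> card (orbit \<sigma> ` V) + card (orbit g ` {y. g y \<noteq> y})"
proof -
  let ?Y = "{y. g y \<noteq> y}"
  define N where "N = {C \<in> orbit \<sigma> ` V. C \<inter> ?Y = {}}"
  have "orbit \<tau> z = orbit \<tau> y" if "z \<in> orbit g y" for y z
    using that
  proof induction
    case base
    show ?case
    proof (cases "g y = y")
      case False
      then show ?thesis using orbit_comp_joined[OF inj False] orbit_eq[OF V \<tau>_permutes] by simp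
    qed simp
  next
    case (step z)
    have "orbit \<tau> (g z) = orbit \<tau> z"
    proof (cases "g z = z")
      case False
      then show ?thesis using orbit_comp_joined[OF inj False] orbit_eq[OF V \<tau>_permutes] by simp
    qed simp
    then show ?case using step by simp
  qed
  then have "(\<Union>z\<in>orbit g y. orbit \<tau> z) = orbit \<tau> y" for y
    using UN_upper[of y "orbit g y" "orbit \<tau>", OF self_in_orbit[OF V g]] by (intro equalityI UN_least) simp_all
  then have "orbit \<tau> ` ?Y = (\<lambda>C. \<Union>z\<in>C. orbit \<tau> z) ` orbit g ` ?Y"
    by (simp add: image_image)
  moreover have "card ((\<lambda>C. \<Union>z\<in>C. orbit \<tau> z) ` orbit g ` ?Y) \<le> card (orbit g ` ?Y)"
    using finite_support_g by (intro card_image_le finite_imageI)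
  ultimately have 1: "card (orbit \<tau> ` ?Y) \<le> card (orbit g ` ?Y)" by (simp only:)
  have disj: "N \<inter> orbit \<sigma> ` ?Y = {}"
    using self_in_orbit[OF V \<sigma>] by (auto simp: N_def)
  have "N \<union> orbit \<sigma> ` ?Y \<subseteq> orbit \<sigma> ` V" using support_subset[OF g] by (auto simp: N_def)
  then have "card (N \<union> orbit \<sigma> ` ?Y) \<le> card (orbit \<sigma> ` V)" using V by (intro card_mono) auto
  then have 2: "card N + card ?Y \<le> card (orbit \<sigma> ` V)"
    using disj V finite_support_g card_image[OF inj] by (simp add: N_def card_Un_disjoint)
  have "card (orbit \<tau> ` V) \<le> card (orbit \<tau> ` ?Y \<union> N)"
    using orbits_comp_subset V finite_support_g by (intro card_mono) (auto simp: N_def)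
  also have "\<dots> \<le> card (orbit \<tau> ` ?Y) + card N" by (rule card_Un_le)
  finally show ?thesis using 1 2 by linarith
qed

end

section \<open>Products of the steps: their cycles lie inside components\<close>

definition perm_product :: "('a \<Rightarrow> 'a) list \<Rightarrow> 'a \<Rightarrow> 'a" where
  "perm_product zs = foldr (\<circ>) zs id"

lemma perm_product_Nil [simp]: "perm_product [] = id"
  by (simp add: perm_product_def)

lemma perm_product_Cons: "perm_product (g # zs) = g \<circ> perm_product zs"
  by (simp add: perm_product_def)

lemma perm_product_append: "perm_product (zs @ [g]) = perm_product zs \<circ> g"
  by (induction zs) (simp_all add: perm_product_Cons comp_assoc)

lemma perm_product_permutes:
  assumes "\<And>g. g \<in> set zs \<Longrightarrow> g permutes V"
  shows "perm_product zs permutes V"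
  using assms
proof (induction zs)
  case (Cons g zs)
  then show ?case unfolding perm_product_Cons by (intro permutes_compose) auto
qed (simp add: permutes_id)

lemma perm_product_component: "perm_product zs v \<in> component zs v"
proof (induction zs)
  case (Cons g zs)
  have "component zs v \<subseteq> component (g # zs) v" by (rule component_mono) auto
  then have "perm_product zs v \<in> component (g # zs) v" using Cons by blast
  moreover have "g (perm_product zs v) \<in> component (g # zs) (perm_product zs v)"
    by (rule component_step) simp
  ultimately have "g (perm_product zs v) \<in> component (g # zs) v" by (rule component_trans)
  then show ?case by (simp add: perm_product_Cons)
qed simp

lemma orbit_perm_product_subset: "orbit (perm_product zs) v \<subseteq> component zs v"
proof
  fix y assume "y \<in> orbit (perm_product zs) v"
  then show "y \<in> component zs v"
  proof induction
    case base
    show ?case by (rule perm_product_component)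
  next
    case (step y)
    show ?case by (rule component_trans[OF step(2) perm_product_component])
  qed
qed

lemma card_components_le_orbits:
  assumes V: "finite V" and zs: "\<And>g. g \<in> set zs \<Longrightarrow> g permutes V"
  shows "card (component zs ` V) \<le> card (orbit (perm_product zs) ` V)"
proof -
  have "(\<Union>x\<in>orbit (perm_product zs) v. component zs x) = component zs v" for v
  proof -
    have eq: "component zs x = component zs v" if "x \<in> orbit (perm_product zs) v" for x
      using subsetD[OF orbit_perm_product_subset that] by (rule component_eq)
    have self: "v \<in> orbit (perm_product zs) v"
      by (rule self_in_orbit[OF V perm_product_permutes[OF zs]])
    show ?thesis
    proof (rule equalityI)
      show "(\<Union>x\<in>orbit (perm_product zs) v. component zs x) \<subseteq> component zs v"
        by (rule UN_least) (simp only: eq)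
      show "component zs v \<subseteq> (\<Union>x\<in>orbit (perm_product zs) v. component zs x)"
        by (rule UN_upper[OF self])
    qed
  qed
  then have "component zs ` V = (\<lambda>C. \<Union>x\<in>C. component zs x) ` orbit (perm_product zs) ` V"
    by (simp add: image_image)
  moreover have "card ((\<lambda>C. \<Union>x\<in>C. component zs x) ` orbit (perm_product zs) ` V) \<le> card (orbit (perm_product zs) ` V)"
    using V by (intro card_image_le finite_imageI)
  ultimately show ?thesis by (simp only:)
qed

section \<open>The supercritical regime\<close>

lemma pr_shift: "pr S r (xs @ ys) Q = pr S r ys (\<lambda>zs. Q (xs @ zs))"
  by (induction r arbitrary: ys) (simp_all add: append_assoc)

lemma pr_all_le:
  assumes S: "finite S" "S \<noteq> {}" and q: "avg S (\<lambda>g. of_bool (A g)) \<le> q"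
  shows "pr S r [] (\<lambda>zs. \<forall>g\<in>set zs. A g) \<le> q ^ r"
proof -
  have q0: "0 \<le> q" using q avg_nonneg[of S "\<lambda>g. of_bool (A g)"] by simp
  have "pr S r xs (\<lambda>zs. \<forall>g\<in>set zs. A g) \<le> of_bool (\<forall>g\<in>set xs. A g) * q ^ r" for xs
  proof (induction r arbitrary: xs)
    case (Suc r)
    have "avg S (\<lambda>g. pr S r (xs @ [g]) (\<lambda>zs. \<forall>g\<in>set zs. A g)) \<le>
        avg S (\<lambda>g. of_bool (\<forall>g\<in>set (xs @ [g]). A g) * q ^ r)"
      by (intro avg_mono Suc)
    also have "\<dots> = avg S (\<lambda>g. (of_bool (\<forall>g\<in>set xs. A g) * q ^ r) * of_bool (A g))"
      by (intro avg_cong) auto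
    also have "\<dots> \<le> (of_bool (\<forall>g\<in>set xs. A g) * q ^ r) * q"
      unfolding avg_cmult using q q0 by (intro mult_left_mono) auto
    finally show ?case by (simp add: ac_simps)
  qed simp
  from this[of "[]"] show ?thesis by simp
qed

lemma exp_mult_le: "0 < (\<alpha>::real) \<Longrightarrow> real m * exp (- \<alpha> * real m) \<le> 1 / \<alpha>"
proof -
  assume \<alpha>: "0 < \<alpha>"
  have "\<alpha> * real m \<le> exp (\<alpha> * real m)" using exp_ge_add_one_self[of "\<alpha> * real m"] by linarith
  then have "\<alpha> * real m * exp (- \<alpha> * real m) \<le> exp (\<alpha> * real m) * exp (- \<alpha> * real m)"
    by (intro mult_right_mono) auto
  also have "\<dots> = 1" by (simp add: exp_add[symmetric])
  finally show ?thesis using \<alpha> by (simp add: field_simps)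
qed

text \<open>The functional \<open>H\<close> follows a linearly decreasing exponent as before, but it
  is bounded and has jumps of order \<open>1 / (e * n)\<close>, because
  \<open>m * exp (- lam * m)\<close> is at most \<open>1 / e\<close>. The size bound
  \<open>\<epsilon> * n\<close> keeps the collision error \<open>L ^ 3 * \<epsilon>\<close> within
  the slack between \<open>c\<close> and \<open>decay h'\<close>.\<close>

lemma (in cycle_type) supercritical_mass_bound:
  fixes n m :: nat and t a h h' c e \<epsilon> \<theta> :: real
  assumes n: "1 \<le> n" "cycle_class J k n \<noteq> {}" and m: "real m \<le> t * real n"
    and par: "0 < c" "0 < e" "e = a - c * t" "h' \<le> h - c / (real n * e)" "0 \<le> \<epsilon>"
      "real L ^ 3 * \<epsilon> + c \<le> decay h'"
    and \<theta>: "0 \<le> \<theta>" "\<theta> * ((real L + c) / e) \<le> 1"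
  shows "pr (cycle_class J k n) m [] (\<lambda>zs. (\<forall>v\<in>{1..n}. real (card (component zs v)) \<le> \<epsilon> * real n) \<and>
      avg {1..n} (\<lambda>v. 1 - exp (- (a - c * real m / real n) * real (card (component zs v)))) \<le> h)
    \<le> exp (- (\<theta> * real n) * (1 - exp (- a) - h) * 1 + real m * ((\<theta> * real n)\<^sup>2 * ((real L + c) / (e * real n))\<^sup>2))"
proof -
  define \<Gamma> where "\<Gamma> = cycle_class J k n"
  define V where "V = {1..n}"
  interpret pc: perm_class V \<Gamma> L
    using perm_classI[OF n] by (simp add: V_def \<Gamma>_def)
  have card_V: "card V = n" by (simp add: V_def)
  have n0: "0 < real n" using n by simp
  define s where "s = (\<lambda>(zs :: (nat \<Rightarrow> nat) list) v. card (component zs v))"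
  define lam where "lam = (\<lambda>i. a - c * real i / real n)"
  define H where "H = (\<lambda>zs. avg V (\<lambda>v. 1 - exp (- lam (length zs) * real (s zs v))))"
  define Good where "Good = (\<lambda>zs. (\<forall>v\<in>V. real (s zs v) \<le> \<epsilon> * real n) \<and> h < H zs)"
  define d where "d = c / real n"
  have d0: "0 \<le> d" using par by (simp add: d_def)
  have lam_ge: "e \<le> lam i" if "i \<le> m" for i
  proof -
    have "real i \<le> t * real n" using that m by linarith
    then have "c * real i \<le> c * (t * real n)" using par by (intro mult_left_mono) auto
    then have "c * real i / real n \<le> c * t" using n0 by (simp add: pos_divide_le_eq ac_simps)
    then show ?thesis using par by (simp add: lam_def)
  qed
  have lam_Suc: "lam (Suc i) = lam i - d" for i
    by (simp add: lam_def d_def add_divide_distrib distrib_left)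
  define \<phi> where "\<phi> = (\<lambda>zs. avg V (\<lambda>v. 1 - exp (- lam (Suc (length zs)) * real (s zs v))))"
  define \<phi>' where "\<phi>' = (\<lambda>zs. avg V (\<lambda>v. real (s zs v) * exp (- lam (Suc (length zs)) * real (s zs v))))"
  have \<phi>'0: "0 \<le> \<phi>' zs" for zs unfolding \<phi>'_def by (intro avg_nonneg) simp
  have \<phi>'_le: "\<phi>' zs \<le> 1 / e" if "length zs < m" for zs
    unfolding \<phi>'_def
  proof (intro avg_le_const pc.finV pc.V_nonempty)
    fix v
    have l: "e \<le> lam (Suc (length zs))" using lam_ge that by simp
    have "real (s zs v) * exp (- lam (Suc (length zs)) * real (s zs v)) \<le> 1 / lam (Suc (length zs))"
      using l par by (intro exp_mult_le) simp
    also have "\<dots> \<le> 1 / e" using l par by (intro divide_left_mono mult_pos_pos) auto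
    finally show "real (s zs v) * exp (- lam (Suc (length zs)) * real (s zs v)) \<le> 1 / e" .
  qed
  have time: "H zs - d * \<phi>' zs \<le> \<phi> zs" "\<phi> zs \<le> H zs" for zs
  proof -
    have pt: "1 - exp (- lam (length zs) * x) - d * (x * exp (- lam (Suc (length zs)) * x)) \<le> 1 - exp (- lam (Suc (length zs)) * x)" for x
    proof -
      have "exp (- lam (Suc (length zs)) * x) * (1 - d * x) \<le> exp (- lam (Suc (length zs)) * x) * exp (- (d * x))"
        using exp_ge_add_one_self[of "- (d * x)"] by (intro mult_left_mono) auto
      also have "\<dots> = exp (- lam (length zs) * x)" by (simp add: lam_Suc exp_add[symmetric] algebra_simps)
      finally show ?thesis by (simp add: algebra_simps)
    qed
    then show "H zs - d * \<phi>' zs \<le> \<phi> zs"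
      unfolding H_def \<phi>_def \<phi>'_def avg_cmult[symmetric] avg_diff[symmetric] by (intro avg_mono) auto
    have "lam (Suc (length zs)) * real x \<le> lam (length zs) * real x" for x
      using d0 by (intro mult_right_mono) (auto simp: lam_Suc)
    then show "\<phi> zs \<le> H zs" unfolding H_def \<phi>_def by (intro avg_mono) auto
  qed
  \<comment> \<open>\<open>pr_drift\<close> bounds upward excursions, so it is applied to
    \<open>- H\<close>.\<close>
  have drift: "avg \<Gamma> (\<lambda>g. - H (zs @ [g])) \<le> - H zs + 0"
    if zs: "set zs \<subseteq> \<Gamma>" "length zs < m" "Good zs" for zs
  proof -
    have l: "0 \<le> lam (Suc (length zs))" using lam_ge[of "Suc (length zs)"] zs par by auto
    \<comment> \<open>Lowering the exponent by \<open>d\<close> costs at most \<open>d / e\<close>,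
      and the gap between \<open>h\<close> and \<open>h'\<close> covers this.\<close>
    have "h' \<le> \<phi> zs"
    proof -
      have "d * \<phi>' zs \<le> d * (1 / e)" using \<phi>'_le[OF zs(2)] d0 by (intro mult_left_mono)
      then show ?thesis using time(1)[of zs] zs(3) par(4) n0 by (simp add: Good_def d_def)
    qed
    moreover have "\<phi> zs \<le> 1" unfolding \<phi>_def by (intro avg_le_const pc.finV pc.V_nonempty) simp
    ultimately have dec: "decay h' \<le> decay (\<phi> zs)" by (intro decay_mono)
    have b: "decay h' \<le> (\<Sum>y\<in>{y. p y \<noteq> y}. 1 - (1 - \<phi> zs) ^ (card (orbit p y) - 1))" if p: "p \<in> \<Gamma>" for p
      using dec sum_support[of p J k n "\<lambda>j. 1 - (1 - \<phi> zs) ^ (j - 1)"] p by (simp add: decay_def \<Gamma>_def)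
    have "(\<Sum>v\<in>V. 1 - exp (- lam (Suc (length zs)) * real (card (component zs v)))) + \<phi>' zs * (decay h' - real L ^ 3 * (\<epsilon> * real n) / real (card V))
      \<le> avg \<Gamma> (\<lambda>g. \<Sum>v\<in>V. 1 - exp (- lam (Suc (length zs)) * real (card (component (zs @ [g]) v))))"
      using pc.avg_component_sum_ge[of zs "lam (Suc (length zs))" "\<epsilon> * real n" "decay h'"] zs b l
      by (simp add: \<phi>_def \<phi>'_def s_def Good_def)
    also have "(\<Sum>v\<in>V. 1 - exp (- lam (Suc (length zs)) * real (card (component zs v)))) = real n * \<phi> zs"
      using n0 by (simp add: \<phi>_def avg_def s_def card_V)
    also have "avg \<Gamma> (\<lambda>g. \<Sum>v\<in>V. 1 - exp (- lam (Suc (length zs)) * real (card (component (zs @ [g]) v)))) = real n * avg \<Gamma> (\<lambda>g. H (zs @ [g]))"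
      unfolding avg_cmult[symmetric] using n0 by (intro avg_cong) (simp add: H_def avg_def s_def card_V)
    finally have "real n * \<phi> zs + \<phi>' zs * (decay h' - real L ^ 3 * \<epsilon>) \<le> real n * avg \<Gamma> (\<lambda>g. H (zs @ [g]))"
      using n0 by (simp add: card_V)
    moreover have "\<phi>' zs * c \<le> \<phi>' zs * (decay h' - real L ^ 3 * \<epsilon>)"
      using par \<phi>'0 by (intro mult_left_mono) auto
    moreover have "real n * H zs - \<phi>' zs * c \<le> real n * \<phi> zs"
    proof -
      have "real n * (H zs - d * \<phi>' zs) \<le> real n * \<phi> zs" using time(1) n0 by (intro mult_left_mono) auto
      moreover have "real n * (H zs - d * \<phi>' zs) = real n * H zs - \<phi>' zs * c" using n0 by (simp add: d_def right_diff_distrib)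
      ultimately show ?thesis by simp
    qed
    ultimately have "real n * H zs \<le> real n * avg \<Gamma> (\<lambda>g. H (zs @ [g]))"
      by linarith
    then have "H zs \<le> avg \<Gamma> (\<lambda>g. H (zs @ [g]))" using n0 by simp
    then show ?thesis using avg_cmult[of \<Gamma> "-1" "\<lambda>g. H (zs @ [g])"] by simp
  qed
  have jump: "\<bar>- H (zs @ [g]) - (- H zs)\<bar> \<le> (real L + c) / (e * real n)"
    if zs: "set zs \<subseteq> \<Gamma>" "length zs < m" "Good zs" and g: "g \<in> \<Gamma>" for zs g
  proof -
    let ?l = "lam (Suc (length zs))"
    have l: "0 < ?l" "e \<le> ?l" using lam_ge[of "Suc (length zs)"] zs par by auto
    let ?S = "(\<Sum>v\<in>V. 1 - exp (- ?l * real (card (component (zs @ [g]) v)))) - (\<Sum>v\<in>V. 1 - exp (- ?l * real (card (component zs v))))"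
    have S: "\<bar>(\<Sum>v\<in>V. 1 - exp (- ?l * real (card (component (zs @ [g]) v)))) - (\<Sum>v\<in>V. 1 - exp (- ?l * real (card (component zs v))))\<bar>
        \<le> real L * (1 / e)"
    proof (rule pc.component_sum_jump[OF zs(1) g, where D = "\<lambda>x. exp (- ?l * real x)"])
      fix x x' :: nat assume "1 \<le> x" "x \<le> x'"
      then have "?l * real x \<le> ?l * real x'" using l by (intro mult_left_mono) auto
      then have "exp (- ?l * real x') \<le> exp (- ?l * real x)" by simp
      then show "\<bar>1 - exp (- ?l * real x') - (1 - exp (- ?l * real x))\<bar> \<le> exp (- ?l * real x)" by simp
    next
      fix x
      have "real x * exp (- ?l * real x) \<le> 1 / ?l" using l by (intro exp_mult_le)
      also have "\<dots> \<le> 1 / e" using l par by (intro divide_left_mono mult_pos_pos) auto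
      finally show "real x * exp (- ?l * real x) \<le> 1 / e" .
    qed
    have "H (zs @ [g]) - \<phi> zs = ?S / real n"
      by (simp add: H_def \<phi>_def s_def avg_def card_V diff_divide_distrib)
    then have "\<bar>H (zs @ [g]) - \<phi> zs\<bar> = \<bar>?S\<bar> / real n" by (simp only: abs_divide abs_of_nat)
    also have "\<dots> \<le> real L * (1 / e) / real n" using S by (rule divide_right_mono) simp
    finally have 1: "\<bar>H (zs @ [g]) - \<phi> zs\<bar> \<le> real L * (1 / e) / real n" .
    have "d * \<phi>' zs \<le> d * (1 / e)" using \<phi>'_le[OF zs(2)] d0 by (intro mult_left_mono)
    then have 2: "\<bar>\<phi> zs - H zs\<bar> \<le> c / real n * (1 / e)" using time[of zs] by (simp add: d_def)
    have "(real L + c) / (e * real n) = real L * (1 / e) / real n + c / real n * (1 / e)"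
      by (simp add: add_divide_distrib mult.commute)
    then show ?thesis using 1 2 by linarith
  qed
  have start: "H [] = 1 - exp (- a)"
  proof -
    have "H [] = avg V (\<lambda>_. 1 - exp (- a))" unfolding H_def
      by (intro avg_cong) (auto simp: s_def lam_def)
    then show ?thesis using pc.finV pc.V_nonempty by simp
  qed
  have "pr \<Gamma> m [] (\<lambda>zs. (\<forall>v\<in>{1..n}. real (card (component zs v)) \<le> \<epsilon> * real n) \<and>
      avg {1..n} (\<lambda>v. 1 - exp (- (a - c * real m / real n) * real (card (component zs v)))) \<le> h)
    \<le> pr \<Gamma> m [] (\<lambda>zs. \<exists>j\<le>m. (\<forall>i<j. Good (take i zs)) \<and> - h \<le> - H (take j zs))"
  proof (rule pr_mono, elim conjE)
    fix ys assume ys: "length ys = m" "set ys \<subseteq> \<Gamma>"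
      and small: "\<forall>v\<in>{1..n}. real (card (component ([] @ ys) v)) \<le> \<epsilon> * real n"
      and Hm: "avg {1..n} (\<lambda>v. 1 - exp (- (a - c * real m / real n) * real (card (component ([] @ ys) v)))) \<le> h"
    \<comment> \<open>Components only grow, so the size bound at the end yields it for every prefix,
      as \<open>Good\<close> demands.\<close>
    have small': "real (s (take i ys) v) \<le> \<epsilon> * real n" if "v \<in> V" for i v
    proof -
      have "component (take i ys) v \<subseteq> component ys v" by (rule component_mono) (rule set_take_subset)
      moreover have "finite (component ys v)"
        using component_subset_carrier[of ys V v] pc.\<Gamma>_permutes ys that finite_subset[OF _ pc.finV] by blast
      ultimately have "s (take i ys) v \<le> s ys v" unfolding s_def by (rule card_mono[rotated])
      moreover have "real (s ys v) \<le> \<epsilon> * real n" using small that by (simp add: V_def s_def)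
      ultimately show ?thesis by linarith
    qed
    have "H ys \<le> h" using Hm ys by (simp add: H_def lam_def V_def s_def)
    then have ex: "\<exists>j. j \<le> m \<and> H (take j ys) \<le> h" using ys by (intro exI[of _ m]) simp
    define j where "j = (LEAST j. j \<le> m \<and> H (take j ys) \<le> h)"
    have j: "j \<le> m" "H (take j ys) \<le> h" using LeastI_ex[OF ex] by (auto simp: j_def)
    have "Good (take i ys)" if "i < j" for i
      using not_less_Least[OF that[unfolded j_def]] that j small' by (auto simp: Good_def)
    then show "\<exists>j\<le>m. (\<forall>i<j. Good (take i ([] @ ys))) \<and> - h \<le> - H (take j ([] @ ys))"
      using j by auto
  qed
  also have "\<dots> \<le> exp (- (\<theta> * real n) * (- h - (- H [])) + real m * (\<theta> * real n * 0 + (\<theta> * real n)\<^sup>2 * ((real L + c) / (e * real n))\<^sup>2))"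
  proof (rule pr_drift[OF pc.finite_\<Gamma> pc.\<Gamma>_nonempty])
    have "\<theta> * real n * ((real L + c) / (e * real n)) = \<theta> * ((real L + c) / e)" using n0 by simp
    then show "\<theta> * real n * ((real L + c) / (e * real n)) \<le> 1" using \<theta>(2) by (simp only:)
  qed (use \<theta> drift jump in auto)
  finally show ?thesis unfolding start \<Gamma>_def by (simp add: algebra_simps)
qed

text \<open>The exponent left at time \<open>t\<close> is about \<open>e = h / (2 * l)\<close>, so
  classes below size \<open>l\<close> contribute about \<open>h / 2\<close> at most to a functional
  that exceeds \<open>h\<close>. Another \<open>h / 4\<close> is reserved for rounding, and the
  remaining \<open>h / 4\<close> must come from classes of size at least \<open>l\<close>. This
  \<open>p\<close> does not depend on \<open>l\<close>, while \<open>\<epsilon>\<close> does;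
  sprinkling relies on this order of choices.\<close>

lemma (in cycle_type) supercritical_mass:
  assumes t: "0 < t" "1 < \<kappa> * t"
  obtains p :: real where "0 < p" "p \<le> 1" "\<And>l :: nat. 1 \<le> l \<Longrightarrow> \<exists>\<epsilon>>0. \<forall>\<delta>>0. \<forall>\<^sub>F n in sequentially. cycle_class J k n \<noteq> {} \<longrightarrow>
      pr (cycle_class J k n) (nat \<lfloor>t * real n\<rfloor>) [] (\<lambda>zs. (\<forall>v\<in>{1..n}. real (card (component zs v)) \<le> \<epsilon> * real n) \<and>
        real (card {v\<in>{1..n}. l \<le> card (component zs v)}) < p * real n) \<le> \<delta>"
proof -
  obtain a h h' where par: "0 < a" "0 < h'" "h' < h" "h < 1 - exp (- a)" "a < t * decay h'"
    using supercritical_parameters[OF t] by metis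
  have ha: "h < a" using par exp_ge_add_one_self[of "- a"] by linarith
  show ?thesis
  proof (rule that[of "h / 4"])
    show "0 < h / 4" using par by simp
    have "0 < exp (- a)" by simp
    then show "h / 4 \<le> 1" using par by linarith
    fix l :: nat assume l: "1 \<le> l"
    define e where "e = h / (2 * real l)"
    have e: "0 < e" using par l by (simp add: e_def)
    have "e \<le> h / 2" using par l unfolding e_def by (intro divide_left_mono) auto
    then have ea: "e < a" using ha par by linarith
    \<comment> \<open>This speed brings the exponent from \<open>a\<close> to exactly
      \<open>e\<close> at time \<open>t\<close>; the slack below \<open>decay h'\<close> is spent on
      collisions through \<open>\<epsilon>\<close>.\<close>
    define c where "c = (a - e) / t"
    have c: "0 < c" "e = a - c * t" using ea t by (auto simp: c_def)
    have cd: "c < decay h'"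
    proof -
      have "a - e < t * decay h'" using par e by linarith
      then show ?thesis using t by (simp add: c_def pos_divide_less_eq mult.commute)
    qed
    define \<epsilon> where "\<epsilon> = (decay h' - c) / real L ^ 3"
    have \<epsilon>: "0 < \<epsilon>" "real L ^ 3 * \<epsilon> + c \<le> decay h'" using cd L_pos by (auto simp: \<epsilon>_def)
    define D where "D = 1 - exp (- a) - h"
    have D: "0 < D" using par by (simp add: D_def)
    define CJ where "CJ = (real L + c) / e"
    have CJ: "0 < CJ" using c e by (simp add: CJ_def add_nonneg_pos)
    define \<theta> where "\<theta> = min (1 / CJ) (D / (2 * t * CJ\<^sup>2))"
    have \<theta>: "0 < \<theta>" "\<theta> * CJ \<le> 1" "t * (\<theta>\<^sup>2 * CJ\<^sup>2) \<le> \<theta> * D / 2"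
    proof -
      show pos: "0 < \<theta>" using CJ D t by (simp add: \<theta>_def)
      have "\<theta> \<le> 1 / CJ" by (simp add: \<theta>_def)
      then show "\<theta> * CJ \<le> 1" using CJ by (simp add: pos_le_divide_eq)
      have "\<theta> \<le> D / (2 * t * CJ\<^sup>2)" by (simp add: \<theta>_def)
      then have "\<theta> * (2 * t * CJ\<^sup>2) \<le> D" using CJ t by (subst (asm) pos_le_divide_eq) auto
      then have "\<theta> * (\<theta> * (2 * t * CJ\<^sup>2)) \<le> \<theta> * D" using pos by (intro mult_left_mono) auto
      then show "t * (\<theta>\<^sup>2 * CJ\<^sup>2) \<le> \<theta> * D / 2" by (simp add: power2_eq_square algebra_simps)
    qed
    show "\<exists>\<epsilon>>0. \<forall>\<delta>>0. \<forall>\<^sub>F n in sequentially. cycle_class J k n \<noteq> {} \<longrightarrow>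
      pr (cycle_class J k n) (nat \<lfloor>t * real n\<rfloor>) [] (\<lambda>zs. (\<forall>v\<in>{1..n}. real (card (component zs v)) \<le> \<epsilon> * real n) \<and>
        real (card {v\<in>{1..n}. l \<le> card (component zs v)}) < h / 4 * real n) \<le> \<delta>"
    proof (intro exI[of _ \<epsilon>] conjI allI impI)
      show "0 < \<epsilon>" by (rule \<epsilon>)
      fix \<delta> :: real assume \<delta>: "0 < \<delta>"
      have ev1: "\<forall>\<^sub>F n in sequentially. c / (real n * e) < h - h'"
      proof -
        have "(\<lambda>n. c / e * (1 / real n)) \<longlonglongrightarrow> 0" by (rule tendsto_mult_right_zero) real_asymp
        then have "(\<lambda>n. c / (real n * e)) \<longlonglongrightarrow> 0" by (simp add: mult.commute)
        then show ?thesis using par by (intro order_tendstoD(2)) auto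
      qed
      have ev2: "\<forall>\<^sub>F n in sequentially. c * real l * (1 / real n) < h / 4"
      proof -
        have "(\<lambda>n. c * real l * (1 / real n)) \<longlonglongrightarrow> 0" by (rule tendsto_mult_right_zero) real_asymp
        then show ?thesis using par by (intro order_tendstoD(2)) auto
      qed
      have ev3: "\<forall>\<^sub>F n in sequentially. exp (- (\<theta> * D / 2) * real n) < \<delta>"
      proof -
        have "0 < \<theta> * D / 2" using \<theta> D by simp
        moreover have "(\<lambda>n. exp (- x * real n)) \<longlonglongrightarrow> 0" if "0 < x" for x :: real
          using that by real_asymp
        ultimately have "(\<lambda>n. exp (- (\<theta> * D / 2) * real n)) \<longlonglongrightarrow> 0" by blast
        then show ?thesis using \<delta> by (intro order_tendstoD(2)) auto
      qed
      show "\<forall>\<^sub>F n in sequentially. cycle_class J k n \<noteq> {} \<longrightarrow>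
        pr (cycle_class J k n) (nat \<lfloor>t * real n\<rfloor>) [] (\<lambda>zs. (\<forall>v\<in>{1..n}. real (card (component zs v)) \<le> \<epsilon> * real n) \<and>
        real (card {v\<in>{1..n}. l \<le> card (component zs v)}) < h / 4 * real n) \<le> \<delta>"
        using ev1 ev2 ev3 eventually_ge_at_top[of 1]
      proof eventually_elim
        case (elim n)
        define m where "m = nat \<lfloor>t * real n\<rfloor>"
        have n0: "0 < real n" using elim by simp
        have m: "real m \<le> t * real n" "t * real n - 1 \<le> real m" using t n0 by (auto simp: m_def of_nat_nat)
        define x where "x = a - c * real m / real n"
        have x0: "0 \<le> x" and x_le: "x \<le> e + c / real n"
        proof -
          have "c * real m \<le> c * (t * real n)" using m c by (intro mult_left_mono) auto
          then have "c * real m / real n \<le> c * t" using n0 by (simp add: pos_divide_le_eq ac_simps)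
          then show "0 \<le> x" using c e by (simp add: x_def)
          have "c * (t * real n - 1) \<le> c * real m" using m c by (intro mult_left_mono) auto
          then have "(c * (t * real n - 1)) / real n \<le> c * real m / real n" using n0 by (intro divide_right_mono) auto
          also have "(c * (t * real n - 1)) / real n = c * t - c / real n" using n0 by (simp add: field_simps)
          finally show "x \<le> e + c / real n" using c by (simp add: x_def)
        qed
        show ?case
        proof
          assume ne: "cycle_class J k n \<noteq> {}"
          have "pr (cycle_class J k n) m [] (\<lambda>zs. (\<forall>v\<in>{1..n}. real (card (component zs v)) \<le> \<epsilon> * real n) \<and>
              real (card {v\<in>{1..n}. l \<le> card (component zs v)}) < h / 4 * real n)
            \<le> pr (cycle_class J k n) m [] (\<lambda>zs. (\<forall>v\<in>{1..n}. real (card (component zs v)) \<le> \<epsilon> * real n) \<and>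
              avg {1..n} (\<lambda>v. 1 - exp (- (a - c * real m / real n) * real (card (component zs v)))) \<le> h)"
          proof (rule pr_mono, elim conjE, intro conjI)
            fix ys assume few: "real (card {v\<in>{1..n}. l \<le> card (component ([] @ ys) v)}) < h / 4 * real n"
            define s where "s = (\<lambda>v. card (component ys v))"
            have "1 - exp (- x * real (s v)) \<le> of_bool (l \<le> s v) + x * real l" for v
            proof (cases "l \<le> s v")
              case True
              moreover have "0 \<le> x * real l" using x0 by simp
              moreover have "0 \<le> exp (- x * real (s v))" by simp
              ultimately show ?thesis by (simp only: of_bool_eq)
            next
              case False
              have "1 - exp (- x * real (s v)) \<le> x * real (s v)"
                using exp_ge_add_one_self[of "- x * real (s v)"] by linarith
              also have "\<dots> \<le> x * real l" using x0 False by (intro mult_left_mono) auto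
              finally show ?thesis using False by simp
            qed
            then have "avg {1..n} (\<lambda>v. 1 - exp (- x * real (s v))) \<le> avg {1..n} (\<lambda>v. of_bool (l \<le> s v) + x * real l)"
              by (intro avg_mono) auto
            also have "\<dots> = real (card {v\<in>{1..n}. l \<le> s v}) / real n + x * real l"
              using elim(4) by (simp add: avg_add, simp add: avg_def Int_def)
            also have "\<dots> \<le> h / 4 + (e + c / real n) * real l"
              using few n0 x_le by (intro add_mono mult_right_mono) (auto simp: s_def divide_le_eq)
            also have "\<dots> \<le> h / 4 + h / 2 + h / 4"
            proof -
              have "e * real l = h / 2" using l by (simp add: e_def)
              moreover have "(e + c / real n) * real l = e * real l + c * real l * (1 / real n)"
                by (simp add: distrib_right)
              ultimately show ?thesis using elim(2) by linarith
            qed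
            also have "\<dots> = h" by simp
            finally show "avg {1..n} (\<lambda>v. 1 - exp (- (a - c * real m / real n) * real (card (component ([] @ ys) v)))) \<le> h"
              by (simp add: x_def s_def)
          qed simp
          also have "\<dots> \<le> exp (- (\<theta> * real n) * (1 - exp (- a) - h) * 1 + real m * ((\<theta> * real n)\<^sup>2 * ((real L + c) / (e * real n))\<^sup>2))"
            using elim \<theta> \<epsilon> c e ne m by (intro supercritical_mass_bound[where h' = h' and t = t]) (auto simp: CJ_def)
          also have "\<dots> \<le> exp (- (\<theta> * D / 2) * real n)"
          proof -
            have "(\<theta> * real n)\<^sup>2 * ((real L + c) / (e * real n))\<^sup>2 = \<theta>\<^sup>2 * CJ\<^sup>2"
              using n0 by (simp add: CJ_def power_mult_distrib power_divide)
            then have "real m * ((\<theta> * real n)\<^sup>2 * ((real L + c) / (e * real n))\<^sup>2) \<le> (t * real n) * (\<theta>\<^sup>2 * CJ\<^sup>2)"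
              using m by (simp only:) (intro mult_right_mono, auto)
            also have "\<dots> = real n * (t * (\<theta>\<^sup>2 * CJ\<^sup>2))" by simp
            also have "\<dots> \<le> real n * (\<theta> * D / 2)" using \<theta>(3) by (intro mult_left_mono) auto
            finally have "- (\<theta> * real n) * D * 1 + real m * ((\<theta> * real n)\<^sup>2 * ((real L + c) / (e * real n))\<^sup>2) \<le> - (\<theta> * D / 2) * real n"
              by (simp add: algebra_simps)
            then show ?thesis by (simp add: D_def)
          qed
          finally show "pr (cycle_class J k n) (nat \<lfloor>t * real n\<rfloor>) [] (\<lambda>zs. (\<forall>v\<in>{1..n}. real (card (component zs v)) \<le> \<epsilon> * real n) \<and>
             real (card {v\<in>{1..n}. l \<le> card (component zs v)}) < h / 4 * real n) \<le> \<delta>"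
            using elim(3) by (simp add: m_def)
        qed
      qed
    qed
  qed
qed

section \<open>Sprinkling: joining large components to a giant one\<close>

lemma sum_split_between:
  fixes w :: "'a \<Rightarrow> real"
  assumes "finite I" "\<And>i. i \<in> I \<Longrightarrow> w i \<le> q" "q \<le> sum w I" "0 \<le> q"
  shows "\<exists>K\<subseteq>I. q \<le> sum w K \<and> sum w K \<le> 2 * q"
  using assms
proof (induction I rule: finite_induct)
  case empty
  then show ?case by auto
next
  case (insert i I)
  show ?case
  proof (cases "q \<le> sum w I")
    case True
    then show ?thesis using insert by (metis insertCI subset_insertI2)
  next
    case False
    then have "sum w (insert i I) \<le> 2 * q" using insert.prems(1)[of i] insert.hyps by simp
    then show ?thesis using insert.prems by (intro exI[of _ "insert i I"]) auto
  qed
qed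

context perm_class begin

lemma finite_component: "set zs \<subseteq> \<Gamma> \<Longrightarrow> v \<in> V \<Longrightarrow> finite (component zs v)"
  using component_subset_carrier[of zs V v] \<Gamma>_permutes finite_subset[OF _ finV] by blast

lemma component_in_V: "set zs \<subseteq> \<Gamma> \<Longrightarrow> v \<in> V \<Longrightarrow> component zs v \<subseteq> V"
  using component_subset_carrier[of zs V v] \<Gamma>_permutes by blast

text \<open>If no component exceeds \<open>p / 3 * n\<close>, the new components can be grouped so
  that they cut \<open>U\<close> into two parts of size at least \<open>p / 3 * n\<close> that no
  sprinkled step joins. A fixed cut survives a step with probability at most
  \<open>1 - p\<^sup>2 / 9\<close>; the union bound over all cuts is affordable because the old
  classes in \<open>U\<close> have size at least \<open>l\<close>.\<close>

lemma sprinkling: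
  fixes p :: real and l r :: nat
  assumes L: "0 < L" and xs: "set xs \<subseteq> \<Gamma>" and l: "1 \<le> l" and p: "0 < p"
  defines "U \<equiv> {v\<in>V. l \<le> card (component xs v)}"
  assumes U: "p * real n \<le> real (card U)"
  shows "pr \<Gamma> r xs (\<lambda>zs. \<forall>v\<in>V. real (card (component zs v)) \<le> p / 3 * real n) \<le> 2 ^ (n div l) * (1 - p\<^sup>2 / 9) ^ r"
proof -
  define q where "q = p / 3 * real n"
  have q0: "0 < q" using p n_pos by (simp add: q_def)
  have UV: "U \<subseteq> V" by (auto simp: U_def)
  have finU: "finite U" using UV finV finite_subset by blast
  have U_closed: "component xs v \<subseteq> U" if "v \<in> U" for v
  proof
    fix w assume w: "w \<in> component xs v"
    then have "component xs w = component xs v" by (rule component_eq)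
    then show "w \<in> U" using that w component_in_V[OF xs, of v] by (auto simp: U_def)
  qed
  define \<C> where "\<C> = component xs ` U"
  have fin\<C>: "finite \<C>" using finU by (simp add: \<C>_def)
  have "card \<C> * l \<le> n"
  proof -
    have "card \<C> * l = (\<Sum>C\<in>\<C>. l)" by simp
    also have "\<dots> \<le> (\<Sum>C\<in>\<C>. card C)" by (intro sum_mono) (auto simp: \<C>_def U_def)
    also have "\<dots> = card (\<Union>\<C>)"
    proof (rule card_Union_disjoint[symmetric])
      show "pairwise disjnt \<C>"
      proof (rule pairwiseI)
        fix C D assume CD: "C \<in> \<C>" "D \<in> \<C>" "C \<noteq> D"
        then obtain v w where "C = component xs v" "D = component xs w" by (auto simp: \<C>_def)
        then show "disjnt C D" using CD(3) component_disjoint unfolding disjnt_def by simp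
      qed
      show "finite C" if "C \<in> \<C>" for C using that finite_component[OF xs] by (auto simp: \<C>_def U_def)
    qed
    also have "\<dots> \<le> n" using U_closed UV finV by (intro card_mono) (auto simp: \<C>_def)
    finally show ?thesis .
  qed
  then have card\<C>: "card \<C> \<le> n div l" using l by (simp add: less_eq_div_iff_mult_less_eq)
  \<comment> \<open>Candidate cuts of \<open>U\<close> into two large parts respecting the old
    components. As there are at most \<open>n div l\<close> classes, there are at most
    \<open>2 ^ (n div l)\<close> cuts.\<close>
  define Fam where "Fam = {T \<in> Union ` Pow \<C>. q \<le> real (card T) \<and> q \<le> real (card (U - T))}"
  have finFam: "finite Fam" using fin\<C> by (simp add: Fam_def)
  have "card Fam \<le> card (Union ` Pow \<C>)" using fin\<C> by (intro card_mono) (auto simp: Fam_def)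
  also have "\<dots> \<le> card (Pow \<C>)" using fin\<C> by (intro card_image_le) simp
  also have "\<dots> = 2 ^ card \<C>" using fin\<C> by (rule card_Pow)
  also have "\<dots> \<le> 2 ^ (n div l)" using card\<C> by (intro power_increasing) auto
  finally have cardFam: "real (card Fam) \<le> 2 ^ (n div l)"
    by (metis of_nat_le_iff of_nat_numeral of_nat_power)
  define nocross where "nocross = (\<lambda>T g. \<not> (\<exists>x. g x \<noteq> x \<and> x \<in> T \<and> g x \<in> U - T))"
  have one: "pr \<Gamma> r [] (\<lambda>ys. \<forall>g\<in>set ys. nocross T g) \<le> (1 - p\<^sup>2 / 9) ^ r" if T: "T \<in> Fam" for T
  proof (rule pr_all_le[OF finite_\<Gamma> \<Gamma>_nonempty])
    have "\<Union>\<C> \<subseteq> U" using U_closed by (auto simp: \<C>_def)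
    then have TV: "T \<subseteq> V" using T UV unfolding Fam_def by blast
    have "(real (card T) * real (card (U - T)) - real (card (T \<inter> (U - T)))) / real n ^ 2
      \<le> avg \<Gamma> (\<lambda>g. of_bool (\<exists>x. g x \<noteq> x \<and> x \<in> T \<and> g x \<in> U - T))"
      using TV UV by (intro avg_pair_ge L) auto
    moreover have "p\<^sup>2 / 9 \<le> (real (card T) * real (card (U - T)) - real (card (T \<inter> (U - T)))) / real n ^ 2"
    proof -
      have "q * q \<le> real (card T) * real (card (U - T))"
        using T q0 by (intro mult_mono) (auto simp: Fam_def)
      then have "(p\<^sup>2 / 9) * real n ^ 2 \<le> real (card T) * real (card (U - T))"
        by (simp add: q_def power2_eq_square ac_simps)
      then show ?thesis using n_pos by (simp add: pos_le_divide_eq Int_Diff)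
    qed
    moreover have "avg \<Gamma> (\<lambda>g. of_bool (nocross T g)) = avg \<Gamma> (\<lambda>g. 1 - of_bool (\<exists>x. g x \<noteq> x \<and> x \<in> T \<and> g x \<in> U - T))"
      unfolding nocross_def by (simp only: of_bool_not_iff)
    then have "avg \<Gamma> (\<lambda>g. of_bool (nocross T g)) = 1 - avg \<Gamma> (\<lambda>g. of_bool (\<exists>x. g x \<noteq> x \<and> x \<in> T \<and> g x \<in> U - T))"
      using finite_\<Gamma> \<Gamma>_nonempty by (simp add: avg_diff)
    ultimately show "avg \<Gamma> (\<lambda>g. of_bool (nocross T g)) \<le> 1 - p\<^sup>2 / 9" by linarith
  qed
  have "pr \<Gamma> r xs (\<lambda>zs. \<forall>v\<in>V. real (card (component zs v)) \<le> q)
      = pr \<Gamma> r [] (\<lambda>ys. \<forall>v\<in>V. real (card (component (xs @ ys) v)) \<le> q)"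
    using pr_shift[of \<Gamma> r xs "[]"] by simp
  also have "\<dots> \<le> pr \<Gamma> r [] (\<lambda>ys. \<exists>T\<in>Fam. \<forall>g\<in>set ys. nocross T g)"
  proof (rule pr_mono)
    fix ys assume ys: "set ys \<subseteq> \<Gamma>" and small: "\<forall>v\<in>V. real (card (component (xs @ [] @ ys) v)) \<le> q"
    define new where "new = component (xs @ ys)"
    have zs: "set (xs @ ys) \<subseteq> \<Gamma>" using xs ys by simp
    define I where "I = new ` U"
    have finI: "finite I" using finU by (simp add: I_def)
    have dis: "C \<inter> D = {}" if "C \<in> I" "D \<in> I" "C \<noteq> D" for C D
    proof -
      from that obtain v w where "C = component (xs @ ys) v" "D = component (xs @ ys) w" by (auto simp: I_def new_def)
      then show ?thesis using that(3) component_disjoint by simp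
    qed
    have card_Union: "real (card (\<Union>C\<in>K. U \<inter> C)) = (\<Sum>C\<in>K. real (card (U \<inter> C)))" if "K \<subseteq> I" for K
    proof -
      have "card (\<Union>C\<in>K. U \<inter> C) = (\<Sum>C\<in>K. card (U \<inter> C))"
      proof (rule card_UN_disjoint)
        show "finite K" using that finI finite_subset by blast
        show "\<forall>C\<in>K. finite (U \<inter> C)" using finU by simp
        show "\<forall>C\<in>K. \<forall>D\<in>K. C \<noteq> D \<longrightarrow> U \<inter> C \<inter> (U \<inter> D) = {}"
        proof (intro ballI impI)
          fix C D assume "C \<in> K" "D \<in> K" "C \<noteq> D"
          then have "C \<inter> D = {}" using that by (intro dis) auto
          then show "U \<inter> C \<inter> (U \<inter> D) = {}" by blast
        qed
      qed
      then show ?thesis by simp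
    qed
    have total: "(\<Union>C\<in>I. U \<inter> C) = U" by (auto simp: I_def new_def)
    have w_le: "real (card (U \<inter> C)) \<le> q" if "C \<in> I" for C
    proof -
      from that obtain v where v: "v \<in> V" "C = new v" using UV by (auto simp: I_def)
      have "card (U \<inter> C) \<le> card C"
        using finite_component[OF zs v(1)] by (intro card_mono) (auto simp: v new_def)
      also have "real (card C) \<le> q" using small v by (simp add: new_def)
      finally show ?thesis by simp
    qed
    have sumI: "3 * q \<le> (\<Sum>C\<in>I. real (card (U \<inter> C)))"
      using U card_Union[of I] total by (simp add: q_def)
    \<comment> \<open>The pieces of \<open>U\<close> have size at most \<open>q\<close> and total at
      least \<open>3 * q\<close>, so some of them make up between \<open>q\<close> and
      \<open>2 * q\<close>, and at least \<open>q\<close> remains outside.\<close>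
    then obtain K where K: "K \<subseteq> I" "q \<le> (\<Sum>C\<in>K. real (card (U \<inter> C)))" "(\<Sum>C\<in>K. real (card (U \<inter> C))) \<le> 2 * q"
      using sum_split_between[OF finI, of "\<lambda>C. real (card (U \<inter> C))" q] w_le q0 by force
    define T where "T = (\<Union>C\<in>K. U \<inter> C)"
    have TU: "T \<subseteq> U" by (auto simp: T_def)
    have cT: "q \<le> real (card T)" "real (card T) \<le> 2 * q" using K card_Union[OF K(1)] by (simp_all add: T_def)
    have "real (card (U - T)) = real (card U) - real (card T)"
      using TU finU by (simp add: card_Diff_subset finite_subset card_mono of_nat_diff)
    then have cUT: "q \<le> real (card (U - T))" using cT U by (simp add: q_def)
    have K_new: "new x \<in> K" if x: "x \<in> T" for x
    proof -
      from x obtain C where C: "C \<in> K" "x \<in> C" by (auto simp: T_def)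
      then obtain v where "C = new v" using K by (auto simp: I_def)
      then have "new x = C" using C(2) component_eq by (simp add: new_def)
      then show ?thesis using C by simp
    qed
    have T_closed: "component xs x \<subseteq> T" if x: "x \<in> T" for x
    proof -
      have "component xs x \<subseteq> new x" unfolding new_def by (rule component_mono) auto
      then have "component xs x \<subseteq> U \<inter> new x" using U_closed TU x by blast
      then show ?thesis using K_new[OF x] by (auto simp: T_def)
    qed
    have "T = \<Union>(component xs ` T)"
    proof
      show "T \<subseteq> \<Union> (component xs ` T)"
      proof
        fix x assume "x \<in> T"
        then show "x \<in> \<Union> (component xs ` T)" by (rule UN_I) simp
      qed
      show "\<Union> (component xs ` T) \<subseteq> T" using T_closed by (rule UN_least)
    qed
    moreover have "component xs ` T \<in> Pow \<C>" using TU by (auto simp: \<C>_def)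
    ultimately have "T \<in> Union ` Pow \<C>" by blast
    then have "T \<in> Fam" using cT cUT by (simp add: Fam_def)
    moreover have "nocross T g" if g: "g \<in> set ys" for g
      unfolding nocross_def
    proof
      assume "\<exists>x. g x \<noteq> x \<and> x \<in> T \<and> g x \<in> U - T"
      then obtain x where x: "x \<in> T" "g x \<in> U - T" by auto
      have "g x \<in> new x" unfolding new_def using g by (intro component_step) simp
      then have "g x \<in> T" using K_new[OF x(1)] x(2) by (auto simp: T_def)
      then show False using x by simp
    qed
    ultimately show "\<exists>T\<in>Fam. \<forall>g\<in>set ([] @ ys). nocross T g" by auto
  qed
  also have "\<dots> \<le> (\<Sum>T\<in>Fam. pr \<Gamma> r [] (\<lambda>ys. \<forall>g\<in>set ys. nocross T g))"
    by (rule pr_finite_union[OF finFam])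
  also have "\<dots> \<le> (\<Sum>T\<in>Fam. (1 - p\<^sup>2 / 9) ^ r)" by (intro sum_mono one)
  also have "\<dots> \<le> 2 ^ (n div l) * (1 - p\<^sup>2 / 9) ^ r"
  proof (cases "Fam = {}")
    case True
    have "p * real n \<le> real n" using U UV card_mono[OF finV UV] by linarith
    then have "p \<le> 1" using n_pos by simp
    then have "p\<^sup>2 \<le> 1" using p by (simp add: power_le_one)
    then show ?thesis using True by simp
  next
    case False
    then obtain T where "T \<in> Fam" by auto
    have "0 \<le> (1 - p\<^sup>2 / 9) ^ r" using one[OF \<open>T \<in> Fam\<close>] pr_nonneg order_trans by blast
    then show ?thesis using cardFam by (simp add: mult_right_mono)
  qed
  finally show ?thesis by (simp add: q_def)
qed

section \<open>Redundant transpositions and collisions\<close>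

definition excess :: "'a set \<Rightarrow> ('a \<Rightarrow> 'a) list \<Rightarrow> nat" where
  "excess A ys = length (filter (\<lambda>g. \<exists>x. g x \<noteq> x \<and> x \<in> A \<and> g x \<in> A) ys)"

text \<open>\<open>q = \<theta>\<^sup>2 / 2\<close> bounds the probability of a counted step from
  below, where \<open>\<theta> * n \<ge> 2\<close> absorbs the pairs on the diagonal. Falling below
  half of the mean bound, with parameter \<open>q / 4\<close> in \<open>pr_drift\<close>, has
  exponent \<open>q\<^sup>2 / 16\<close>.\<close>

lemma excess_bound:
  fixes \<theta> :: real
  assumes L: "0 < L" and A: "A \<subseteq> V" "\<theta> * real n \<le> real (card A)" and \<theta>: "0 < \<theta>" "2 \<le> \<theta> * real n"
  shows "pr \<Gamma> r [] (\<lambda>ys. real (excess A ys) \<le> \<theta>\<^sup>2 / 4 * real r) \<le> exp (- (\<theta> ^ 4 / 64) * real r)"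
proof -
  define q where "q = \<theta>\<^sup>2 / 2"
  define b where "b = (\<lambda>g. of_bool (\<exists>x. g x \<noteq> x \<and> x \<in> A \<and> g x \<in> A) :: real)"
  have cA: "card A \<le> n" using A finV by (intro card_mono)
  have "\<theta> \<le> 1"
  proof -
    have "\<theta> * real n \<le> 1 * real n" using A cA by linarith
    then show ?thesis using n_pos by simp
  qed
  then have q: "0 < q" "q \<le> 1" using \<theta> by (auto simp: q_def power_le_one intro: order_trans[of _ 1])
  have "q \<le> (real (card A) * real (card A) - real (card (A \<inter> A))) / real n ^ 2"
  proof -
    have "\<theta> * real n * (\<theta> * real n - 1) \<le> real (card A) * (real (card A) - 1)"
      using A \<theta> by (intro mult_mono) auto
    moreover have "q * real n ^ 2 \<le> \<theta> * real n * (\<theta> * real n - 1)"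
    proof -
      have "2 * (\<theta> * real n) \<le> (\<theta> * real n) * (\<theta> * real n)" using \<theta> by (intro mult_right_mono) auto
      then show ?thesis by (simp add: q_def power2_eq_square algebra_simps)
    qed
    ultimately have "q * real n ^ 2 \<le> real (card A) * real (card A) - real (card A)"
      by (simp add: right_diff_distrib)
    then show ?thesis using n_pos by (simp add: pos_le_divide_eq)
  qed
  also have "\<dots> \<le> avg \<Gamma> b" unfolding b_def by (rule avg_pair_ge[OF L A(1) A(1)])
  finally have avg_b: "q \<le> avg \<Gamma> b" .
  define X where "X = (\<lambda>ys. q * real (length ys) - real (excess A ys))"
  have X_app: "X (ys @ [g]) = X ys + (q - b g)" for ys g
    by (simp add: X_def excess_def b_def distrib_left)
  have "pr \<Gamma> r [] (\<lambda>ys. real (excess A ys) \<le> \<theta>\<^sup>2 / 4 * real r)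
     \<le> pr \<Gamma> r [] (\<lambda>zs. \<exists>j\<le>r. (\<forall>i<j. True) \<and> q * real r / 2 \<le> X (take j zs))"
    by (intro pr_mono exI[of _ r]) (auto simp: X_def q_def mult.commute)
  also have "\<dots> \<le> exp (- (q / 4) * (q * real r / 2 - X []) + real r * (q / 4 * 0 + (q / 4)\<^sup>2 * 1\<^sup>2))"
  proof (rule pr_drift[OF finite_\<Gamma> \<Gamma>_nonempty])
    fix zs
    show "avg \<Gamma> (\<lambda>g. X (zs @ [g])) \<le> X zs + 0"
      using avg_b finite_\<Gamma> \<Gamma>_nonempty by (simp add: X_app avg_add avg_diff)
    show "\<bar>X (zs @ [g]) - X zs\<bar> \<le> 1" for g using q by (simp add: X_app b_def)
  qed (use q in auto)
  also have "\<dots> = exp (- (\<theta> ^ 4 / 64) * real r)"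
    by (simp add: X_def excess_def q_def power2_eq_square power4_eq_xxxx algebra_simps)
  finally show ?thesis .
qed

text \<open>\<open>merges\<close> counts the transpositions needed to write the permutations of the list: each of them
  merges two components at best, and each step merges all its cycles if it hits distinct cycles.\<close>

definition merges :: "('a \<Rightarrow> 'a) list \<Rightarrow> nat" where
  "merges ys = (\<Sum>g\<leftarrow>ys. L - card (orbit g ` {y. g y \<noteq> y}))"

lemma merges_append: "merges (ys @ [g]) = merges ys + (L - card (orbit g ` {y. g y \<noteq> y}))"
  by (simp add: merges_def)

lemma card_orbits_le_L: "g \<in> \<Gamma> \<Longrightarrow> card (orbit g ` {y. g y \<noteq> y}) \<le> L"
  using card_image_le[OF finite_support, of g "orbit g"] card_support[of g] by simp

text \<open>Every transposition lowers the number of components by at most one. A step counted by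
  \<open>excess\<close> has a moved pair \<open>x\<close>, \<open>g x\<close> that already lies in
  one component, and the transposition joining this pair lowers the number by none.\<close>

lemma components_merges:
  assumes "0 < L" "set (xs @ ys) \<subseteq> \<Gamma>" "v \<in> V"
  shows "card (component xs ` V) + excess (component xs v) ys \<le> card (component (xs @ ys) ` V) + merges ys"
  using assms(2)
proof (induction ys rule: rev_induct)
  case Nil
  then show ?case by (simp add: excess_def merges_def)
next
  case (snoc g ys)
  have g: "g \<in> \<Gamma>" using snoc.prems by simp
  have IH: "card (component xs ` V) + excess (component xs v) ys \<le> card (component (xs @ ys) ` V) + merges ys"
    using snoc by simp
  have "{y. g y \<noteq> y} \<noteq> {}" using card_support[OF g] assms(1) by (metis card.empty less_irrefl)
  then obtain x0 where x0: "g x0 \<noteq> x0" by auto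
  define b where "b = (\<exists>x. g x \<noteq> x \<and> x \<in> component xs v \<and> g x \<in> component xs v)"
  obtain x where x: "g x \<noteq> x" "b \<Longrightarrow> x \<in> component xs v \<and> g x \<in> component xs v"
    using x0 unfolding b_def by blast
  have "of_bool b \<le> (of_bool (g x \<in> component (xs @ ys) x) :: nat)"
  proof (cases b)
    case True
    then have "x \<in> component xs v" "g x \<in> component xs v" using x by auto
    then have "g x \<in> component xs x" using component_sym component_trans by metis
    then have "g x \<in> component (xs @ ys) x" using component_mono[of xs "xs @ ys" x] by auto
    then show ?thesis by simp
  qed simp
  moreover have "card (component (xs @ ys) ` V) + card (orbit g ` {y. g y \<noteq> y}) + of_bool (g x \<in> component (xs @ ys) x)
    \<le> card (component ((xs @ ys) @ [g]) ` V) + card {y. g y \<noteq> y}"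
    by (rule card_components_append[OF finV \<Gamma>_permutes[OF g] x(1)])
  moreover have "excess (component xs v) (ys @ [g]) = excess (component xs v) ys + of_bool b"
    by (simp add: excess_def b_def)
  moreover have "merges (ys @ [g]) + card (orbit g ` {y. g y \<noteq> y}) = merges ys + L"
    using card_orbits_le_L[OF g] by (simp add: merges_append)
  ultimately show ?case
    using IH card_support[OF g] unfolding append_assoc by linarith
qed

text \<open>Steps that meet some cycle of the current product in two of their moved points; only
  these can fail to join distinct cycles.\<close>

definition collisions :: "('a \<Rightarrow> 'a) list \<Rightarrow> nat" where
  "collisions zs = card {i. i < length zs \<and> \<not> inj_on (orbit (perm_product (take i zs))) {y. (zs ! i) y \<noteq> y}}"

lemma collisions_append:
  "collisions (zs @ [g]) = collisions zs + of_bool (\<not> inj_on (orbit (perm_product zs)) {y. g y \<noteq> y})"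
proof -
  let ?P = "\<lambda>zs i. \<not> inj_on (orbit (perm_product (take i zs))) {y. (zs ! i) y \<noteq> y}"
  have "{i. i < length (zs @ [g]) \<and> ?P (zs @ [g]) i} =
      {i. i < length zs \<and> ?P zs i} \<union> (if \<not> inj_on (orbit (perm_product zs)) {y. g y \<noteq> y} then {length zs} else {})"
    by (auto simp: less_Suc_eq nth_append)
  then show ?thesis by (simp add: collisions_def)
qed

text \<open>Without a collision the number of cycles drops by at least what \<open>merges\<close>
  gains. A collision adds at most \<open>L\<close> cycles and at most \<open>L\<close> to
  \<open>merges\<close>, hence the factor \<open>2 * L\<close>.\<close>

lemma orbits_merges:
  assumes "set zs \<subseteq> \<Gamma>"
  shows "card (orbit (perm_product zs) ` V) + merges zs \<le> n + 2 * L * collisions zs"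
  using assms
proof (induction zs rule: rev_induct)
  case Nil
  have "card (orbit (perm_product []) ` V) \<le> n" using finV by (rule card_image_le)
  moreover have "merges [] = 0" "collisions [] = 0" by (simp_all add: merges_def collisions_def)
  ultimately show ?case by linarith
next
  case (snoc g zs)
  have g: "g \<in> \<Gamma>" using snoc.prems by simp
  have perm: "perm_product zs permutes V" using snoc.prems \<Gamma>_permutes by (intro perm_product_permutes) auto
  have IH: "card (orbit (perm_product zs) ` V) + merges zs \<le> n + 2 * L * collisions zs" using snoc by simp
  show ?case
  proof (cases "inj_on (orbit (perm_product zs)) {y. g y \<noteq> y}")
    case True
    then show ?thesis
      using card_orbits_comp_joined[OF finV perm \<Gamma>_permutes[OF g] perm_product_append True] IH
        card_support[OF g] card_orbits_le_L[OF g]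
      by (simp add: merges_append collisions_append)
  next
    case False
    then show ?thesis
      using card_orbits_comp_le[OF finV perm \<Gamma>_permutes[OF g] perm_product_append] IH card_support[OF g]
      by (simp add: merges_append collisions_append)
  qed
qed

text \<open>While all cycles have size at most \<open>\<delta> * n\<close>, a step collides with
  probability at most \<open>2 * real L ^ 2 * \<delta> \<le> b\<close>, where 2 bounds
  \<open>inj_ratio\<close>. The threshold is twice the resulting bound on the mean.\<close>

lemma collisions_bound:
  fixes \<delta> b :: real
  assumes \<delta>: "0 \<le> \<delta>" and b: "2 * real L ^ 2 * \<delta> \<le> b" "0 < b" "b \<le> 1" and ratio: "inj_ratio n L \<le> 2"
  shows "pr \<Gamma> m [] (\<lambda>zs. (\<forall>i<m. \<forall>v\<in>V. real (card (orbit (perm_product (take i zs)) v)) \<le> \<delta> * real n) \<and>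
      2 * b * real m \<le> real (collisions zs)) \<le> exp (- (b\<^sup>2 / 4) * real m)"
proof -
  define Good where "Good = (\<lambda>zs. \<forall>v\<in>V. real (card (orbit (perm_product zs) v)) \<le> \<delta> * real n)"
  define X where "X = (\<lambda>zs. real (collisions zs) - b * real (length zs))"
  define c where "c = (\<lambda>(zs :: ('a \<Rightarrow> 'a) list) g. of_bool (\<not> inj_on (orbit (perm_product zs)) {y. g y \<noteq> y}) :: real)"
  have X_app: "X (zs @ [g]) = X zs + (c zs g - b)" for zs g
    by (simp add: X_def c_def collisions_append distrib_left)
  have avg_c: "avg \<Gamma> (c zs) \<le> b" if zs: "set zs \<subseteq> \<Gamma>" "Good zs" for zs
  proof -
    have perm: "perm_product zs permutes V" using zs \<Gamma>_permutes by (intro perm_product_permutes) auto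
    have "avg \<Gamma> (c zs) \<le> inj_ratio n L * (real L ^ 2 * (\<delta> * real n / real n))"
      unfolding c_def
    proof (rule avg_support_collision_le)
      fix v assume v: "v \<in> V"
      have "{u \<in> V. orbit (perm_product zs) v = orbit (perm_product zs) u} \<subseteq> orbit (perm_product zs) v"
        using self_in_orbit[OF finV perm] by blast
      moreover have "finite (orbit (perm_product zs) v)"
        using orbit_subset_carrier[OF perm v] finV finite_subset by blast
      ultimately have "card {u \<in> V. orbit (perm_product zs) v = orbit (perm_product zs) u} \<le> card (orbit (perm_product zs) v)"
        by (rule card_mono[rotated])
      then show "real (card {u \<in> V. orbit (perm_product zs) v = orbit (perm_product zs) u}) \<le> \<delta> * real n"
        using zs(2) v unfolding Good_def by (meson of_nat_le_iff order_trans)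
    qed (use \<delta> in simp)
    also have "\<dots> \<le> 2 * (real L ^ 2 * (\<delta> * real n / real n))"
      using ratio \<delta> by (intro mult_right_mono) auto
    also have "\<dots> \<le> b" using b n_pos by simp
    finally show ?thesis .
  qed
  have "pr \<Gamma> m [] (\<lambda>zs. (\<forall>i<m. \<forall>v\<in>V. real (card (orbit (perm_product (take i zs)) v)) \<le> \<delta> * real n) \<and>
      2 * b * real m \<le> real (collisions zs))
    \<le> pr \<Gamma> m [] (\<lambda>zs. \<exists>j\<le>m. (\<forall>i<j. Good (take i zs)) \<and> b * real m \<le> X (take j zs))"
    by (intro pr_mono exI[of _ m]) (auto simp: X_def Good_def)
  also have "\<dots> \<le> exp (- (b / 2) * (b * real m - X []) + real m * (b / 2 * 0 + (b / 2)\<^sup>2 * 1\<^sup>2))"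
  proof (rule pr_drift[OF finite_\<Gamma> \<Gamma>_nonempty])
    fix zs assume "set zs \<subseteq> \<Gamma>" "Good zs"
    then show "avg \<Gamma> (\<lambda>g. X (zs @ [g])) \<le> X zs + 0"
      using avg_c[of zs] finite_\<Gamma> \<Gamma>_nonempty by (simp add: X_app avg_add avg_diff)
    show "\<bar>X (zs @ [g]) - X zs\<bar> \<le> 1" for g using b by (simp add: X_app c_def)
  qed (use b in auto)
  also have "\<dots> = exp (- (b\<^sup>2 / 4) * real m)"
    by (simp add: X_def collisions_def power2_eq_square algebra_simps)
  finally show ?thesis .
qed

end

section \<open>A large cycle above the critical time\<close>

lemma eventually_exp_neg_less:
  fixes x \<delta> C :: real
  assumes "0 < x" "0 < \<delta>"
  shows "\<forall>\<^sub>F n in sequentially. C * exp (- x * real n) < \<delta>"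
proof -
  have "(\<lambda>n. exp (- x * real n)) \<longlonglongrightarrow> 0" using assms(1) by real_asymp
  then have "(\<lambda>n. C * exp (- x * real n)) \<longlonglongrightarrow> 0" by (rule tendsto_mult_right_zero)
  then show ?thesis using assms(2) by (rule order_tendstoD(2))
qed

text \<open>As there are never more components than cycles, comparing the two counts bounds
  \<open>excess\<close> by \<open>2 * L * collisions\<close>. A giant component makes
  \<open>excess\<close> linear in \<open>n\<close> during the last phase, whereas cycles of size at
  most \<open>\<delta> * n\<close> would keep the collisions below that for a small enough
  \<open>\<delta>\<close>.\<close>

lemma (in cycle_type) supercritical_cycles:
  assumes t: "0 < t" "1 < \<kappa> * t"
  obtains \<delta> :: real where "0 < \<delta>" "\<And>\<eta>. 0 < \<eta> \<Longrightarrow> \<forall>\<^sub>F n in sequentially. cycle_class J k n \<noteq> {} \<longrightarrow>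
      pr (cycle_class J k n) (nat \<lfloor>t * real n\<rfloor>) [] (\<lambda>zs. \<forall>i<nat \<lfloor>t * real n\<rfloor>. \<forall>v\<in>{1..n}.
        real (card (orbit (perm_product (take i zs)) v)) \<le> \<delta> * real n) \<le> \<eta>"
proof -
  define t1 where "t1 = (t + 1 / \<kappa>) / 2"
  \<comment> \<open>The time after \<open>t1\<close> is cut into three parts: sprinkling, counting,
    and a reserve that absorbs the roundings.\<close>
  define w where "w = (t - t1) / 3"
  have inv: "1 / \<kappa> < t" using t \<kappa>_pos by (simp add: pos_divide_less_eq mult.commute)
  have t1: "1 / \<kappa> < t1" "t1 < t" using inv by (auto simp: t1_def)
  have "0 < 1 / \<kappa>" using \<kappa>_pos by simp
  then have t1'_pos: "0 < t1" using t1 by linarith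
  have "1 < \<kappa> * t1" using t1(1) \<kappa>_pos by (simp add: pos_divide_less_eq mult.commute)
  note t1' = t1'_pos this
  have w: "0 < w" using t1 by (simp add: w_def)
  obtain p where p: "0 < p" "p \<le> 1" and mass: "\<And>l :: nat. 1 \<le> l \<Longrightarrow> \<exists>\<epsilon>>0. \<forall>\<delta>>0. \<forall>\<^sub>F n in sequentially. cycle_class J k n \<noteq> {} \<longrightarrow>
      pr (cycle_class J k n) (nat \<lfloor>t1 * real n\<rfloor>) [] (\<lambda>zs. (\<forall>v\<in>{1..n}. real (card (component zs v)) \<le> \<epsilon> * real n) \<and>
        real (card {v\<in>{1..n}. l \<le> card (component zs v)}) < p * real n) \<le> \<delta>"
    by (rule supercritical_mass[OF t1']) (rule that)
  \<comment> \<open>Half of the exponential rate at which sprinkling rules out a fixed cut. Taking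
    \<open>l\<close> large makes the number of cuts grow at a rate of at most \<open>y\<close>, so
    the union bound still decays.\<close>
  define y where "y = w * p\<^sup>2 / 18"
  have y: "0 < y" using w p by (simp add: y_def)
  obtain l :: nat where l: "ln 2 / y \<le> real l" using real_arch_simple by blast
  have l1: "1 \<le> l"
  proof (rule ccontr)
    assume "\<not> 1 \<le> l"
    then have "ln 2 / y \<le> 0" using l by simp
    moreover have "0 < ln 2 / y" using y by simp
    ultimately show False by linarith
  qed
  have ly: "ln 2 / real l \<le> y"
  proof -
    have "ln 2 \<le> real l * y" using l y by (simp add: pos_divide_le_eq)
    then show ?thesis using l1 by (simp add: divide_le_eq mult.commute)
  qed
  obtain \<epsilon> where \<epsilon>: "0 < \<epsilon>" and mass_l: "\<And>\<delta>. 0 < \<delta> \<Longrightarrow> \<forall>\<^sub>F n in sequentially. cycle_class J k n \<noteq> {} \<longrightarrow>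
      pr (cycle_class J k n) (nat \<lfloor>t1 * real n\<rfloor>) [] (\<lambda>zs. (\<forall>v\<in>{1..n}. real (card (component zs v)) \<le> \<epsilon> * real n) \<and>
        real (card {v\<in>{1..n}. l \<le> card (component zs v)}) < p * real n) \<le> \<delta>"
    using mass[OF l1] by blast
  define \<theta> where "\<theta> = min \<epsilon> (p / 3)"
  have \<theta>: "0 < \<theta>" "\<theta> \<le> \<epsilon>" "\<theta> \<le> p / 3" using \<epsilon> p by (auto simp: \<theta>_def)
  \<comment> \<open>Makes \<open>2 * L\<close> times the tolerated \<open>2 * b * m\<close>
    collisions at most \<open>\<theta>\<^sup>2 / 4 * w * n\<close>, a number of redundant steps that
    is exceeded with high probability.\<close>
  define b where "b = min 1 (\<theta>\<^sup>2 * w / (16 * real L * t))"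
  have b: "0 < b" "b \<le> 1" using \<theta> w L_pos t by (auto simp: b_def)
  have bL: "4 * real L * b * t \<le> \<theta>\<^sup>2 / 4 * w"
  proof -
    have "b \<le> \<theta>\<^sup>2 * w / (16 * real L * t)" by (simp add: b_def)
    then have "b * (16 * real L * t) \<le> \<theta>\<^sup>2 * w" using L_pos t by (subst (asm) pos_le_divide_eq) auto
    then show ?thesis by (simp add: algebra_simps)
  qed
  define \<delta> where "\<delta> = b / (2 * real L ^ 2)"
  have \<delta>: "0 < \<delta>" "2 * real L ^ 2 * \<delta> \<le> b" using b L_pos by (auto simp: \<delta>_def)
  show ?thesis
  proof (rule that[OF \<delta>(1)])
    fix \<eta> :: real assume \<eta>: "0 < \<eta>"
    have ev1: "\<forall>\<^sub>F n in sequentially. inj_ratio n L < 2"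
      using inj_ratio_tendsto[of L] by (rule order_tendstoD(2)) simp
    have ev2: "\<forall>\<^sub>F n in sequentially. 2 \<le> \<theta> * real n"
    proof -
      have "filterlim (\<lambda>n. \<theta> * real n) at_top sequentially" using \<theta> by real_asymp
      then show ?thesis by (simp add: filterlim_at_top)
    qed
    have ev3: "\<forall>\<^sub>F n in sequentially. 1 \<le> w * real n"
    proof -
      have "filterlim (\<lambda>n. w * real n) at_top sequentially" using w by real_asymp
      then show ?thesis by (simp add: filterlim_at_top)
    qed
    have ev4: "\<forall>\<^sub>F n in sequentially. exp (p\<^sup>2 / 9) * exp (- y * real n) < \<eta> / 4"
      using y \<eta> by (intro eventually_exp_neg_less) auto
    have ev5: "\<forall>\<^sub>F n in sequentially. 1 * exp (- (\<theta> ^ 4 / 64 * w) * real n) < \<eta> / 4"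
      using \<theta> w \<eta> by (intro eventually_exp_neg_less) auto
    have ev6: "\<forall>\<^sub>F n in sequentially. 1 * exp (- (b\<^sup>2 / 4 * w) * real n) < \<eta> / 4"
      using b w \<eta> by (intro eventually_exp_neg_less) auto
    have ev7: "\<forall>\<^sub>F n in sequentially. cycle_class J k n \<noteq> {} \<longrightarrow>
      pr (cycle_class J k n) (nat \<lfloor>t1 * real n\<rfloor>) [] (\<lambda>zs. (\<forall>v\<in>{1..n}. real (card (component zs v)) \<le> \<epsilon> * real n) \<and>
        real (card {v\<in>{1..n}. l \<le> card (component zs v)}) < p * real n) \<le> \<eta> / 4"
      using \<eta> by (intro mass_l) simp
    show "\<forall>\<^sub>F n in sequentially. cycle_class J k n \<noteq> {} \<longrightarrow>
      pr (cycle_class J k n) (nat \<lfloor>t * real n\<rfloor>) [] (\<lambda>zs. \<forall>i<nat \<lfloor>t * real n\<rfloor>. \<forall>v\<in>{1..n}.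
        real (card (orbit (perm_product (take i zs)) v)) \<le> \<delta> * real n) \<le> \<eta>"
      using ev1 ev2 ev3 ev4 ev5 ev6 ev7 eventually_ge_at_top[of 1]
    proof eventually_elim
      case (elim n)
      show ?case
      proof
        assume ne: "cycle_class J k n \<noteq> {}"
        define \<Gamma> where "\<Gamma> = cycle_class J k n"
        define V where "V = {1..n}"
        interpret pc: perm_class V \<Gamma> L
          using perm_classI[OF elim(8) ne] by (simp add: V_def \<Gamma>_def)
        have card_V: "card V = n" by (simp add: V_def)
        define m where "m = nat \<lfloor>t * real n\<rfloor>"
        define m1 where "m1 = nat \<lfloor>t1 * real n\<rfloor>"
        define m2 where "m2 = nat \<lfloor>w * real n\<rfloor>"
        define m3 where "m3 = m - (m1 + m2)"
        have m: "t * real n - 1 \<le> real m" "real m \<le> t * real n" using t by (auto simp: m_def of_nat_nat)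
        have m1: "real m1 \<le> t1 * real n" using t1' by (simp add: m1_def of_nat_nat)
        have m2: "w * real n - 1 \<le> real m2" "real m2 \<le> w * real n" using w by (auto simp: m2_def of_nat_nat)
        have tw: "t * real n = t1 * real n + 3 * (w * real n)" by (simp add: w_def field_simps)
        have "real (m1 + m2) + w * real n \<le> real m" using m m1 m2 elim(3) tw by simp
        moreover have "0 \<le> w * real n" using w by simp
        ultimately have "real (m1 + m2) \<le> real m" "w * real n \<le> real m - real (m1 + m2)" by linarith+
        then have m3: "m = (m1 + m2) + m3" "w * real n \<le> real m3"
          by (simp_all only: m3_def of_nat_diff of_nat_le_iff le_add_diff_inverse)
        define Q where "Q = (\<lambda>zs. \<forall>i<m. \<forall>v\<in>V. real (card (orbit (perm_product (take i zs)) v)) \<le> \<delta> * real n)"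
        define Q2 where "Q2 = (\<lambda>zs. real (pc.collisions zs) < 2 * b * real m)"
        define R1 where "R1 = (\<lambda>zs. \<not> ((\<forall>v\<in>V. real (card (component zs v)) \<le> \<epsilon> * real n) \<and>
            real (card {v\<in>V. l \<le> card (component zs v)}) < p * real n))"
        define R2 where "R2 = (\<lambda>zs. \<exists>v\<in>V. \<theta> * real n \<le> real (card (component zs v)))"
        have D: "pr \<Gamma> m [] (\<lambda>zs. Q zs \<and> 2 * b * real m \<le> real (pc.collisions zs)) \<le> \<eta> / 4"
        proof -
          have "pr \<Gamma> m [] (\<lambda>zs. Q zs \<and> 2 * b * real m \<le> real (pc.collisions zs)) \<le> exp (- (b\<^sup>2 / 4) * real m)"
            using pc.collisions_bound[of \<delta> b m] \<delta> b elim(1) by (simp add: Q_def card_V)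
          also have "\<dots> \<le> exp (- (b\<^sup>2 / 4 * w) * real n)"
          proof -
            have "w * real n \<le> real m" using m3 by linarith
            then have "b\<^sup>2 / 4 * (w * real n) \<le> b\<^sup>2 / 4 * real m" by (intro mult_left_mono) auto
            then show ?thesis by (simp add: ac_simps)
          qed
          finally show ?thesis using elim(6) by linarith
        qed
        have E: "pr \<Gamma> m3 ys Q2 \<le> \<eta> / 4" if ys: "length ys = m1 + m2" "set ys \<subseteq> \<Gamma>" "R2 ys" for ys
        proof -
          obtain v where v: "v \<in> V" "\<theta> * real n \<le> real (card (component ys v))" using ys(3) by (auto simp: R2_def)
          define A where "A = component ys v"
          have AV: "A \<subseteq> V" using pc.component_in_V[OF ys(2) v(1)] by (simp add: A_def)
          have "pr \<Gamma> m3 ys Q2 = pr \<Gamma> m3 [] (\<lambda>zs. Q2 (ys @ zs))" using pr_shift[of \<Gamma> m3 ys "[]"] by simp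
          also have "\<dots> \<le> pr \<Gamma> m3 [] (\<lambda>zs. real (pc.excess A zs) \<le> \<theta>\<^sup>2 / 4 * real m3)"
          proof (rule pr_mono)
            fix zs assume zs: "length zs = m3" "set zs \<subseteq> \<Gamma>" "Q2 (ys @ [] @ zs)"
            \<comment> \<open>Of the \<open>n\<close> components at the start each merge removes at
              most one and redundant steps save some; the result is at most the number of cycles at
              the end, which is at most \<open>n\<close> minus all merges plus the collision error.
              The merges cancel.\<close>
            have "card (component [] ` V) = n" using card_V by (simp add: card_image)
            then have "n \<le> card (component ys ` V) + pc.merges ys"
              using pc.components_merges[OF L_pos, of "[]" ys v] ys v by simp
            moreover have "card (component ys ` V) + pc.excess A zs \<le> card (component (ys @ zs) ` V) + pc.merges zs"
              using pc.components_merges[OF L_pos, of ys zs v] ys zs v by (simp add: A_def)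
            moreover have "card (component (ys @ zs) ` V) \<le> card (orbit (perm_product (ys @ zs)) ` V)"
              using ys zs pc.\<Gamma>_permutes by (intro card_components_le_orbits pc.finV) auto
            moreover have "card (orbit (perm_product (ys @ zs)) ` V) + pc.merges (ys @ zs) \<le> n + 2 * L * pc.collisions (ys @ zs)"
              using pc.orbits_merges[of "ys @ zs"] ys zs by (simp add: card_V)
            moreover have "pc.merges (ys @ zs) = pc.merges ys + pc.merges zs" by (simp add: pc.merges_def)
            ultimately have "pc.excess A zs \<le> 2 * L * pc.collisions (ys @ zs)" by linarith
            then have "real (pc.excess A zs) \<le> real (2 * L * pc.collisions (ys @ zs))" by (simp only: of_nat_le_iff)
            also have "\<dots> = 2 * real L * real (pc.collisions (ys @ zs))" by simp
            also have "\<dots> \<le> 2 * real L * (2 * b * real m)"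
              using zs(3) by (intro mult_left_mono) (auto simp: Q2_def)
            also have "\<dots> \<le> 2 * real L * (2 * b * (t * real n))"
              using m b by (intro mult_left_mono) auto
            also have "\<dots> = (4 * real L * b * t) * real n" by simp
            also have "\<dots> \<le> (\<theta>\<^sup>2 / 4 * w) * real n" using bL by (intro mult_right_mono) auto
            also have "\<dots> = \<theta>\<^sup>2 / 4 * (w * real n)" by simp
            also have "\<dots> \<le> \<theta>\<^sup>2 / 4 * real m3" using m3 by (intro mult_left_mono) auto
            finally show "real (pc.excess A ([] @ zs)) \<le> \<theta>\<^sup>2 / 4 * real m3" by simp
          qed
          also have "\<dots> \<le> exp (- (\<theta> ^ 4 / 64) * real m3)"
            using v \<theta> elim(2) AV by (intro pc.excess_bound L_pos) (auto simp: A_def card_V)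
          also have "\<dots> \<le> exp (- (\<theta> ^ 4 / 64 * w) * real n)"
          proof -
            have "\<theta> ^ 4 / 64 * (w * real n) \<le> \<theta> ^ 4 / 64 * real m3" using m3 by (intro mult_left_mono) auto
            then show ?thesis by (simp add: ac_simps)
          qed
          finally show ?thesis using elim(5) by linarith
        qed
        have F: "pr \<Gamma> m2 ys (\<lambda>zs. \<not> R2 zs) \<le> \<eta> / 4" if ys: "length ys = m1" "set ys \<subseteq> \<Gamma>" "R1 ys" for ys
        proof (cases "\<exists>v\<in>V. \<epsilon> * real n < real (card (component ys v))")
          case True
          then obtain v where v: "v \<in> V" "\<epsilon> * real n < real (card (component ys v))" by auto
          \<comment> \<open>A component above \<open>\<epsilon> * n\<close> is already present, and
            it persists; sprinkling is only needed otherwise.\<close>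
          have "pr \<Gamma> m2 ys (\<lambda>zs. \<not> R2 zs) = 0"
          proof (rule pr_False)
            fix zs assume zs: "set zs \<subseteq> \<Gamma>"
            have "card (component ys v) \<le> card (component (ys @ zs) v)"
              using pc.finite_component[of "ys @ zs" v] ys zs v component_mono[of ys "ys @ zs" v] by (intro card_mono) auto
            moreover have "\<theta> * real n \<le> \<epsilon> * real n" using \<theta> by (intro mult_right_mono) auto
            ultimately have "\<theta> * real n \<le> real (card (component (ys @ zs) v))" using v by linarith
            then show "\<not> \<not> R2 (ys @ zs)" using v by (auto simp: R2_def)
          qed
          then show ?thesis using \<eta> by simp
        next
          case False
          then have U: "p * real n \<le> real (card {v\<in>V. l \<le> card (component ys v)})"
            using ys(3) unfolding R1_def by force
          have "pr \<Gamma> m2 ys (\<lambda>zs. \<not> R2 zs) \<le> pr \<Gamma> m2 ys (\<lambda>zs. \<forall>v\<in>V. real (card (component zs v)) \<le> p / 3 * real n)"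
          proof (rule pr_mono, rule ballI)
            fix zs v assume "\<not> R2 (ys @ zs)" "v \<in> V"
            then have "real (card (component (ys @ zs) v)) < \<theta> * real n" by (auto simp: R2_def)
            moreover have "\<theta> * real n \<le> p / 3 * real n" using \<theta> by (intro mult_right_mono) auto
            ultimately show "real (card (component (ys @ zs) v)) \<le> p / 3 * real n" by linarith
          qed
          also have "\<dots> \<le> 2 ^ (n div l) * (1 - p\<^sup>2 / 9) ^ m2"
            using pc.sprinkling[OF L_pos ys(2) l1 p(1), of m2] U by (simp add: card_V)
          also have "\<dots> \<le> exp (p\<^sup>2 / 9) * exp (- y * real n)"
          proof -
            have "(2::real) ^ (n div l) = exp (ln 2 * real (n div l))" by (simp add: exp_of_nat2_mult)
            also have "ln 2 * real (n div l) \<le> ln 2 / real l * real n"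
            proof -
              have "real (n div l) \<le> real n / real l" by (rule of_nat_div_le_of_nat)
              then have "ln 2 * real (n div l) \<le> ln 2 * (real n / real l)" by (intro mult_left_mono) auto
              then show ?thesis by simp
            qed
            also have "\<dots> \<le> y * real n" using ly by (intro mult_right_mono) auto
            finally have 1: "(2::real) ^ (n div l) \<le> exp (y * real n)" by simp
            have p2: "p\<^sup>2 \<le> 1" using p by (simp add: power_le_one)
            have "(1 - p\<^sup>2 / 9) ^ m2 \<le> exp (- (p\<^sup>2 / 9)) ^ m2"
              using exp_ge_add_one_self[of "- (p\<^sup>2 / 9)"] p2 by (intro power_mono) auto
            also have "\<dots> = exp (- (p\<^sup>2 / 9) * real m2)" by (simp add: exp_of_nat_mult[symmetric] mult.commute)
            also have "\<dots> \<le> exp (- (p\<^sup>2 / 9) * (w * real n - 1))"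
              using m2 by (intro iffD2[OF exp_le_cancel_iff] mult_left_mono_neg) auto
            also have "- (p\<^sup>2 / 9) * (w * real n - 1) = p\<^sup>2 / 9 - 2 * y * real n"
              by (simp add: y_def field_simps)
            finally have 2: "(1 - p\<^sup>2 / 9) ^ m2 \<le> exp (p\<^sup>2 / 9 - 2 * y * real n)" .
            have "2 ^ (n div l) * (1 - p\<^sup>2 / 9) ^ m2 \<le> exp (y * real n) * exp (p\<^sup>2 / 9 - 2 * y * real n)"
              using 1 2 p2 by (intro mult_mono) auto
            then show ?thesis by (simp add: exp_add[symmetric])
          qed
          finally show ?thesis using elim(4) by linarith
        qed
        have "pr \<Gamma> (m1 + m2) [] (\<lambda>zs. \<not> R2 zs) \<le> pr \<Gamma> m1 [] (\<lambda>zs. \<not> R1 zs) + \<eta> / 4"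
          using F \<eta> by (intro pr_append_le pc.finite_\<Gamma> pc.\<Gamma>_nonempty) auto
        also have "pr \<Gamma> m1 [] (\<lambda>zs. \<not> R1 zs) \<le> \<eta> / 4"
          using elim(7) ne by (simp add: R1_def \<Gamma>_def V_def m1_def)
        finally have G: "pr \<Gamma> (m1 + m2) [] (\<lambda>zs. \<not> R2 zs) \<le> \<eta> / 4 + \<eta> / 4" by simp
        have "pr \<Gamma> m [] Q2 \<le> pr \<Gamma> (m1 + m2) [] (\<lambda>zs. \<not> R2 zs) + \<eta> / 4"
          unfolding m3(1) using E \<eta> by (intro pr_append_le pc.finite_\<Gamma> pc.\<Gamma>_nonempty) auto
        then have Q2: "pr \<Gamma> m [] Q2 \<le> \<eta> / 4 + \<eta> / 4 + \<eta> / 4" using G by linarith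
        have "pr \<Gamma> m [] Q \<le> pr \<Gamma> m [] (\<lambda>zs. (Q zs \<and> 2 * b * real m \<le> real (pc.collisions zs)) \<or> Q2 zs)"
          by (rule pr_mono) (auto simp: Q2_def)
        also have "\<dots> \<le> pr \<Gamma> m [] (\<lambda>zs. Q zs \<and> 2 * b * real m \<le> real (pc.collisions zs)) + pr \<Gamma> m [] Q2"
          by (rule pr_disj)
        also have "\<dots> \<le> \<eta>" using D Q2 by linarith
        finally show "pr (cycle_class J k n) (nat \<lfloor>t * real n\<rfloor>) [] (\<lambda>zs. \<forall>i<nat \<lfloor>t * real n\<rfloor>. \<forall>v\<in>{1..n}.
          real (card (orbit (perm_product (take i zs)) v)) \<le> \<delta> * real n) \<le> \<eta>"
          by (simp add: Q_def \<Gamma>_def V_def m_def)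
      qed
    qed
  qed
qed

section \<open>The Poisson clock and the law of the steps\<close>

lemma nn_integral_power_poisson:
  assumes "0 < r" "0 \<le> z"
  shows "(\<integral>\<^sup>+k. ennreal (z ^ k) \<partial>measure_pmf (poisson_pmf r)) = ennreal (exp (r * (z - 1)))"
proof -
  have "(\<lambda>k. (r * z) ^ k /\<^sub>R fact k * exp (- r)) sums (exp (r * z) * exp (- r))"
    by (intro sums_mult2 exp_converges)
  then have sums: "(\<lambda>k. r ^ k / fact k * exp (- r) * z ^ k) sums exp (r * (z - 1))"
    by (simp add: exp_add[symmetric] power_mult_distrib field_simps)
  have "(\<integral>\<^sup>+k. ennreal (z ^ k) \<partial>measure_pmf (poisson_pmf r)) =
      (\<integral>\<^sup>+k. ennreal (pmf (poisson_pmf r) k) * ennreal (z ^ k) \<partial>count_space UNIV)"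
    by (rule nn_integral_measure_pmf)
  also have "\<dots> = (\<Sum>k. ennreal (r ^ k / fact k * exp (- r) * z ^ k))"
    using assms by (subst nn_integral_count_space_nat) (simp add: ennreal_mult[symmetric])
  also have "\<dots> = ennreal (exp (r * (z - 1)))"
    using assms sums by (intro suminf_ennreal_eq) auto
  finally show ?thesis .
qed

text \<open>Markov's inequality for \<open>z ^ k\<close>. The assumption on \<open>S\<close> covers
  upper tails with \<open>z > 1\<close> and lower tails with \<open>z < 1\<close> alike.\<close>

lemma poisson_chernoff:
  assumes "0 < r" "0 < z" and S: "\<And>k. k \<in> S \<Longrightarrow> z powr a \<le> z ^ k"
  shows "measure (measure_pmf (poisson_pmf r)) S \<le> z powr (- a) * exp (r * (z - 1))"
proof -
  have "emeasure (measure_pmf (poisson_pmf r)) S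
      \<le> emeasure (measure_pmf (poisson_pmf r)) ({k \<in> UNIV. 1 \<le> ennreal (z powr (- a)) * ennreal (z ^ k)})"
  proof (rule emeasure_mono)
    show "S \<subseteq> {k \<in> UNIV. 1 \<le> ennreal (z powr (- a)) * ennreal (z ^ k)}"
    proof
      fix k assume "k \<in> S"
      then have "z powr (- a) * z powr a \<le> z powr (- a) * z ^ k" using S by (intro mult_left_mono) auto
      then have "1 \<le> z powr (- a) * z ^ k" using assms by (simp add: powr_add[symmetric])
      then show "k \<in> {k \<in> UNIV. 1 \<le> ennreal (z powr (- a)) * ennreal (z ^ k)}"
        using assms by (simp add: ennreal_mult[symmetric])
    qed
  qed simp
  also have "\<dots> \<le> ennreal (z powr (- a)) * (\<integral>\<^sup>+k. ennreal (z ^ k) * indicator UNIV k \<partial>measure_pmf (poisson_pmf r))"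
    by (rule nn_integral_Markov_inequality) auto
  also have "\<dots> = ennreal (z powr (- a) * exp (r * (z - 1)))"
    using assms by (simp add: nn_integral_power_poisson ennreal_mult)
  finally show ?thesis
    by (simp add: measure_pmf.emeasure_eq_measure)
qed

lemma poisson_ge_two:
  assumes "0 < r"
  shows "measure (measure_pmf (poisson_pmf r)) {k. 2 \<le> k} \<le> r\<^sup>2"
proof -
  have "{k::nat. 2 \<le> k} = UNIV - {0, 1}" by auto
  then have "measure (measure_pmf (poisson_pmf r)) {k. 2 \<le> k} = 1 - measure (measure_pmf (poisson_pmf r)) {0, 1}"
    using measure_pmf.prob_compl[of "{0, 1}" "poisson_pmf r"] by simp
  also have "measure (measure_pmf (poisson_pmf r)) {0, 1} = (1 + r) * exp (- r)"
    using assms by (simp add: measure_measure_pmf_finite algebra_simps)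
  also have "1 - (1 + r) * exp (- r) \<le> 1 - (1 + r) * (1 - r)"
    using exp_ge_add_one_self[of "- r"] assms by (intro diff_left_mono mult_left_mono) auto
  finally show ?thesis by (simp add: algebra_simps power2_eq_square)
qed

text \<open>The exponent is \<open>b (1 - u + ln u)\<close> with \<open>u = a / b\<close>.\<close>

lemma chernoff_exponent_neg:
  fixes a b :: real
  assumes "0 < a" "0 < b" "a \<noteq> b"
  shows "a * (b / a - 1) - b * ln (b / a) < 0"
proof -
  have u: "0 < a / b" "a / b \<noteq> 1" using assms by auto
  have "ln (a / b) \<noteq> a / b - 1" using ln_eq_minus_one u by blast
  then have "ln (a / b) < a / b - 1" using ln_le_minus_one[OF u(1)] by simp
  then have "b * ln (a / b) < b * (a / b - 1)" using assms by simp
  moreover have "ln (b / a) = - ln (a / b)" using assms by (simp add: ln_div)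
  ultimately show ?thesis using assms by (simp add: algebra_simps)
qed

context poisson_process begin

lemma increment_measurable:
  assumes "0 \<le> s" "0 \<le> t"
  shows "(\<lambda>\<omega>. N t \<omega> - N s \<omega>) \<in> measurable M (count_space UNIV)"
proof -
  have [measurable]: "N t \<in> measurable M (count_space UNIV)" "N s \<in> measurable M (count_space UNIV)"
    using measurable_N assms by auto
  show ?thesis by measurable
qed

lemma prob_increment:
  assumes "0 \<le> s" "s < t"
  shows "prob {\<omega> \<in> space M. N t \<omega> - N s \<omega> \<in> S} = measure (measure_pmf (poisson_pmf (rate * (t - s)))) S"
proof -
  have "measure (distr M (count_space UNIV) (\<lambda>\<omega>. N t \<omega> - N s \<omega>)) S
      = prob ((\<lambda>\<omega>. N t \<omega> - N s \<omega>) -` S \<inter> space M)"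
    using increment_measurable assms by (intro measure_distr) auto
  moreover have "(\<lambda>\<omega>. N t \<omega> - N s \<omega>) -` S \<inter> space M = {\<omega> \<in> space M. N t \<omega> - N s \<omega> \<in> S}" by auto
  ultimately show ?thesis using increments_poisson[OF assms] by simp
qed

lemma prob_N:
  assumes "0 < t"
  shows "prob {\<omega> \<in> space M. N t \<omega> \<in> S} = measure (measure_pmf (poisson_pmf (rate * t))) S"
proof -
  have "{\<omega> \<in> space M. N t \<omega> \<in> S} = {\<omega> \<in> space M. N t \<omega> - N 0 \<omega> \<in> S}"
    using N_zero by auto
  then show ?thesis using prob_increment[of 0 t S] assms by simp
qed

lemma N_pred_sets: "0 \<le> t \<Longrightarrow> {\<omega> \<in> space M. P (N t \<omega>)} \<in> sets M"
  using measurable_sets[OF measurable_N, of t "{k. P k}"] by (simp add: vimage_def Int_def conj_commute)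

end

lemma nat_path_hits:
  fixes f :: "nat \<Rightarrow> nat"
  assumes "f 0 = 0" "\<And>i. i < K \<Longrightarrow> f (Suc i) \<le> Suc (f i)" "j \<le> f K"
  shows "\<exists>i\<le>K. f i = j"
  using assms
proof (induction K)
  case (Suc K)
  show ?case
  proof (cases "j \<le> f K")
    case True
    then show ?thesis using Suc by (meson le_Suc_eq less_SucI)
  next
    case False
    then have "f (Suc K) = j" using Suc.prems(2)[of K] Suc.prems(3) by simp
    then show ?thesis by blast
  qed
qed simp

section \<open>Joint law of the steps, measurability, and the values taken by the clock\<close>

locale finite_step_walk = uniform_step_walk M N \<Gamma> \<gamma> for M N \<Gamma> \<gamma> +
  assumes finite_steps: "finite \<Gamma>"
begin

definition "steps m \<omega> = map (\<lambda>i. \<gamma> i \<omega>) [1..<Suc m]"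

lemma length_steps [simp]: "length (steps m \<omega>) = m"
  by (simp add: steps_def del: upt_Suc)

lemma nth_steps: "i \<in> {1..m} \<Longrightarrow> steps m \<omega> ! (i - 1) = \<gamma> i \<omega>"
  unfolding steps_def by (subst nth_map) (auto simp del: upt_Suc)

lemma step_measurable: "1 \<le> i \<Longrightarrow> \<gamma> i \<in> measurable M (count_space \<Gamma>)"
  using steps_indep by (simp add: indep_vars_def)

lemma step_in: "1 \<le> i \<Longrightarrow> \<omega> \<in> space M \<Longrightarrow> \<gamma> i \<omega> \<in> \<Gamma>"
  using measurable_space[OF step_measurable] by simp

lemma steps_nonempty: "\<Gamma> \<noteq> {}"
  using step_in[of 1] not_empty by auto

lemma step_prob: "1 \<le> i \<Longrightarrow> g \<in> \<Gamma> \<Longrightarrow> prob (\<gamma> i -` {g} \<inter> space M) = 1 / real (card \<Gamma>)"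
proof -
  assume *: "1 \<le> i" "g \<in> \<Gamma>"
  have "prob (\<gamma> i -` {g} \<inter> space M) = measure (distr M (count_space \<Gamma>) (\<gamma> i)) {g}"
    using * step_measurable by (intro measure_distr[symmetric]) auto
  also have "\<dots> = 1 / real (card \<Gamma>)"
    using * finite_steps by (simp add: steps_uniform measure_uniform_count_measure)
  finally show ?thesis .
qed

lemma steps_eq:
  assumes "length gs = m"
  shows "{\<omega> \<in> space M. steps m \<omega> = gs} = (\<Inter>i\<in>{1..m}. \<gamma> i -` {gs ! (i - 1)} \<inter> space M) \<inter> space M"
proof -
  have "steps m \<omega> = gs \<longleftrightarrow> (\<forall>i\<in>{1..m}. \<gamma> i \<omega> = gs ! (i - 1))" for \<omega>
  proof
    assume eq: "steps m \<omega> = gs"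
    then show "\<forall>i\<in>{1..m}. \<gamma> i \<omega> = gs ! (i - 1)" using nth_steps by metis
  next
    assume "\<forall>i\<in>{1..m}. \<gamma> i \<omega> = gs ! (i - 1)"
    then show "steps m \<omega> = gs" using assms by (intro nth_equalityI) (auto simp: steps_def simp del: upt_Suc)
  qed
  then show ?thesis by auto
qed

lemma steps_eq_sets: "length gs = m \<Longrightarrow> set gs \<subseteq> \<Gamma> \<Longrightarrow> {\<omega> \<in> space M. steps m \<omega> = gs} \<in> sets M"
proof -
  assume *: "length gs = m" "set gs \<subseteq> \<Gamma>"
  have "\<gamma> i -` {gs ! (i - 1)} \<inter> space M \<in> sets M" if "i \<in> {1..m}" for i
  proof (rule measurable_sets[OF step_measurable])
    have "gs ! (i - 1) \<in> set gs" using that * by (intro nth_mem) auto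
    then show "{gs ! (i - 1)} \<in> sets (count_space \<Gamma>)" using * by auto
  qed (use that in simp)
  then have "(\<Inter>i\<in>{1..m}. \<gamma> i -` {gs ! (i - 1)} \<inter> space M) \<inter> space M \<in> sets M" if "m \<noteq> 0"
    using that by (intro sets.Int[OF sets.finite_INT sets.top]) auto
  then show ?thesis
    unfolding steps_eq[OF *(1)] by (cases "m = 0") simp_all
qed

lemma steps_eq_prob:
  assumes gs: "length gs = m" "set gs \<subseteq> \<Gamma>"
  shows "prob {\<omega> \<in> space M. steps m \<omega> = gs} = 1 / real (card \<Gamma>) ^ m"
proof (cases "m = 0")
  case True
  then show ?thesis using gs by (simp add: steps_def prob_space)
next
  case False
  have mem: "gs ! (i - 1) \<in> \<Gamma>" if "i \<in> {1..m}" for i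
  proof -
    have "gs ! (i - 1) \<in> set gs" using that gs by (intro nth_mem) auto
    then show ?thesis using gs by auto
  qed
  have "prob {\<omega> \<in> space M. steps m \<omega> = gs} = prob (\<Inter>i\<in>{1..m}. \<gamma> i -` {gs ! (i - 1)} \<inter> space M)"
    unfolding steps_eq[OF gs(1)] using False by (intro arg_cong[where f = prob]) auto
  also have "\<dots> = (\<Prod>i\<in>{1..m}. prob (\<gamma> i -` {gs ! (i - 1)} \<inter> space M))"
    using False mem by (intro indep_varsD[OF steps_indep]) auto
  also have "\<dots> = (\<Prod>i\<in>{1..m}. 1 / real (card \<Gamma>))"
    using mem by (intro prod.cong refl step_prob) auto
  finally show ?thesis by (simp add: power_divide)
qed

lemma steps_decomp:
  "{\<omega> \<in> space M. Q (steps m \<omega>)} = (\<Union>gs\<in>{gs. length gs = m \<and> set gs \<subseteq> \<Gamma> \<and> Q gs}. {\<omega> \<in> space M. steps m \<omega> = gs})"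
proof -
  have "set (steps m \<omega>) \<subseteq> \<Gamma>" if "\<omega> \<in> space M" for \<omega> using step_in that by (auto simp: steps_def)
  then show ?thesis by auto
qed

lemma finite_lists: "finite {gs. length gs = m \<and> set gs \<subseteq> \<Gamma> \<and> Q gs}"
  by (rule finite_subset[OF _ finite_lists_length_eq[OF finite_steps, of m]]) auto

lemma steps_sets: "{\<omega> \<in> space M. Q (steps m \<omega>)} \<in> sets M"
  unfolding steps_decomp using finite_lists steps_eq_sets by (intro sets.finite_UN) auto

text \<open>The first \<open>m\<close> steps are uniform on the lists of length \<open>m\<close>
  over \<open>\<Gamma>\<close>, so that the recursion \<open>pr\<close> computes actual
  probabilities.\<close>

lemma steps_law: "prob {\<omega> \<in> space M. Q (steps m \<omega>)} = pr \<Gamma> m [] Q"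
proof -
  have "prob {\<omega> \<in> space M. Q (steps m \<omega>)} =
      (\<Sum>gs\<in>{gs. length gs = m \<and> set gs \<subseteq> \<Gamma> \<and> Q gs}. prob {\<omega> \<in> space M. steps m \<omega> = gs})"
    unfolding steps_decomp using finite_lists steps_eq_sets
    by (intro finite_measure_finite_Union) (auto simp: disjoint_family_on_def)
  also have "\<dots> = (\<Sum>gs\<in>{gs. length gs = m \<and> set gs \<subseteq> \<Gamma> \<and> Q gs}. 1 / real (card \<Gamma>) ^ m)"
    by (intro sum.cong refl steps_eq_prob) auto
  also have "\<dots> = (\<Sum>gs | length gs = m \<and> set gs \<subseteq> \<Gamma>. of_bool (Q ([] @ gs)) / real (card \<Gamma>) ^ m)"
    using finite_lists_length_eq[OF finite_steps, of m]
    by (intro sum.mono_neutral_cong_left) (auto simp: conj_commute)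
  finally show ?thesis by (simp only: pr_eq_avg[OF finite_steps steps_nonempty])
qed

lemma steps_take: "j \<le> m \<Longrightarrow> take j (steps m \<omega>) = steps j \<omega>"
  by (simp add: steps_def take_map take_upt del: upt_Suc)

lemma walk_steps: "walk \<gamma> N t \<omega> = perm_product (steps (N t \<omega>) \<omega>)"
  by (simp add: walk_def perm_product_def steps_def del: upt_Suc)

lemma walk_sets: "0 \<le> t \<Longrightarrow> {\<omega> \<in> space M. Q (walk \<gamma> N t \<omega>)} \<in> sets M"
proof -
  assume t: "0 \<le> t"
  have "{\<omega> \<in> space M. Q (walk \<gamma> N t \<omega>)} =
      (\<Union>m. {\<omega> \<in> space M. N t \<omega> = m} \<inter> {\<omega> \<in> space M. Q (perm_product (steps m \<omega>))})"
    unfolding walk_steps by auto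
  also have "\<dots> \<in> sets M"
    using N_pred_sets[OF t] steps_sets[of "\<lambda>gs. Q (perm_product gs)"]
    by (intro sets.countable_UN sets.Int subsetI) auto
  finally show ?thesis .
qed

text \<open>The clock is right-continuous with values in the naturals, hence constant on a short
  interval to the right of \<open>s\<close>. This replaces an uncountable union over times by one
  over rationals, for measurability.\<close>

lemma walk_rational:
  assumes \<omega>: "\<omega> \<in> space M" and s: "0 \<le> s" "s < T"
  shows "\<exists>q\<in>\<rat>. 0 \<le> q \<and> q < T \<and> walk \<gamma> N q \<omega> = walk \<gamma> N s \<omega>"
proof -
  have "((\<lambda>u. N u \<omega>) \<longlongrightarrow> N s \<omega>) (at_right s)"
    using right_continuous_N[OF \<omega> s(1)] by (simp add: continuous_within)
  then have "\<forall>\<^sub>F u in at_right s. N u \<omega> = N s \<omega>" by (simp add: tendsto_discrete)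
  then obtain b where b: "s < b" "\<And>u. s < u \<Longrightarrow> u < b \<Longrightarrow> N u \<omega> = N s \<omega>"
    unfolding eventually_at_right[OF s(2)] by blast
  obtain q where q: "q \<in> \<rat>" "s < q" "q < min b T" using Rats_dense_in_real[of s "min b T"] b s by auto
  then have "N q \<omega> = N s \<omega>" using b by simp
  then show ?thesis using q s by (intro bexI[of _ q]) (auto simp: walk_steps)
qed

lemma exists_walk_sets:
  "{\<omega> \<in> space M. \<exists>s. 0 \<le> s \<and> s < T \<and> Q (walk \<gamma> N s \<omega>)} \<in> sets M"
proof -
  have "{\<omega> \<in> space M. \<exists>s. 0 \<le> s \<and> s < T \<and> Q (walk \<gamma> N s \<omega>)} =
      (\<Union>q\<in>{q\<in>\<rat>. 0 \<le> q \<and> q < T}. {\<omega> \<in> space M. Q (walk \<gamma> N q \<omega>)})"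
  proof (intro equalityI subsetI)
    fix \<omega> assume "\<omega> \<in> {\<omega> \<in> space M. \<exists>s. 0 \<le> s \<and> s < T \<and> Q (walk \<gamma> N s \<omega>)}"
    then obtain s where s: "\<omega> \<in> space M" "0 \<le> s" "s < T" "Q (walk \<gamma> N s \<omega>)" by blast
    obtain q where "q \<in> \<rat>" "0 \<le> q" "q < T" "walk \<gamma> N q \<omega> = walk \<gamma> N s \<omega>"
      using walk_rational[OF s(1-3)] by blast
    then show "\<omega> \<in> (\<Union>q\<in>{q\<in>\<rat>. 0 \<le> q \<and> q < T}. {\<omega> \<in> space M. Q (walk \<gamma> N q \<omega>)})"
      using s by auto
  qed blast
  also have "\<dots> \<in> sets M"
    using walk_sets by (intro sets.countable_UN'' countable_subset[OF _ countable_rat]) auto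
  finally show ?thesis .
qed

text \<open>The interval is divided into \<open>K\<close> cells, and two jumps within one cell have
  probability at most the square of its length.\<close>

lemma prob_double_jump:
  assumes "0 < T" "0 < K"
  shows "prob {\<omega> \<in> space M. \<exists>i<K. 2 \<le> N (T * real (Suc i) / real K) \<omega> - N (T * real i / real K) \<omega>} \<le> T\<^sup>2 / real K"
proof -
  let ?E = "\<lambda>i. {\<omega> \<in> space M. N (T * real (Suc i) / real K) \<omega> - N (T * real i / real K) \<omega> \<in> {k. 2 \<le> k}}"
  have sets: "?E i \<in> sets M" for i
    using measurable_sets[OF increment_measurable[of "T * real i / real K" "T * real (Suc i) / real K"], of "{k. 2 \<le> k}"] assms
    by (simp add: vimage_def Int_def conj_commute)
  have one: "prob (?E i) \<le> (T / real K)\<^sup>2" for i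
  proof -
    have "T * real i / real K < T * real (Suc i) / real K" using assms by (simp add: divide_strict_right_mono)
    then have "prob (?E i) = measure (measure_pmf (poisson_pmf (1 * (T * real (Suc i) / real K - T * real i / real K)))) {k. 2 \<le> k}"
      using assms by (intro prob_increment) auto
    also have "1 * (T * real (Suc i) / real K - T * real i / real K) = T / real K"
      by (simp add: diff_divide_distrib[symmetric] algebra_simps)
    also have "measure (measure_pmf (poisson_pmf (T / real K))) {k. 2 \<le> k} \<le> (T / real K)\<^sup>2"
      using assms by (intro poisson_ge_two) simp
    finally show ?thesis .
  qed
  have "{\<omega> \<in> space M. \<exists>i<K. 2 \<le> N (T * real (Suc i) / real K) \<omega> - N (T * real i / real K) \<omega>} = (\<Union>i\<in>{..<K}. ?E i)"
    by auto
  also have "prob \<dots> \<le> (\<Sum>i<K. prob (?E i))"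
    using sets by (intro finite_measure_subadditive_finite) auto
  also have "\<dots> \<le> (\<Sum>i<K. (T / real K)\<^sup>2)" by (intro sum_mono one)
  also have "\<dots> = T\<^sup>2 / real K" using assms by (simp add: power2_eq_square)
  finally show ?thesis .
qed

text \<open>Without double jumps the clock rises by at most one from grid point to grid point, so it
  takes every value up to \<open>N T\<close>. Hence no partial product is skipped by the
  continuous-time walk.\<close>

lemma clock_hits:
  assumes \<omega>: "\<omega> \<in> space M" and "0 < T" "0 < K"
    and "\<not> (\<exists>i<K. 2 \<le> N (T * real (Suc i) / real K) \<omega> - N (T * real i / real K) \<omega>)" and j: "j \<le> N T \<omega>"
  shows "\<exists>s. 0 \<le> s \<and> s \<le> T \<and> N s \<omega> = j"
proof -
  have "\<exists>i\<le>K. N (T * real i / real K) \<omega> = j"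
  proof (rule nat_path_hits)
    show "N (T * real 0 / real K) \<omega> = 0" using N_zero[OF \<omega>] by simp
    show "N (T * real (Suc i) / real K) \<omega> \<le> Suc (N (T * real i / real K) \<omega>)" if "i < K" for i
      using assms(4) that by fastforce
    show "j \<le> N (T * real K / real K) \<omega>" using j assms by simp
  qed
  then obtain i where "i \<le> K" "N (T * real i / real K) \<omega> = j" by auto
  moreover have "T * real i / real K \<le> T" using \<open>i \<le> K\<close> assms by (simp add: pos_divide_le_eq)
  moreover have "0 \<le> T * real i / real K" using assms by simp
  ultimately show ?thesis by blast
qed

text \<open>For \<open>a = 0\<close> the clock is at 0 and the event is empty; the rate 1 is then a
  placeholder that keeps the exponent negative. Otherwise \<open>z = b / a\<close> is the optimal
  Chernoff parameter.\<close>

lemma prob_N_gt: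
  assumes "0 \<le> a" "a < b" "0 < n"
  shows "prob {\<omega> \<in> space M. b * n \<le> real (N (a * n) \<omega>)} \<le> exp (- n * (if a = 0 then 1 else - (a * (b / a - 1) - b * ln (b / a))))"
proof (cases "a = 0")
  case True
  have "0 < b * n" using assms by simp
  then have "{\<omega> \<in> space M. b * n \<le> real (N (a * n) \<omega>)} = {}" using True N_zero by auto
  then have "prob {\<omega> \<in> space M. b * n \<le> real (N (a * n) \<omega>)} = 0" by (simp only: measure_empty)
  then show ?thesis by (simp only:) simp
next
  case False
  have z: "1 < b / a" "0 < b / a" using False assms by auto
  have "{\<omega> \<in> space M. b * n \<le> real (N (a * n) \<omega>)} = {\<omega> \<in> space M. N (a * n) \<omega> \<in> {k. b * n \<le> real k}}" by simp
  also have "prob \<dots> = measure (measure_pmf (poisson_pmf (1 * (a * n)))) {k. b * n \<le> real k}"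
    using False assms by (intro prob_N) simp
  also have "\<dots> \<le> (b / a) powr (- (b * n)) * exp (1 * (a * n) * (b / a - 1))"
    using False assms z by (intro poisson_chernoff) (auto simp: powr_realpow[symmetric] intro: powr_mono)
  also have "\<dots> = exp (n * (a * (b / a - 1) - b * ln (b / a)))"
    using z False assms by (simp add: powr_def exp_add[symmetric] algebra_simps)
  finally show ?thesis using False by (simp add: algebra_simps)
qed

lemma prob_N_lt:
  assumes "0 < b" "b < a" "0 < n"
  shows "prob {\<omega> \<in> space M. real (N (a * n) \<omega>) \<le> b * n} \<le> exp (n * (a * (b / a - 1) - b * ln (b / a)))"
proof -
  have z: "b / a < 1" "0 < b / a" using assms by auto
  have "{\<omega> \<in> space M. real (N (a * n) \<omega>) \<le> b * n} = {\<omega> \<in> space M. N (a * n) \<omega> \<in> {k. real k \<le> b * n}}" by simp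
  also have "prob \<dots> = measure (measure_pmf (poisson_pmf (1 * (a * n)))) {k. real k \<le> b * n}"
    using assms by (intro prob_N) simp
  also have "\<dots> \<le> (b / a) powr (- (b * n)) * exp (1 * (a * n) * (b / a - 1))"
    using assms z by (intro poisson_chernoff) (auto simp: powr_realpow[symmetric] intro!: powr_mono')
  also have "\<dots> = exp (n * (a * (b / a - 1) - b * ln (b / a)))"
    using z assms by (simp add: powr_def exp_add[symmetric] algebra_simps)
  finally show ?thesis .
qed

end

section \<open>Transfer to the continuous-time walk\<close>

lemma measure_tendsto_1:
  fixes M :: "nat \<Rightarrow> 'a measure"
  assumes "\<forall>\<^sub>F n in sequentially. prob_space (M n)"
    and "\<And>\<eta>. 0 < \<eta> \<Longrightarrow> \<forall>\<^sub>F n in sequentially. 1 - \<eta> \<le> measure (M n) (E n)"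
  shows "(\<lambda>n. measure (M n) (E n)) \<longlonglongrightarrow> 1"
proof (rule tendstoI)
  fix e :: real assume "0 < e"
  then have "\<forall>\<^sub>F n in sequentially. 1 - e / 2 \<le> measure (M n) (E n)" by (intro assms(2)) simp
  then show "\<forall>\<^sub>F n in sequentially. dist (measure (M n) (E n)) 1 < e"
    using assms(1)
  proof eventually_elim
    case (elim n)
    then have "measure (M n) (E n) \<le> 1" by (intro prob_space.prob_le_1)
    then show ?case using elim \<open>0 < e\<close> by (simp add: dist_real_def)
  qed
qed

lemma (in cycle_type) critical_time_eq: "critical_time J k = 1 / \<kappa>"
  by (simp add: critical_time_def \<kappa>_def inverse_eq_divide)

theorem theorem2:
  fixes J :: nat and k :: "nat \<Rightarrow> nat"
    and M :: "nat \<Rightarrow> 'a measure"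
    and \<gamma> :: "nat \<Rightarrow> nat \<Rightarrow> 'a \<Rightarrow> (nat \<Rightarrow> nat)"
    and N :: "nat \<Rightarrow> real \<Rightarrow> 'a \<Rightarrow> nat"
  assumes "J \<ge> 2"
    and "\<exists>j\<in>{2..J}. k j \<noteq> 0"
    and "\<And>n. n \<ge> (\<Sum>j=2..J. j * k j) \<Longrightarrow>
           uniform_step_walk (M n) (N n) (cycle_class J k n) (\<gamma> n)"
  shows
    "(\<forall>t. 0 \<le> t \<and> t < critical_time J k \<longrightarrow>
        (\<exists>\<beta>>0. (\<lambda>n. measure (M n)
             {\<omega> \<in> space (M n).
                \<not> (\<exists>c \<in> perm_cycles n (walk (\<gamma> n) (N n) (t * real n) \<omega>).
                     real (card c) > \<beta> * ln (real n))}) \<longlonglongrightarrow> 1)) \<and>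
     (\<forall>t. t > critical_time J k \<longrightarrow>
        (\<exists>\<delta>>0. (\<lambda>n. measure (M n)
             {\<omega> \<in> space (M n).
                giant_cycle_time n (walk (\<gamma> n) (N n)) \<delta> \<omega> < ereal (t * real n)}) \<longlonglongrightarrow> 1))"
proof -
  interpret ct: cycle_type J k using assms(2) by unfold_locales
  have fin: "finite (cycle_class J k n)" for n
    by (rule finite_subset[OF _ finite_permutations[of "{1..n}"]]) (auto simp: cycle_class_def)
  have walk: "finite_step_walk (M n) (N n) (cycle_class J k n) (\<gamma> n)" if "n \<ge> ct.L" for n
    using assms(3)[of n] that fin by (simp add: ct.L_def finite_step_walk_def finite_step_walk_axioms_def)
  have ev_L: "\<forall>\<^sub>F n in sequentially. ct.L \<le> n" by (rule eventually_ge_at_top)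
  have ev_prob: "\<forall>\<^sub>F n in sequentially. prob_space (M n)"
    using ev_L
  proof eventually_elim
    case (elim n)
    interpret finite_step_walk "M n" "N n" "cycle_class J k n" "\<gamma> n" by (rule walk[OF elim])
    show ?case by (rule prob_space_axioms)
  qed
  have subcritical: "\<exists>\<beta>>0. (\<lambda>n. measure (M n)
             {\<omega> \<in> space (M n).
                \<not> (\<exists>c \<in> perm_cycles n (walk (\<gamma> n) (N n) (t * real n) \<omega>).
                     real (card c) > \<beta> * ln (real n))}) \<longlonglongrightarrow> 1"
    if t: "0 \<le> t" "t < critical_time J k" for t
  proof -
    \<comment> \<open>Room between \<open>t\<close> and the critical time: with high probability
      fewer than \<open>t1 * n\<close> steps have occurred at time \<open>t * n\<close>, so the
      bound for a fixed number of steps applies.\<close>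
    define t1 where "t1 = (t + 1 / ct.\<kappa>) / 2"
    have t1: "t < t1" "t1 < 1 / ct.\<kappa>" using t by (auto simp: t1_def ct.critical_time_eq)
    have t1': "0 < t1" "ct.\<kappa> * t1 < 1" using t1 t ct.\<kappa>_pos by (simp_all add: pos_less_divide_eq mult.commute)
    obtain \<beta> where \<beta>: "0 < \<beta>" and comp: "\<And>\<eta>. 0 < \<eta> \<Longrightarrow> \<forall>\<^sub>F n in sequentially. cycle_class J k n \<noteq> {} \<longrightarrow>
      pr (cycle_class J k n) (nat \<lfloor>t1 * real n\<rfloor>) [] (\<lambda>zs. \<exists>v\<in>{1..n}. \<beta> * ln (real n) < real (card (component zs v))) \<le> \<eta>"
      by (rule ct.subcritical_components[OF t1']) (rule that)
    define x where "x = (if t = 0 then 1 else - (t * (t1 / t - 1) - t1 * ln (t1 / t)))"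
    have x: "0 < x" using chernoff_exponent_neg[of t t1] t t1 by (auto simp: x_def)
    show ?thesis
    proof (intro exI[of _ \<beta>] conjI \<beta> measure_tendsto_1 ev_prob)
      fix \<eta> :: real assume \<eta>: "0 < \<eta>"
      have "\<forall>\<^sub>F n in sequentially. 1 * exp (- x * real n) < \<eta> / 2"
        using x \<eta> by (intro eventually_exp_neg_less) auto
      moreover have "\<forall>\<^sub>F n in sequentially. cycle_class J k n \<noteq> {} \<longrightarrow>
         pr (cycle_class J k n) (nat \<lfloor>t1 * real n\<rfloor>) [] (\<lambda>zs. \<exists>v\<in>{1..n}. \<beta> * ln (real n) < real (card (component zs v))) \<le> \<eta> / 2"
        using \<eta> by (intro comp) simp
      ultimately show "\<forall>\<^sub>F n in sequentially. 1 - \<eta> \<le> measure (M n)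
             {\<omega> \<in> space (M n).
                \<not> (\<exists>c \<in> perm_cycles n (walk (\<gamma> n) (N n) (t * real n) \<omega>).
                     real (card c) > \<beta> * ln (real n))}"
        using ev_L eventually_ge_at_top[of 1]
      proof eventually_elim
        case (elim n)
        interpret finite_step_walk "M n" "N n" "cycle_class J k n" "\<gamma> n" by (rule walk[OF elim(3)])
        define m where "m = nat \<lfloor>t1 * real n\<rfloor>"
        define Q where "Q = (\<lambda>\<sigma>. \<not> (\<exists>c \<in> perm_cycles n \<sigma>. real (card c) > \<beta> * ln (real n)))"
        define E where "E = {\<omega> \<in> space (M n). Q (walk (\<gamma> n) (N n) (t * real n) \<omega>)}"
        define A where "A = {\<omega> \<in> space (M n). t1 * real n \<le> real (N n (t * real n) \<omega>)}"
        define B where "B = {\<omega> \<in> space (M n). \<exists>v\<in>{1..n}. \<beta> * ln (real n) < real (card (component (steps m \<omega>) v))}"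
        have n0: "0 < real n" using elim by simp
        have tn: "0 \<le> t * real n" using t by simp
        have sets: "E \<in> sets (M n)" "A \<in> sets (M n)" "B \<in> sets (M n)"
          unfolding E_def A_def B_def by (rule walk_sets[OF tn] N_pred_sets[OF tn] steps_sets)+
        \<comment> \<open>If at most \<open>m\<close> steps have occurred, every cycle of their
          product lies in a component of the first \<open>m\<close> steps, so a long cycle forces a
          large component.\<close>
        have "space (M n) - E \<subseteq> A \<union> B"
        proof
          fix \<omega> assume "\<omega> \<in> space (M n) - E"
          then have \<omega>: "\<omega> \<in> space (M n)" "\<not> Q (walk (\<gamma> n) (N n) (t * real n) \<omega>)" by (auto simp: E_def)
          show "\<omega> \<in> A \<union> B"
          proof (cases "N n (t * real n) \<omega> \<le> m")
            case True
            let ?j = "N n (t * real n) \<omega>"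
            obtain v where v: "v \<in> {1..n}" "\<beta> * ln (real n) < real (card (orbit (perm_product (steps ?j \<omega>)) v))"
              using \<omega>(2) by (auto simp: Q_def perm_cycles_def walk_steps)
            have perms: "g permutes {1..n}" if g: "g \<in> set (steps m \<omega>)" for g
            proof -
              obtain i where i: "g = \<gamma> n i \<omega>" "1 \<le> i" using g by (auto simp: steps_def simp del: upt_Suc)
              show ?thesis unfolding i(1) by (rule cycle_class_permutes[OF step_in[OF i(2) \<omega>(1)]])
            qed
            have "orbit (perm_product (steps ?j \<omega>)) v \<subseteq> component (steps ?j \<omega>) v"
              by (rule orbit_perm_product_subset)
            also have "\<dots> \<subseteq> component (steps m \<omega>) v"
              using steps_take[OF True, of \<omega>] set_take_subset[of ?j "steps m \<omega>"] by (intro component_mono) simp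
            finally have "card (orbit (perm_product (steps ?j \<omega>)) v) \<le> card (component (steps m \<omega>) v)"
              using component_subset_carrier[of "steps m \<omega>" "{1..n}" v, OF perms v(1)] finite_subset
              by (intro card_mono) auto
            then have "\<beta> * ln (real n) < real (card (component (steps m \<omega>) v))" using v(2) by linarith
            then show ?thesis using v(1) \<omega>(1) by (auto simp: B_def)
          next
            case False
            then have "t1 * real n \<le> real (N n (t * real n) \<omega>)" by (simp add: m_def) linarith
            then show ?thesis using \<omega>(1) by (simp add: A_def)
          qed
        qed
        then have "prob (space (M n) - E) \<le> prob (A \<union> B)" using sets by (intro finite_measure_mono) auto
        also have "\<dots> \<le> prob A + prob B" using sets by (intro measure_Un_le)
        also have "prob A \<le> \<eta> / 2"
          using prob_N_gt[OF t(1) t1(1) n0] elim(1) unfolding A_def x_def by (simp add: mult.commute)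
        also have "prob B = pr (cycle_class J k n) m [] (\<lambda>zs. \<exists>v\<in>{1..n}. \<beta> * ln (real n) < real (card (component zs v)))"
          unfolding B_def by (rule steps_law)
        also have "\<dots> \<le> \<eta> / 2" using elim(2) steps_nonempty by (simp add: m_def)
        finally have "prob (space (M n) - E) \<le> \<eta>" by simp
        then have "1 - \<eta> \<le> prob E" using prob_compl[OF sets(1)] by simp
        then show ?case by (simp only: E_def Q_def)
      qed
    qed
  qed
  moreover have supercritical: "\<exists>\<delta>>0. (\<lambda>n. measure (M n)
             {\<omega> \<in> space (M n).
                giant_cycle_time n (walk (\<gamma> n) (N n)) \<delta> \<omega> < ereal (t * real n)}) \<longlonglongrightarrow> 1"
    if t: "t > critical_time J k" for t
  proof -
    \<comment> \<open>The order is critical time, \<open>t2\<close>, \<open>t3\<close>,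
      \<open>t\<close>: the discrete result is used for \<open>t2 * n\<close> steps, with high
      probability more than these have occurred at time \<open>t3 * n\<close>, and
      \<open>t3 < t\<close> makes the hitting time strictly smaller than
      \<open>t * n\<close>.\<close>
    define t2 where "t2 = (t + 2 * (1 / ct.\<kappa>)) / 3"
    define t3 where "t3 = (2 * t + 1 / ct.\<kappa>) / 3"
    have t2: "1 / ct.\<kappa> < t2" "t2 < t3" "t3 < t" using t by (auto simp: t2_def t3_def ct.critical_time_eq)
    have "0 < 1 / ct.\<kappa>" using ct.\<kappa>_pos by simp
    then have t2_pos: "0 < t2" using t2 by linarith
    have t2_gt: "1 < ct.\<kappa> * t2" using t2(1) ct.\<kappa>_pos by (simp add: pos_divide_less_eq mult.commute)
    obtain \<delta> where \<delta>: "0 < \<delta>" and cyc: "\<And>\<eta>. 0 < \<eta> \<Longrightarrow> \<forall>\<^sub>F n in sequentially. cycle_class J k n \<noteq> {} \<longrightarrow>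
      pr (cycle_class J k n) (nat \<lfloor>t2 * real n\<rfloor>) [] (\<lambda>zs. \<forall>i<nat \<lfloor>t2 * real n\<rfloor>. \<forall>v\<in>{1..n}.
        real (card (orbit (perm_product (take i zs)) v)) \<le> \<delta> * real n) \<le> \<eta>"
      by (rule ct.supercritical_cycles[OF t2_pos t2_gt]) (rule that)
    define x where "x = - (t3 * (t2 / t3 - 1) - t2 * ln (t2 / t3))"
    have x: "0 < x" using chernoff_exponent_neg[of t3 t2] t2_pos t2 by (simp add: x_def)
    show ?thesis
    proof (intro exI[of _ \<delta>] conjI \<delta> measure_tendsto_1 ev_prob)
      fix \<eta> :: real assume \<eta>: "0 < \<eta>"
      have "\<forall>\<^sub>F n in sequentially. 1 * exp (- x * real n) < \<eta> / 3"
        using x \<eta> by (intro eventually_exp_neg_less) auto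
      moreover have "\<forall>\<^sub>F n in sequentially. t3\<^sup>2 * (1 / real n) < \<eta> / 3"
      proof -
        have "(\<lambda>n. t3\<^sup>2 * (1 / real n)) \<longlonglongrightarrow> 0" by (rule tendsto_mult_right_zero) real_asymp
        then show ?thesis using \<eta> by (intro order_tendstoD(2)) auto
      qed
      moreover have "\<forall>\<^sub>F n in sequentially. cycle_class J k n \<noteq> {} \<longrightarrow>
        pr (cycle_class J k n) (nat \<lfloor>t2 * real n\<rfloor>) [] (\<lambda>zs. \<forall>i<nat \<lfloor>t2 * real n\<rfloor>. \<forall>v\<in>{1..n}.
          real (card (orbit (perm_product (take i zs)) v)) \<le> \<delta> * real n) \<le> \<eta> / 3"
        using \<eta> by (intro cyc) simp
      ultimately show "\<forall>\<^sub>F n in sequentially. 1 - \<eta> \<le> measure (M n)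
             {\<omega> \<in> space (M n). giant_cycle_time n (walk (\<gamma> n) (N n)) \<delta> \<omega> < ereal (t * real n)}"
        using ev_L eventually_ge_at_top[of 1]
      proof eventually_elim
        case (elim n)
        interpret finite_step_walk "M n" "N n" "cycle_class J k n" "\<gamma> n" by (rule walk[OF elim(4)])
        define m where "m = nat \<lfloor>t2 * real n\<rfloor>"
        define T where "T = t3 * real n"
        \<comment> \<open>So fine a grid makes the probability bound \<open>T\<^sup>2 / K\<close>
          for a double jump of order \<open>1 / n\<close>.\<close>
        define K where "K = n ^ 3"
        define Q where "Q = (\<lambda>\<sigma>. \<exists>v\<in>{1..n}. \<delta> * real n < real (card (orbit \<sigma> v)))"
        define E where "E = {\<omega> \<in> space (M n). \<exists>s. 0 \<le> s \<and> s < t * real n \<and> Q (walk (\<gamma> n) (N n) s \<omega>)}"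
        define A where "A = {\<omega> \<in> space (M n). real (N n T \<omega>) \<le> t2 * real n}"
        define B where "B = {\<omega> \<in> space (M n). \<exists>i<K. 2 \<le> N n (T * real (Suc i) / real K) \<omega> - N n (T * real i / real K) \<omega>}"
        define C where "C = {\<omega> \<in> space (M n). \<forall>i<m. \<forall>v\<in>{1..n}.
          real (card (orbit (perm_product (take i (steps m \<omega>))) v)) \<le> \<delta> * real n}"
        have n0: "0 < real n" "0 < K" using elim by (simp_all add: K_def)
        have T: "0 < T" "T < t * real n" using t2_pos t2 n0 by (simp_all add: T_def)
        have sets_E: "E \<in> sets (M n)" unfolding E_def by (rule exists_walk_sets)
        have sets_A: "A \<in> sets (M n)" unfolding A_def using T by (intro N_pred_sets) simp
        have sets_C: "C \<in> sets (M n)" unfolding C_def by (rule steps_sets)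
        have sets_B: "B \<in> sets (M n)"
        proof -
          have "B = (\<Union>i<K. {\<omega> \<in> space (M n). N n (T * real (Suc i) / real K) \<omega> - N n (T * real i / real K) \<omega> \<in> {2..}})"
            by (auto simp: B_def)
          moreover have "{\<omega> \<in> space (M n). N n (T * real (Suc i) / real K) \<omega> - N n (T * real i / real K) \<omega> \<in> {2..}} \<in> sets (M n)" for i
            using measurable_sets[OF increment_measurable[of "T * real i / real K" "T * real (Suc i) / real K"], of "{2..}"] T
            by (simp add: vimage_def Int_def conj_commute)
          ultimately show ?thesis by simp
        qed
        have "space (M n) - E \<subseteq> A \<union> (B \<union> C)"
        proof
          fix \<omega> assume "\<omega> \<in> space (M n) - E"
          then have \<omega>: "\<omega> \<in> space (M n)" and noE: "\<And>s. 0 \<le> s \<Longrightarrow> s < t * real n \<Longrightarrow> \<not> Q (walk (\<gamma> n) (N n) s \<omega>)"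
            by (auto simp: E_def)
          show "\<omega> \<in> A \<union> (B \<union> C)"
          proof (rule ccontr)
            assume no: "\<omega> \<notin> A \<union> (B \<union> C)"
            then have "t2 * real n < real (N n T \<omega>)" using \<omega> by (simp add: A_def)
            then have mN: "m \<le> N n T \<omega>" unfolding m_def by linarith
            obtain i v where i: "i < m" "v \<in> {1..n}" "\<delta> * real n < real (card (orbit (perm_product (take i (steps m \<omega>))) v))"
              using no \<omega> unfolding C_def by (auto simp: not_le)
            have "\<exists>s. 0 \<le> s \<and> s \<le> T \<and> N n s \<omega> = i"
              using no \<omega> T n0 i mN by (intro clock_hits[of _ _ K]) (auto simp: B_def)
            then obtain s where s: "0 \<le> s" "s \<le> T" "N n s \<omega> = i" by auto
            have "take i (steps m \<omega>) = steps i \<omega>" using i by (intro steps_take) simp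
            then have "Q (walk (\<gamma> n) (N n) s \<omega>)" using i s unfolding Q_def walk_steps by auto
            then show False using noE[of s] s T by linarith
          qed
        qed
        then have "prob (space (M n) - E) \<le> prob (A \<union> (B \<union> C))"
          using sets_A sets_B sets_C by (intro finite_measure_mono) auto
        also have "\<dots> \<le> prob A + prob (B \<union> C)" using sets_A sets_B sets_C by (intro measure_Un_le) auto
        also have "prob (B \<union> C) \<le> prob B + prob C" using sets_B sets_C by (intro measure_Un_le)
        also have "prob A \<le> \<eta> / 3"
          using prob_N_lt[OF t2_pos t2(2) n0(1)] elim(1) unfolding A_def x_def T_def by (simp add: mult.commute)
        also have "prob B \<le> \<eta> / 3"
        proof -
          have "prob B \<le> T\<^sup>2 / real K" unfolding B_def by (rule prob_double_jump[OF T(1) n0(2)])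
          also have "\<dots> = t3\<^sup>2 * (1 / real n)" using n0 by (simp add: T_def K_def power2_eq_square power3_eq_cube)
          finally show ?thesis using elim(2) by linarith
        qed
        also have "prob C = pr (cycle_class J k n) m [] (\<lambda>zs. \<forall>i<m. \<forall>v\<in>{1..n}.
            real (card (orbit (perm_product (take i zs)) v)) \<le> \<delta> * real n)"
          unfolding C_def by (rule steps_law)
        also have "\<dots> \<le> \<eta> / 3" using elim(3) steps_nonempty by (simp add: m_def)
        finally have "prob (space (M n) - E) \<le> \<eta>" by simp
        then have "1 - \<eta> \<le> prob E" using prob_compl[OF sets_E] by simp
        \<comment> \<open>An infimum lies strictly below \<open>t * n\<close> exactly if some
          element of the set does, so attainment of the infimum is not an issue.\<close>
        moreover have "E = {\<omega> \<in> space (M n). giant_cycle_time n (walk (\<gamma> n) (N n)) \<delta> \<omega> < ereal (t * real n)}"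
        proof -
          have large: "\<delta> * real n < real (largest_cycle n \<sigma>) \<longleftrightarrow> Q \<sigma>" for \<sigma>
          proof -
            have fin_cyc: "finite (card ` perm_cycles n \<sigma>)" "card ` perm_cycles n \<sigma> \<noteq> {}"
              using elim by (auto simp: perm_cycles_def)
            have "\<delta> * real n < real (largest_cycle n \<sigma>) \<longleftrightarrow> (\<exists>x\<in>card ` perm_cycles n \<sigma>. \<delta> * real n < real x)"
            proof
              assume "\<delta> * real n < real (largest_cycle n \<sigma>)"
              then show "\<exists>x\<in>card ` perm_cycles n \<sigma>. \<delta> * real n < real x"
                using Max_in[OF fin_cyc] by (auto simp: largest_cycle_def)
            next
              assume "\<exists>x\<in>card ` perm_cycles n \<sigma>. \<delta> * real n < real x"
              then obtain x where x: "x \<in> card ` perm_cycles n \<sigma>" "\<delta> * real n < real x" by blast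
              then have "x \<le> largest_cycle n \<sigma>" unfolding largest_cycle_def by (intro Max_ge fin_cyc)
              then show "\<delta> * real n < real (largest_cycle n \<sigma>)" using x(2) by linarith
            qed
            then show ?thesis by (simp add: Q_def perm_cycles_def)
          qed
          have "giant_cycle_time n (walk (\<gamma> n) (N n)) \<delta> \<omega> < ereal (t * real n) \<longleftrightarrow>
              (\<exists>s. 0 \<le> s \<and> s < t * real n \<and> Q (walk (\<gamma> n) (N n) s \<omega>))" for \<omega>
            unfolding giant_cycle_time_def Inf_less_iff large by auto
          then show ?thesis by (simp add: E_def)
        qed
        ultimately show ?case by simp
      qed
    qed
  qed
  ultimately show ?thesis by blast
qed

end
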